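(* Let $X$ be a complex Banach space, $0<\alpha<1$, $T>0$, let $A$ satisfy Condition (A), and let $0<\sigma<1-\alpha$. Let $F\in C^{\sigma}([0,T];X)$ with $F(0)=0$, and set $u(t)=\int_0^tK(t-s)F(s)\,ds$. Then $Au,\ \partial_t^{\alpha}u\in C^{\sigma}([0,T];X)$ and $\partial_t^{\alpha}u(t)=Au(t)+F(t)$ for $0<t<T$. Moreover there is a constant $C>0$ independent of $F$ such that $$\|Au\|_{C^{\sigma}([0,T];X)}+\|\partial_t^{\alpha}u\|_{C^{\sigma}([0,T];X)}\le C\|F\|_{C^{\sigma}([0,T];X)}.$$
   Context: Condition (A) on $A:\mathcal{D}(A)\subset X\to X$: (i) closed, densely defined; (ii) there is $\vartheta\in(\pi/2,\pi)$ with $\Sigma_{\vartheta}:=\{z\in\mathbb{C}\setminus\{0\}:|\arg z|<\vartheta\}\subset\rho(A)$; (iii) for every $\epsilon\in(0,\vartheta)$, $\|(\lambda-A)^{-1}\|\le C_\epsilon/|\lambda|$ for $\lambda\in\Sigma_{\vartheta-\epsilon}$; (iv) $0\in\rho(A)$. $J^{\beta}v(t)=\frac{1}{\Gamma(\beta)}\int_0^t(t-s)^{\beta-1}v(s)\,ds$; for fixed $1\le q\le\infty$, $\partial_t^{\alpha}:=(J^{\alpha})^{-1}$ with domain $J^{\alpha}L^q(0,T;X)$. For $t>0$, $G(t)a:=\frac{1}{2\pi i}\int_{\Gamma}e^{\lambda t}\lambda^{\alpha-1}(\lambda^{\alpha}-A)^{-1}a\,d\lambda$ (principal branches), $\Gamma=\{\rho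 e^{-i\vartheta}:\rho>1/t\}\cup\{t^{-1}e^{i\theta}:|\theta|\le\vartheta\}\cup\{\rho e^{i\vartheta}:\rho>1/t\}$ oriented from $\infty e^{-i\vartheta}$ to $\infty e^{i\vartheta}$, and $K(t)a:=\frac{d}{dt}(J^{\alpha}(G(\cdot)a))(t)$. $C^{\sigma}([0,T];X)$ is the space of $u\in C([0,T];X)$ with $\sup_{0\le t<s\le T}\|u(s)-u(t)\|/|s-t|^{\sigma}<\infty$, normed by $\|u\|_{C([0,T];X)}$ plus this seminorm. *)

theory Defs
  imports "HOL-Analysis.Analysis"
begin

text \<open>A complex Banach space is modelled as a real Banach space (type class banach)
together with a complex scalar multiplication smc extending the real one and
compatible with the norm.\<close>

definition complex_structure :: "(complex \<Rightarrow> 'x::real_normed_vector \<Rightarrow> 'x) \<Rightarrow> bool" where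
  "complex_structure smc \<longleftrightarrow>
     (\<forall>r x. smc (complex_of_real r) x = r *\<^sub>R x) \<and>
     (\<forall>a b x. smc (a * b) x = smc a (smc b x)) \<and>
     (\<forall>a b x. smc (a + b) x = smc a x + smc b x) \<and>
     (\<forall>a x y. smc a (x + y) = smc a x + smc a y) \<and>
     (\<forall>a x. norm (smc a x) = cmod a * norm x)"

definition closed_dense_op ::
  "(complex \<Rightarrow> 'x::real_normed_vector \<Rightarrow> 'x) \<Rightarrow> 'x set \<Rightarrow> ('x \<Rightarrow> 'x) \<Rightarrow> bool" where
  "closed_dense_op smc D A \<longleftrightarrow>
     0 \<in> D \<and> (\<forall>x\<in>D. \<forall>y\<in>D. x + y \<in> D) \<and> (\<forall>c. \<forall>x\<in>D. smc c x \<in> D) \<and>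
     (\<forall>x\<in>D. \<forall>y\<in>D. A (x + y) = A x + A y) \<and> (\<forall>c. \<forall>x\<in>D. A (smc c x) = smc c (A x)) \<and>
     closed {(x, A x) | x. x \<in> D} \<and> closure D = UNIV"

definition resolvent_set ::
  "(complex \<Rightarrow> 'x::real_normed_vector \<Rightarrow> 'x) \<Rightarrow> 'x set \<Rightarrow> ('x \<Rightarrow> 'x) \<Rightarrow> complex set" where
  "resolvent_set smc D A =
     {\<mu>. (\<forall>a. \<exists>!x. x \<in> D \<and> smc \<mu> x - A x = a) \<and>
         (\<exists>M. \<forall>x\<in>D. norm x \<le> M * norm (smc \<mu> x - A x))}"

definition resolvent ::
  "(complex \<Rightarrow> 'x::real_normed_vector \<Rightarrow> 'x) \<Rightarrow> 'x set \<Rightarrow> ('x \<Rightarrow> 'x) \<Rightarrow> complex \<Rightarrow> 'x \<Rightarrow> 'x" where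
  "resolvent smc D A \<mu> a = (THE x. x \<in> D \<and> smc \<mu> x - A x = a)"

definition sector :: "real \<Rightarrow> complex set" where
  "sector \<theta> = {z. z \<noteq> 0 \<and> \<bar>Arg z\<bar> < \<theta>}"

definition condition_A ::
  "(complex \<Rightarrow> 'x::real_normed_vector \<Rightarrow> 'x) \<Rightarrow> 'x set \<Rightarrow> ('x \<Rightarrow> 'x) \<Rightarrow> real \<Rightarrow> bool" where
  "condition_A smc D A th \<longleftrightarrow>
     closed_dense_op smc D A \<and>
     pi / 2 < th \<and> th < pi \<and> sector th \<subseteq> resolvent_set smc D A \<and>
     (\<forall>\<epsilon>. 0 < \<epsilon> \<and> \<epsilon> < th \<longrightarrow>
        (\<exists>C. \<forall>z\<in>sector (th - \<epsilon>). \<forall>a.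
            norm (resolvent smc D A z a) \<le> C / cmod z * norm a)) \<and>
     0 \<in> resolvent_set smc D A"

definition frac_int :: "real \<Rightarrow> (real \<Rightarrow> 'x::real_normed_vector) \<Rightarrow> real \<Rightarrow> 'x" where
  "frac_int \<beta> v t = integral {0..t} (\<lambda>s. ((t - s) powr (\<beta> - 1) / Gamma \<beta>) *\<^sub>R v s)"

definition G_integrand ::
  "(complex \<Rightarrow> 'x::real_normed_vector \<Rightarrow> 'x) \<Rightarrow> 'x set \<Rightarrow> ('x \<Rightarrow> 'x) \<Rightarrow> real \<Rightarrow> real \<Rightarrow> 'x \<Rightarrow> complex \<Rightarrow> 'x" where
  "G_integrand smc D A \<alpha> t a z =
     smc (exp (z * complex_of_real t) * z powr (complex_of_real (\<alpha> - 1)))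
         (resolvent smc D A (z powr complex_of_real \<alpha>) a)"

text \<open>G(t)a as the contour integral over Gamma, written via the parametrisations of
its three pieces: the lower ray (traversed inwards), the arc of radius 1/t, and
the upper ray (traversed outwards). The contour integral of f along gamma is the
integral of gamma'(s) * f(gamma(s)).\<close>

definition G_op ::
  "(complex \<Rightarrow> 'x::real_normed_vector \<Rightarrow> 'x) \<Rightarrow> 'x set \<Rightarrow> ('x \<Rightarrow> 'x) \<Rightarrow> real \<Rightarrow> real \<Rightarrow> real \<Rightarrow> 'x \<Rightarrow> 'x" where
  "G_op smc D A \<alpha> th t a =
     (let f = G_integrand smc D A \<alpha> t a in
      smc (1 / (2 * complex_of_real pi * \<i>))
        (- integral {1 / t..} (\<lambda>\<rho>. smc (cis (- th)) (f (complex_of_real \<rho> * cis (- th))))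
         + integral {- th..th}
             (\<lambda>\<theta>. smc (\<i> * cis \<theta> / complex_of_real t) (f (cis \<theta> / complex_of_real t)))
         + integral {1 / t..} (\<lambda>\<rho>. smc (cis th) (f (complex_of_real \<rho> * cis th)))))"

definition K_op ::
  "(complex \<Rightarrow> 'x::real_normed_vector \<Rightarrow> 'x) \<Rightarrow> 'x set \<Rightarrow> ('x \<Rightarrow> 'x) \<Rightarrow> real \<Rightarrow> real \<Rightarrow> real \<Rightarrow> 'x \<Rightarrow> 'x" where
  "K_op smc D A \<alpha> th t a =
     vector_derivative (\<lambda>\<tau>. frac_int \<alpha> (\<lambda>s. G_op smc D A \<alpha> th s a) \<tau>) (at t)"

definition holder_space :: "real \<Rightarrow> real \<Rightarrow> (real \<Rightarrow> 'x::real_normed_vector) \<Rightarrow> bool" where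
  "holder_space T \<sigma> u \<longleftrightarrow> continuous_on {0..T} u \<and>
     (\<exists>M. \<forall>t s. 0 \<le> t \<and> t < s \<and> s \<le> T \<longrightarrow> norm (u s - u t) \<le> M * (s - t) powr \<sigma>)"

definition holder_norm :: "real \<Rightarrow> real \<Rightarrow> (real \<Rightarrow> 'x::real_normed_vector) \<Rightarrow> real" where
  "holder_norm T \<sigma> u =
     (SUP t\<in>{0..T}. norm (u t)) +
     (SUP p\<in>{(t, s). 0 \<le> t \<and> t < s \<and> s \<le> T}. norm (u (snd p) - u (fst p)) / (snd p - fst p) powr \<sigma>)"

end

theory Submission
  imports Defs "HOL-Complex_Analysis.Complex_Analysis"
begin

text \<open>Write \<open>S = A\<^sup>-\<^sup>1\<close>. Estimating the contour integral over the arc of radius \<open>1 / t\<close> gives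
\<open>\<parallel>G\<^sup>(\<^sup>j\<^sup>)(t)\<parallel> \<le> C t\<^sup>-\<^sup>j\<close>, and \<open>J\<^sup>\<alpha> G(t) = S (G(t) - I)\<close>: exchanging the integrals replaces \<open>e\<^sup>\<lambda>\<^sup>t\<close> by
\<open>\<lambda>\<^sup>-\<^sup>\<alpha> e\<^sup>\<lambda>\<^sup>t\<close> up to a remainder that decays in the sector, so that its contour integral vanishes
as the arc moves to infinity. Hence \<open>K = S G'\<close> and \<open>u = S (w - F)\<close> with
\<open>w(t) = \<integral>\<^sub>0\<^sup>t G'(t - s) (F(s) - F(t)) ds + G(t) F(t)\<close>, that is \<open>A u + F = w\<close>. The Hoelder bound for \<open>w\<close>
follows from the estimates of \<open>G\<close>, \<open>G'\<close>, \<open>G''\<close>. For smooth \<open>F\<close> one has \<open>w = G * F'\<close>, and Fubini turns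
\<open>J\<^sup>\<alpha> w\<close> into \<open>(J\<^sup>\<alpha> G) * F' = S (w - F) = u\<close>; the general case follows by Steklov averaging.\<close>

section \<open>Separating functionals\<close>

text \<open>X need not be separable, so vector-valued integrals are Henstock-Kurzweil integrals, and
  convergence, limits and interchange all come from a real majorant. \<open>A\<close> itself never
  enters an integral: the argument runs with its bounded inverse, and \<open>A u = w - F\<close> is
  read off from u = S (w - F).

  The formula for J^\<alpha> G is delicate because the fractional integral stops at t. Truncating
  the Laplace transform of its kernel leaves exp (z t) times an upper incomplete Gamma function. The
  exponential is large for Re z > 0, the other factor for Re z < 0, and only the product decays. A
  rate |z|^(-1/4) is proved for it; with the weight of order |z|^(-1) this passes the exponent 1
  needed on the rays.

  In the Hoelder estimate the bound C / t for G' threatens a logarithm. It is avoided by subtracting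
  F(t) under the integral and by integrating exactly the term in which the increment of F is frozen.
  The contour integrals are taken in operator norm, so the constants do not depend on F.\<close>

definition sublinear :: "('a::real_vector \<Rightarrow> real) \<Rightarrow> bool" where
  "sublinear p \<longleftrightarrow> (\<forall>x y. p (x + y) \<le> p x + p y) \<and> (\<forall>c\<ge>0. \<forall>x. p (c *\<^sub>R x) \<le> c * p x)"

lemma sublinear_add: "sublinear p \<Longrightarrow> p (x + y) \<le> p x + p y"
  by (simp add: sublinear_def)

lemma sublinear_zero:
  assumes "sublinear p" shows "p 0 = 0"
proof -
  have "p (0 *\<^sub>R 0) \<le> 0 * p 0" using assms unfolding sublinear_def by blast
  moreover have "p (0 + 0) \<le> p 0 + p 0" using assms unfolding sublinear_def by blast
  ultimately show ?thesis by simp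
qed

text \<open>The definition asks only for the inequality, which is what infima inherit directly; the
  reverse comes from scaling back by 1 / c.\<close>

lemma sublinear_scale:
  assumes "sublinear p" "c \<ge> 0" shows "p (c *\<^sub>R x) = c * p x"
proof (cases "c = 0")
  case True then show ?thesis using sublinear_zero[OF assms(1)] by simp
next
  case False
  then have c: "c > 0" using assms(2) by simp
  have le: "p (c *\<^sub>R x) \<le> c * p x" using assms unfolding sublinear_def by blast
  have "p ((1/c) *\<^sub>R (c *\<^sub>R x)) \<le> (1/c) * p (c *\<^sub>R x)"
    using assms c unfolding sublinear_def by (meson divide_nonneg_nonneg zero_le_one)
  then have "c * p x \<le> p (c *\<^sub>R x)" using c by (simp add: field_simps)
  then show ?thesis using le by simp
qed

lemma sublinear_minus: "sublinear p \<Longrightarrow> - p (- x) \<le> p x"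
  using sublinear_add[of p x "- x"] sublinear_zero[of p] by simp

text \<open>\<open>q x\<close> is the infimum of \<open>p\<close> along the half-line x + s v, with
  the price s * p v of the added vector refunded. Taking s = 0 gives q \<le> p, and s = 1 at x = - v
  gives the last property, which for a minimal \<open>p\<close> forces oddness in direction
  v.\<close>

lemma sublinear_shift:
  assumes p: "sublinear p"
  obtains q where "sublinear q" "\<And>x. q x \<le> p x" "q (- v) \<le> - p v"
proof -
  define q where "q x = (INF s\<in>{0..}. p (x + s *\<^sub>R v) - s * p v)" for x
  have bdd: "bdd_below ((\<lambda>s. p (x + s *\<^sub>R v) - s * p v) ` {0..})" for x
  proof (rule bdd_belowI2[where m = "- p (- x)"])
    fix s :: real assume "s \<in> {0..}"
    then have "s * p v = p ((x + s *\<^sub>R v) + - x)" using sublinear_scale[OF p, of s v] by simp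
    also have "\<dots> \<le> p (x + s *\<^sub>R v) + p (- x)" by (rule sublinear_add[OF p])
    finally show "- p (- x) \<le> p (x + s *\<^sub>R v) - s * p v" by simp
  qed
  have le: "q x \<le> p (x + s *\<^sub>R v) - s * p v" if "s \<ge> 0" for x s
    unfolding q_def by (rule cINF_lower[OF bdd]) (use that in simp)
  have qp: "q x \<le> p x" for x using le[of 0 x] by simp
  have add: "q (x + y) \<le> q x + q y" for x y
  proof -
    have "q (x + y) - (p (y + s *\<^sub>R v) - s * p v) \<le> q x" if s: "s \<ge> 0" for s
      unfolding q_def[of x]
    proof (rule cINF_greatest)
      fix r :: real assume r: "r \<in> {0..}"
      have "q (x + y) \<le> p ((x + y) + (r + s) *\<^sub>R v) - (r + s) * p v" using r s by (intro le) simp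
      also have "(x + y) + (r + s) *\<^sub>R v = (x + r *\<^sub>R v) + (y + s *\<^sub>R v)"
        by (simp add: algebra_simps)
      also have "p \<dots> \<le> p (x + r *\<^sub>R v) + p (y + s *\<^sub>R v)" by (rule sublinear_add[OF p])
      finally show "q (x + y) - (p (y + s *\<^sub>R v) - s * p v) \<le> p (x + r *\<^sub>R v) - r * p v"
        by (simp add: algebra_simps)
    qed simp
    then have "q (x + y) - q x \<le> q y"
      unfolding q_def[of y] by (intro cINF_greatest) (auto simp: algebra_simps)
    then show ?thesis by simp
  qed
  have scale: "q (c *\<^sub>R x) \<le> c * q x" if c: "c \<ge> 0" for c x
  proof (cases "c = 0")
    case True then show ?thesis using qp[of 0] sublinear_zero[OF p] by simp
  next
    case False
    then have c: "c > 0" using c by simp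
    have "q (c *\<^sub>R x) / c \<le> q x"
      unfolding q_def[of x]
    proof (rule cINF_greatest)
      fix s :: real assume s: "s \<in> {0..}"
      have "q (c *\<^sub>R x) \<le> p (c *\<^sub>R x + (c * s) *\<^sub>R v) - (c * s) * p v"
        using s c by (intro le) simp
      also have "c *\<^sub>R x + (c * s) *\<^sub>R v = c *\<^sub>R (x + s *\<^sub>R v)" by (simp add: algebra_simps)
      also have "p \<dots> = c * p (x + s *\<^sub>R v)" using c by (intro sublinear_scale[OF p]) simp
      finally show "q (c *\<^sub>R x) / c \<le> p (x + s *\<^sub>R v) - s * p v"
        using c by (simp add: field_simps)
    qed simp
    then show ?thesis using c by (simp add: field_simps)
  qed
  have "q (- v) \<le> - p v" using le[of 1 "- v"] sublinear_zero[OF p] by simp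
  moreover have "sublinear q" using add scale by (simp add: sublinear_def)
  ultimately show ?thesis using qp by (intro that)
qed

text \<open>Hahn--Banach: a minimal sublinear functional is linear, because shifting it in any
direction gives a smaller one.\<close>

lemma norming_functional:
  fixes y :: "'a::real_normed_vector"
  obtains f :: "'a \<Rightarrow> real" where "bounded_linear f" "f y = norm y"
proof -
  have sn: "sublinear (norm :: 'a \<Rightarrow> real)"
    by (auto simp: sublinear_def norm_triangle_ineq)
  \<comment> \<open>Shifting the norm in direction y makes every functional below \<open>p0\<close>
    at most - norm y at - y. For a linear one this is norm y at y.\<close>
  obtain p0 where p0: "sublinear p0" "\<And>x. p0 x \<le> norm x" "p0 (- y) \<le> - norm y"
    using sublinear_shift[OF sn] by blast
  define A where "A = {p. sublinear p \<and> p \<le> p0}"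
  \<comment> \<open>The order is reversed, so the maximal element from Zorn's lemma is a minimal
    sublinear functional.\<close>
  define P where "P = (\<lambda>p q :: 'a \<Rightarrow> real. q \<le> p)"
  have "\<exists>m\<in>A. \<forall>a\<in>A. P m a \<longrightarrow> a = m"
  proof (rule predicate_Zorn)
    show "partial_order_on A (relation_of P A)"
      by (rule partial_order_on_relation_ofI) (auto simp: P_def)
    fix C assume C: "C \<in> Chains (relation_of P A)"
    then have CA: "C \<subseteq> A" by (rule Chains_relation_of)
    show "\<exists>u\<in>A. \<forall>a\<in>C. P a u"
    proof (cases "C = {}")
      case True
      have "p0 \<in> A" using p0 by (simp add: A_def)
      then show ?thesis using True by blast
    next
      case False
      define u where "u x = (INF p\<in>C. p x)" for x
      have bdd: "bdd_below ((\<lambda>p. p x) ` C)" for x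
      proof (rule bdd_belowI2[where m = "- p0 (- x)"])
        fix p assume "p \<in> C"
        then have "sublinear p" "p (- x) \<le> p0 (- x)" using CA by (auto simp: A_def le_fun_def)
        then show "- p0 (- x) \<le> p x" using sublinear_minus[of p x] by simp
      qed
      have le: "u x \<le> p x" if "p \<in> C" for p x
        unfolding u_def by (rule cINF_lower[OF bdd that])
      have "u (x + z) \<le> u x + u z" for x z
      proof -
        have "u (x + z) - q z \<le> u x" if q: "q \<in> C" for q
          unfolding u_def[of x]
        proof (rule cINF_greatest[OF False])
          fix p assume p: "p \<in> C"
          have "q \<le> p \<or> p \<le> q" using C p q by (auto simp: Chains_def relation_of_def P_def)
          then obtain r where r: "r \<in> C" "r \<le> p" "r \<le> q" using p q by blast
          have "u (x + z) \<le> r (x + z)" using le r by blast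
          also have "\<dots> \<le> r x + r z" using r CA by (intro sublinear_add) (auto simp: A_def)
          also have "\<dots> \<le> p x + q z" using r by (intro add_mono) (auto simp: le_fun_def)
          finally show "u (x + z) - q z \<le> p x" by simp
        qed
        then have "u (x + z) - u x \<le> u z" unfolding u_def[of z]
          by (intro cINF_greatest[OF False]) (auto simp: algebra_simps)
        then show ?thesis by simp
      qed
      moreover have "u (c *\<^sub>R x) \<le> c * u x" if c: "c \<ge> 0" for c x
      proof (cases "c = 0")
        case True
        obtain p where "p \<in> C" using False by blast
        then show ?thesis using True le[of p 0] CA sublinear_zero[of p] by (auto simp: A_def)
      next
        case c0: False
        have "u (c *\<^sub>R x) / c \<le> u x" unfolding u_def[of x]
        proof (rule cINF_greatest[OF False])
          fix p assume p: "p \<in> C"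
          have "u (c *\<^sub>R x) \<le> c * p x" using le[OF p, of "c *\<^sub>R x"] sublinear_scale[of p c x] CA c p
            by (auto simp: A_def)
          then show "u (c *\<^sub>R x) / c \<le> p x" using c c0 by (simp add: field_simps)
        qed
        then show ?thesis using c c0 by (simp add: field_simps)
      qed
      ultimately have "sublinear u" by (simp add: sublinear_def)
      moreover obtain p where "p \<in> C" using False by blast
      then have "u \<le> p0" using le[of p] CA by (auto simp: A_def le_fun_def intro: order_trans)
      ultimately show ?thesis using le by (intro bexI[of _ u]) (auto simp: A_def P_def le_fun_def)
    qed
  qed
  then obtain m where m: "sublinear m" "m \<le> p0"
    and min: "\<And>a. sublinear a \<Longrightarrow> a \<le> p0 \<Longrightarrow> a \<le> m \<Longrightarrow> a = m"
    by (auto simp: A_def P_def)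
  have neg: "m (- v) = - m v" for v
  proof -
    obtain q where q: "sublinear q" "\<And>x. q x \<le> m x" "q (- v) \<le> - m v"
      using sublinear_shift[OF m(1)] by blast
    have "q \<le> m" using q by (simp add: le_fun_def)
    then have "q = m" using min[OF q(1)] m(2) by (meson order_trans)
    then show ?thesis using q(3) sublinear_minus[OF m(1), of "- v"] by simp
  qed
  have madd: "m (x + z) = m x + m z" for x z
    using sublinear_add[OF m(1), of x z] sublinear_add[OF m(1), of "x + z" "- z"] neg[of z] by simp
  have mscale: "m (c *\<^sub>R x) = c * m x" for c x
  proof (cases "c \<ge> 0")
    case True then show ?thesis by (rule sublinear_scale[OF m(1)])
  next
    case False
    then have "m ((- c) *\<^sub>R x) = - c * m x" by (intro sublinear_scale[OF m(1)]) simp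
    then show ?thesis using neg[of "c *\<^sub>R x"] by simp
  qed
  have mn: "m x \<le> norm x" for x using m(2) p0(2)[of x] by (auto simp: le_fun_def intro: order_trans)
  have "bounded_linear m"
  proof (rule bounded_linear_intro[where K = 1])
    fix x show "norm (m x) \<le> norm x * 1" using mn[of x] mn[of "- x"] neg[of x] by simp
  qed (auto simp: madd mscale)
  moreover have "m (- y) \<le> - norm y" using m(2) p0(3) by (auto simp: le_fun_def intro: order_trans)
  then have "m y = norm y" using neg[of y] mn[of y] by simp
  ultimately show ?thesis by (rule that)
qed

lemma eq_if_functionals_eq:
  fixes x y :: "'a::real_normed_vector"
  assumes "\<And>f :: 'a \<Rightarrow> real. bounded_linear f \<Longrightarrow> f x = f y"
  shows "x = y"
proof -
  obtain f :: "'a \<Rightarrow> real" where f: "bounded_linear f" "f (x - y) = norm (x - y)"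
    by (rule norming_functional)
  interpret bounded_linear f by fact
  have "norm (x - y) = f x - f y" using f(2) diff by simp
  also have "\<dots> = 0" using assms[OF f(1)] by linarith
  finally show ?thesis by simp
qed

section \<open>Integrals of dominated continuous functions with values in a Banach space\<close>

text \<open>Increments of a primitive of f on the open interval are bounded by those of the
  primitive of g, which is uniformly continuous on the closed one. Hence the primitive of f extends
  continuously to the endpoints, and the fundamental theorem with derivatives only in the interior
  yields the integral.\<close>

lemma integrable_on_Icc_dominated:
  fixes f :: "real \<Rightarrow> 'a::banach"
  assumes f: "continuous_on {a<..<b} f" and g: "g integrable_on {a..b}"
    and fg: "\<And>x. x \<in> {a<..<b} \<Longrightarrow> norm (f x) \<le> g x"
  shows "f integrable_on {a..b}"
proof (cases "a < b")
  case False
  then show ?thesis using integrable_on_refl[of f a] by (cases "a = b") (simp_all add: integrable_on_empty)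
next
  case ab: True
  define c where "c = (a + b) / 2"
  have c: "a < c" "c < b" using ab by (auto simp: c_def field_simps)
  have fi: "f integrable_on {x..y}" if "a < x" "y < b" for x y
    by (rule integrable_continuous_interval, rule continuous_on_subset[OF f]) (use that in auto)
  \<comment> \<open>The oriented integral from the midpoint: at least one of the two terms
    vanishes.\<close>
  define F where "F x = integral {c..x} f - integral {x..c} f" for x
  have F_eq: "F x = integral {l..x} f - integral {l..c} f"
    if "a < l" "l \<le> x" "l \<le> c" "x < b" for l x
  proof (cases "c \<le> x")
    case True
    have "integral {l..c} f + integral {c..x} f = integral {l..x} f"
      by (rule Henstock_Kurzweil_Integration.integral_combine) (use that True fi[of l x] in auto)
    moreover have "integral {x..c} f = 0" using True by (cases "x = c") auto
    ultimately show ?thesis by (simp add: F_def algebra_simps)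
  next
    case False
    have "integral {l..x} f + integral {x..c} f = integral {l..c} f"
      by (rule Henstock_Kurzweil_Integration.integral_combine) (use that False c fi[of l c] in auto)
    then show ?thesis using False by (simp add: F_def algebra_simps)
  qed
  have F_diff: "F y - F x = integral {x..y} f" if "a < x" "x \<le> y" "y < b" for x y
  proof -
    define l where "l = min x c"
    have l: "a < l" "l \<le> x" "l \<le> c" using that c by (auto simp: l_def)
    have "integral {l..x} f + integral {x..y} f = integral {l..y} f"
      by (rule Henstock_Kurzweil_Integration.integral_combine) (use that l fi[of l y] in auto)
    then have "integral {l..y} f - integral {l..x} f = integral {x..y} f" by (metis add_diff_cancel_left')
    then show ?thesis using F_eq[of l x] F_eq[of l y] l that by simp
  qed
  define \<gamma> where "\<gamma> x = integral {a..x} g" for x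
  have gi: "g integrable_on {x..y}" if "a \<le> x" "y \<le> b" for x y
    using integrable_subinterval_real[OF g] that by auto
  have F_bd: "norm (F y - F x) \<le> \<gamma> y - \<gamma> x" if "a < x" "x \<le> y" "y < b" for x y
  proof -
    have "norm (integral {x..y} f) \<le> integral {x..y} g"
      by (rule integral_norm_bound_integral) (use that fi gi fg in auto)
    moreover have "integral {a..x} g + integral {x..y} g = integral {a..y} g"
      by (rule Henstock_Kurzweil_Integration.integral_combine) (use that gi[of a y] in auto)
    ultimately show ?thesis using F_diff[OF that] by (simp add: \<gamma>_def)
  qed
  have "continuous_on {a..b} \<gamma>" unfolding \<gamma>_def by (rule indefinite_integral_continuous_1[OF g])
  then have u\<gamma>: "uniformly_continuous_on {a..b} \<gamma>"
    by (intro compact_uniformly_continuous) auto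
  have uF: "uniformly_continuous_on {a<..<b} F"
    unfolding uniformly_continuous_on_def
  proof (intro allI impI)
    fix e :: real assume "e > 0"
    then obtain d where d: "d > 0"
      "\<And>x x'. x \<in> {a..b} \<Longrightarrow> x' \<in> {a..b} \<Longrightarrow> dist x' x < d \<Longrightarrow> dist (\<gamma> x') (\<gamma> x) < e"
      using u\<gamma> unfolding uniformly_continuous_on_def by metis
    show "\<exists>d>0. \<forall>x\<in>{a<..<b}. \<forall>x'\<in>{a<..<b}. dist x' x < d \<longrightarrow> dist (F x') (F x) < e"
    proof (intro exI[of _ d] conjI ballI impI)
      fix x x' assume x: "x \<in> {a<..<b}" "x' \<in> {a<..<b}" "dist x' x < d"
      then have D: "dist (\<gamma> x') (\<gamma> x) < e" by (intro d) auto
      show "dist (F x') (F x) < e"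
        using F_bd[of x x'] F_bd[of x' x] x D
        by (cases "x \<le> x'") (auto simp: dist_norm norm_minus_commute)
    qed (rule d)
  qed
  obtain H where H: "uniformly_continuous_on (closure {a<..<b}) H" "\<And>x. x \<in> {a<..<b} \<Longrightarrow> F x = H x"
    using uniformly_continuous_on_extension_on_closure[OF uF] by metis
  have Hc: "continuous_on {a..b} H"
    using uniformly_continuous_imp_continuous[OF H(1)] ab by simp
  have "(H has_vector_derivative f x) (at x)" if x: "x \<in> {a<..<b}" for x
  proof -
    define l where "l = (a + min x c) / 2"
    define r where "r = (b + x) / 2"
    have lr: "a < l" "l < x" "l < c" "x < r" "r < b" using x c by (auto simp: l_def r_def field_simps min_def)
    have "((\<lambda>y. integral {l..y} f) has_vector_derivative f x) (at x within {l..r})"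
      by (rule integral_has_vector_derivative, rule continuous_on_subset[OF f]) (use lr in auto)
    then have "((\<lambda>y. integral {l..y} f - integral {l..c} f) has_vector_derivative f x) (at x)"
      using lr by (auto simp: at_within_Icc_at intro!: derivative_eq_intros)
    then show ?thesis
      by (rule has_vector_derivative_transform_within_open[where S = "{l<..<r}"])
        (use lr F_eq H(2) in auto)
  qed
  then have "(f has_integral (H b - H a)) {a..b}"
    using ab by (intro fundamental_theorem_of_calculus_interior Hc) auto
  then show ?thesis by blast
qed

text \<open>\<open>interval_with_interior S U\<close> treats the rays and the arc of the contour uniformly.\<close>

definition interval_with_interior :: "real set \<Rightarrow> real set \<Rightarrow> bool" where
  "interval_with_interior S U \<longleftrightarrow>
     (\<exists>a b. S = {a..b} \<and> U = {a<..<b}) \<or> (\<exists>c. S = {c..} \<and> U = {c<..})"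

lemma interval_with_interior_Icc [simp]: "interval_with_interior {a..b} {a<..<b}"
  and interval_with_interior_Ici [simp]: "interval_with_interior {a..} {a<..}"
  unfolding interval_with_interior_def by blast+

lemma interval_with_interior_open: "interval_with_interior S U \<Longrightarrow> open U"
  and interval_with_interior_subset: "interval_with_interior S U \<Longrightarrow> U \<subseteq> S"
  unfolding interval_with_interior_def by (elim disjE exE conjE; simp add: subset_iff)+

lemma interval_with_interior_negligible:
  assumes "interval_with_interior S U" shows "negligible (S - U)"
  using assms unfolding interval_with_interior_def
proof (elim disjE exE conjE)
  fix a b assume "S = {a..b}" "U = {a<..<b}"
  then show ?thesis by (intro negligible_subset[of "{a, b}" "S - U"]) auto
next
  fix c assume "S = {c..}" "U = {c<..}"
  then show ?thesis by (intro negligible_subset[of "{c}" "S - U"]) auto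
qed

text \<open>The Cauchy criterion over large boxes transfers from g to f: enlarging a box changes the
  integral of f by no more than that of g.\<close>

lemma integrable_on_Ici_dominated:
  fixes f :: "real \<Rightarrow> 'a::banach"
  assumes f: "continuous_on {c<..} f" and g: "g integrable_on {c..}"
    and fg: "\<And>x. x \<in> {c<..} \<Longrightarrow> norm (f x) \<le> g x"
  shows "f integrable_on {c..}"
proof -
  \<comment> \<open>The bound is assumed only in the interior, so both functions are reset to 0 at
    the endpoint, which leaves the integrals unchanged.\<close>
  define f0 where "f0 x = (if x = c then 0 else f x)" for x
  define g0 where "g0 x = (if x = c then 0 else g x)" for x
  have g0: "g0 integrable_on {c..}"
    by (rule integrable_spike[OF g negligible_sing[of c]]) (auto simp: g0_def)
  have fg0: "norm (f0 x) \<le> g0 x" if "x \<ge> c" for x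
    using fg[of x] that by (auto simp: f0_def g0_def)
  let ?f = "\<lambda>x. if x \<in> {c..} then f0 x else 0"
  let ?g = "\<lambda>x. if x \<in> {c..} then g0 x else 0"
  have gint: "?g integrable_on cbox a b" for a b
    using integrable_alt[THEN iffD1, OF g0] by blast
  have fint: "?f integrable_on cbox a b" for a b
  proof -
    have "f integrable_on {c..b}"
    proof (rule integrable_on_Icc_dominated)
      show "continuous_on {c<..<b} f" by (rule continuous_on_subset[OF f]) auto
      show "g integrable_on {c..b}"
        using integrable_on_subinterval[OF g, of c b] by auto
    qed (use fg in auto)
    then have "f0 integrable_on {c..b}"
      by (rule integrable_spike[OF _ negligible_sing[of c]]) (auto simp: f0_def)
    then have "f0 integrable_on {max a c..b}"
      by (rule integrable_subinterval_real) auto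
    then have "?f integrable_on {max a c..b}"
      by (rule integrable_eq) auto
    moreover have "(\<lambda>x. if x \<in> {max a c..b} then ?f x else 0) = (\<lambda>x. if x \<in> {a..b} then ?f x else 0)"
      by auto
    ultimately have "?f integrable_on {a..b}"
      using integrable_restrict_UNIV[of "{max a c..b}" ?f] integrable_restrict_UNIV[of "{a..b}" ?f] by simp
    then show ?thesis by simp
  qed
  have "f0 integrable_on {c..}"
  proof (rule integrable_alt[THEN iffD2], intro conjI allI impI fint)
    fix e :: real assume e: "e > 0"
    then have "\<exists>B>0. \<forall>a b a' b'. ball 0 B \<subseteq> cbox a b \<and> ball 0 B \<subseteq> cbox a' b' \<longrightarrow>
        norm (integral (cbox a b) ?g - integral (cbox a' b') ?g) < e / 2"
      by (intro integrable_alt[THEN iffD1, OF g0, THEN conjunct2, THEN spec, THEN mp]) simp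
    then obtain B where B: "B > 0" "\<And>a b a' b'. ball 0 B \<subseteq> cbox a b \<Longrightarrow> ball 0 B \<subseteq> cbox a' b' \<Longrightarrow>
        norm (integral (cbox a b) ?g - integral (cbox a' b') ?g) < e / 2"
      by blast
    \<comment> \<open>Only a box and an enlargement of it are compared. Half of e is reserved
      because two arbitrary boxes will be compared through enlargements of both.\<close>
    have sub: "norm (integral (cbox a b) ?f - integral (cbox a' b') ?f) < e / 2"
      if h: "ball 0 B \<subseteq> cbox a b" "ball 0 B \<subseteq> cbox a' b'" "a = min a' c - B" "b \<ge> b'" for a b a' b' :: real
    proof -
      have lb: "l \<le> -B \<and> B \<le> u" if "ball 0 B \<subseteq> cbox l u" for l u :: real
      proof -
        have "closure (ball 0 B) \<subseteq> cbox l u" using that by (meson closed_cbox closure_minimal)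
        then have "cball 0 B \<subseteq> cbox l u" using B(1) by simp
        moreover have "- B \<in> cball 0 B" "B \<in> cball 0 B" using B(1) by auto
        ultimately have "- B \<in> cbox l u" "B \<in> cbox l u" by blast+
        then show ?thesis by simp
      qed
      have o: "a \<le> a'" "a' \<le> b'" "b' \<le> b" using h lb[OF h(1)] lb[OF h(2)] B(1) by auto
      have split: "integral {a..b} F = integral {a..a'} F + integral {a'..b'} F + integral {b'..b} F"
        if F: "\<And>x y. F integrable_on cbox x y" for F :: "real \<Rightarrow> 'z::banach"
      proof -
        have "integral {a..a'} F + integral {a'..b} F = integral {a..b} F"
          by (rule Henstock_Kurzweil_Integration.integral_combine) (use o F in auto)
        moreover have "integral {a'..b'} F + integral {b'..b} F = integral {a'..b} F"
          by (rule Henstock_Kurzweil_Integration.integral_combine) (use o F in auto)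
        ultimately show ?thesis by (metis add.assoc)
      qed
      have nb: "norm (integral {x..y} ?f) \<le> integral {x..y} ?g" for x y
      proof (rule integral_norm_bound_integral)
        show "norm (?f w) \<le> ?g w" for w using fg0[of w] by simp
      qed (use fint[of x y] gint[of x y] in simp_all)
      have nt: "norm ((p + q + r) - q) \<le> norm p + norm r" for p q r :: 'a
        using norm_triangle_ineq[of p r] by (simp add: algebra_simps)
      have "norm (integral {a..b} ?f - integral {a'..b'} ?f) \<le> integral {a..a'} ?g + integral {b'..b} ?g"
        unfolding split[OF fint] by (rule order_trans[OF nt add_mono[OF nb nb]])
      also have "\<dots> = integral {a..b} ?g - integral {a'..b'} ?g" unfolding split[OF gint] by simp
      also have "\<dots> < e / 2" using B(2)[OF h(1,2)] unfolding real_norm_def box_real by linarith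
      finally show ?thesis unfolding box_real .
    qed
    show "\<exists>B>0. \<forall>a b a' b'. ball 0 B \<subseteq> cbox a b \<and> ball 0 B \<subseteq> cbox a' b' \<longrightarrow>
       norm (integral (cbox a b) ?f - integral (cbox a' b') ?f) < e"
    proof (intro exI[of _ B] conjI allI impI B(1), elim conjE)
      fix a b a' b' :: real assume h: "ball 0 B \<subseteq> cbox a b" "ball 0 B \<subseteq> cbox a' b'"
      define b2 where "b2 = max b b'"
      \<comment> \<open>The enlargements of the two boxes may differ at the left end, but both start
        left of \<open>c\<close>, where the integrand is 0.\<close>
      have same: "integral (cbox (min a c - B) b2) ?f = integral (cbox (min a' c - B) b2) ?f"
      proof -
        have eq: "integral {l..b2} ?f = integral {c..b2} ?f" if "l \<le> c" for l
        proof -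
          have "integral {l..b2} ?f = integral UNIV (\<lambda>x. if x \<in> {l..b2} then ?f x else 0)"
            by (simp only: integral_restrict_UNIV)
          also have "(\<lambda>x. if x \<in> {l..b2} then ?f x else 0) = (\<lambda>x. if x \<in> {c..b2} then ?f x else 0)"
            using that by auto
          also have "integral UNIV \<dots> = integral {c..b2} ?f" by (simp only: integral_restrict_UNIV)
          finally show ?thesis .
        qed
        show ?thesis using eq[of "min a c - B"] eq[of "min a' c - B"] B(1) by simp
      qed
      have bb: "ball 0 B \<subseteq> cbox (min x c - B) b2" if "ball 0 B \<subseteq> cbox x y" "y \<le> b2" for x y
      proof
        fix w :: real assume w: "w \<in> ball 0 B"
        then have "w \<in> cbox x y" using that by blast
        then show "w \<in> cbox (min x c - B) b2" using that(2) B(1) by auto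
      qed
      have X1: "dist (integral (cbox (min a c - B) b2) ?f) (integral (cbox a b) ?f) < e / 2"
        unfolding dist_norm by (rule sub) (use h bb in \<open>auto simp: b2_def\<close>)
      have X2: "dist (integral (cbox (min a' c - B) b2) ?f) (integral (cbox a' b') ?f) < e / 2"
        unfolding dist_norm by (rule sub) (use h bb in \<open>auto simp: b2_def\<close>)
      show "norm (integral (cbox a b) ?f - integral (cbox a' b') ?f) < e"
        by (rule dist_triangle_half_r[OF X1[unfolded same] X2, unfolded dist_norm])
    qed
  qed
  then show ?thesis
    by (rule integrable_spike[OF _ negligible_sing[of c]]) (auto simp: f0_def)
qed

lemma integrable_dominated:
  fixes f :: "real \<Rightarrow> 'a::banach"
  assumes "interval_with_interior S U" "continuous_on U f" "g integrable_on S"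
    and "\<And>x. x \<in> U \<Longrightarrow> norm (f x) \<le> g x"
  shows "f integrable_on S"
  using assms(1) unfolding interval_with_interior_def
proof (elim disjE exE conjE)
  fix a b assume "S = {a..b}" "U = {a<..<b}"
  with assms(2-4) show ?thesis using integrable_on_Icc_dominated[of a b f g] by simp
next
  fix c assume "S = {c..}" "U = {c<..}"
  with assms(2-4) show ?thesis using integrable_on_Ici_dominated[of c f g] by simp
qed

lemma integral_norm_bound_interior:
  fixes f :: "real \<Rightarrow> 'a::banach"
  assumes SU: "interval_with_interior S U" and f: "f integrable_on S" and g: "g integrable_on S"
    and fg: "\<And>x. x \<in> U \<Longrightarrow> norm (f x) \<le> g x"
  shows "norm (integral S f) \<le> integral S g"
proof -
  let ?f = "\<lambda>x. if x \<in> U then f x else 0" and ?g = "\<lambda>x. if x \<in> U then g x else 0"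
  have N: "negligible (S - U)" by (rule interval_with_interior_negligible[OF SU])
  have "integral S f = integral S ?f" by (rule integral_spike[OF N]) auto
  moreover have "integral S g = integral S ?g" by (rule integral_spike[OF N]) auto
  moreover have "norm (integral S ?f) \<le> integral S ?g"
    by (rule integral_norm_bound_integral)
      (auto intro: integrable_spike[OF f N] integrable_spike[OF g N] fg)
  ultimately show ?thesis by simp
qed

section \<open>Limits, continuity and differentiation under the integral sign\<close>

lemma dominated_convergence_interior:
  fixes f :: "nat \<Rightarrow> real \<Rightarrow> 'a::banach"
  assumes SU: "interval_with_interior S U" and f: "\<And>n. continuous_on U (f n)" and f': "continuous_on U f'"
    and g: "g integrable_on S" and fg: "\<And>n x. x \<in> U \<Longrightarrow> norm (f n x) \<le> g x"
    and lim: "\<And>x. x \<in> U \<Longrightarrow> (\<lambda>n. f n x) \<longlonglongrightarrow> f' x"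
  shows "(\<lambda>n. integral S (f n)) \<longlonglongrightarrow> integral S f'"
proof -
  have fg': "norm (f' x) \<le> g x" if "x \<in> U" for x
    by (rule LIMSEQ_le_const2[OF tendsto_norm[OF lim[OF that]]]) (use fg[OF that] in blast)
  have fi: "f n integrable_on S" for n by (rule integrable_dominated[OF SU f g fg])
  have fi': "f' integrable_on S" by (rule integrable_dominated[OF SU f' g fg'])
  have N: "negligible (S - U)" by (rule interval_with_interior_negligible[OF SU])
  \<comment> \<open>Scalar dominated convergence is applied to the distances, which tend to 0 under
    the majorant 2 g and bound the difference of the vector-valued integrals.\<close>
  define d where "d n x = (if x \<in> U then norm (f n x - f' x) else 0)" for n x
  have d: "d n integrable_on S" for n
  proof (rule integrable_dominated[OF SU, of _ "\<lambda>x. 2 * g x"])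
    have "continuous_on U (\<lambda>x. norm (f n x - f' x))" by (intro continuous_intros f f')
    then show "continuous_on U (d n)" by (rule continuous_on_eq) (simp add: d_def)
    show "(\<lambda>x. 2 * g x) integrable_on S" using g by simp
    show "norm (d n x) \<le> 2 * g x" if "x \<in> U" for x
      using fg[OF that, of n] fg'[OF that] norm_triangle_ineq4[of "f n x" "f' x"] that by (simp add: d_def)
  qed
  have "(\<lambda>n. integral S (d n)) \<longlonglongrightarrow> integral S (\<lambda>x. 0 :: real)"
  proof (rule dominated_convergence)
    show "(\<lambda>x. if x \<in> U then 2 * g x else 0) integrable_on S"
      by (rule integrable_spike[OF _ N, of "\<lambda>x. 2 * g x"]) (use g in auto)
    show "norm (d n x) \<le> (if x \<in> U then 2 * g x else 0)" if "x \<in> S" for n x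
      using fg[of x n] fg'[of x] norm_triangle_ineq4[of "f n x" "f' x"]
      by (cases "x \<in> U") (auto simp: d_def)
    show "(\<lambda>n. d n x) \<longlonglongrightarrow> 0" if "x \<in> S" for x
    proof (cases "x \<in> U")
      case True
      then show ?thesis using lim[OF True] unfolding d_def by (simp add: LIM_zero tendsto_norm_zero)
    qed (simp add: d_def)
  qed (rule d)
  then have d0: "(\<lambda>n. integral S (d n)) \<longlonglongrightarrow> 0" by simp
  have "norm (integral S (f n) - integral S f') \<le> integral S (d n)" for n
  proof -
    have "integral S (f n) - integral S f' = integral S (\<lambda>x. f n x - f' x)"
      by (rule integral_diff[OF fi fi', symmetric])
    moreover have "norm (integral S (\<lambda>x. f n x - f' x)) \<le> integral S (d n)"
      by (rule integral_norm_bound_interior[OF SU integrable_diff[OF fi fi'] d]) (simp add: d_def)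
    ultimately show ?thesis by simp
  qed
  then have "(\<lambda>n. integral S (f n) - integral S f') \<longlonglongrightarrow> 0"
    by (intro Lim_null_comparison[OF _ d0] always_eventually allI)
  then show ?thesis by (simp add: LIM_zero_iff)
qed

text \<open>Translates integrals over closed intervals into the form required by
  \<open>fubini_banach\<close>: functions on the whole line, cut off to an open set.\<close>

lemma has_integral_interior_UNIV:
  fixes f :: "real \<Rightarrow> 'a::banach"
  assumes SU: "interval_with_interior S U"
  shows "((\<lambda>x. if x \<in> U then f x else 0) has_integral i) UNIV \<longleftrightarrow> (f has_integral i) S"
proof -
  have "(f has_integral i) U \<longleftrightarrow> (f has_integral i) S"
  proof (rule has_integral_spike_set_eq)
    show "negligible {x \<in> U - S. f x \<noteq> 0}"
      using interval_with_interior_subset[OF SU] by (intro negligible_subset[OF negligible_empty]) blast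
    show "negligible {x \<in> S - U. f x \<noteq> 0}"
      using interval_with_interior_negligible[OF SU] by (rule negligible_subset) blast
  qed
  then show ?thesis by (simp only: has_integral_restrict_UNIV)
qed

text \<open>The factor \<open>b\<close> may be unbounded on X, but it is bounded along a convergent
  sequence, and continuity is checked on sequences.\<close>

lemma continuous_on_integral_dominated:
  fixes f :: "'p::metric_space \<Rightarrow> real \<Rightarrow> 'a::banach"
  assumes SU: "interval_with_interior S U"
    and fU: "\<And>x. x \<in> X \<Longrightarrow> continuous_on U (f x)"
    and fX: "\<And>y. y \<in> U \<Longrightarrow> continuous_on X (\<lambda>x. f x y)"
    and b: "continuous_on X b" and g: "g integrable_on S" "\<And>y. y \<in> U \<Longrightarrow> 0 \<le> g y"
    and fg: "\<And>x y. x \<in> X \<Longrightarrow> y \<in> U \<Longrightarrow> norm (f x y) \<le> b x * g y"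
  shows "continuous_on X (\<lambda>x. integral S (f x))"
  unfolding continuous_on_sequentially o_def
proof (intro allI ballI impI, elim conjE)
  fix x a assume a: "a \<in> X" and x: "\<forall>n. x n \<in> X" "x \<longlonglongrightarrow> a"
  have "(\<lambda>n. b (x n)) \<longlonglongrightarrow> b a"
    using b a x unfolding continuous_on_sequentially o_def by blast
  then have "Bseq (\<lambda>n. b (x n))" by (intro convergent_imp_Bseq convergentI)
  then obtain B where "\<forall>n. norm (b (x n)) \<le> B" by (rule BseqE)
  then have B: "\<bar>b (x n)\<bar> \<le> B" for n by simp
  show "(\<lambda>n. integral S (f (x n))) \<longlonglongrightarrow> integral S (f a)"
  proof (rule dominated_convergence_interior[OF SU])
    show "(\<lambda>y. B * g y) integrable_on S" using integrable_cmul[OF g(1), of B] by simp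
    show "norm (f (x n) y) \<le> B * g y" if y: "y \<in> U" for n y
    proof -
      have "norm (f (x n) y) \<le> b (x n) * g y" using fg x y by blast
      also have "\<dots> \<le> B * g y" using B[of n] g(2)[OF y] by (intro mult_right_mono) auto
      finally show ?thesis .
    qed
    show "(\<lambda>n. f (x n) y) \<longlonglongrightarrow> f a y" if "y \<in> U" for y
      using fX[OF that] a x unfolding continuous_on_sequentially o_def by blast
  qed (use fU a x in auto)
qed

text \<open>Dominating the second-order remainder spares a mean value inequality inside the integral.\<close>

lemma has_derivative_integral_dominated:
  fixes f :: "'p::real_normed_vector \<Rightarrow> real \<Rightarrow> 'a::banach"
  assumes SU: "interval_with_interior S U" and \<delta>: "\<delta> > 0"
    and fi: "\<And>h. norm h < \<delta> \<Longrightarrow> f (x0 + h) integrable_on S"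
    and L: "bounded_linear L" "\<And>h. (f' h has_integral L h) S"
    and g: "g integrable_on S"
    and fg: "\<And>h y. norm h < \<delta> \<Longrightarrow> y \<in> U \<Longrightarrow> norm (f (x0 + h) y - f x0 y - f' h y) \<le> (norm h)\<^sup>2 * g y"
  shows "((\<lambda>x. integral S (f x)) has_derivative L) (at x0)"
  unfolding has_derivative_at
proof (intro conjI L(1))
  have bd: "norm (integral S (f (x0 + h)) - integral S (f x0) - L h) \<le> (norm h)\<^sup>2 * integral S g"
    if h: "norm h < \<delta>" for h
  proof -
    have f0: "f x0 integrable_on S" using fi[of 0] \<delta> by simp
    have i: "((\<lambda>y. f (x0 + h) y - f x0 y - f' h y) has_integral
        (integral S (f (x0 + h)) - integral S (f x0) - L h)) S"
      by (intro has_integral_diff integrable_integral fi[OF h] f0 L(2))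
    have "norm (integral S (\<lambda>y. f (x0 + h) y - f x0 y - f' h y)) \<le> integral S (\<lambda>y. (norm h)\<^sup>2 * g y)"
      by (rule integral_norm_bound_interior[OF SU has_integral_integrable[OF i]])
        (use fg[OF h] integrable_cmul[OF g, of "(norm h)\<^sup>2"] in auto)
    then show ?thesis unfolding integral_unique[OF i] by simp
  qed
  have "((\<lambda>h. norm h * integral S g) \<longlongrightarrow> 0 * integral S g) (at (0::'p))"
    by (intro tendsto_intros tendsto_norm_zero)
  then have t: "((\<lambda>h. norm h * integral S g) \<longlongrightarrow> 0) (at (0::'p))" by simp
  show "(\<lambda>h. norm (integral S (f (x0 + h)) - integral S (f x0) - L h) / norm h) \<midarrow>0\<rightarrow> 0"
  proof (rule Lim_null_comparison[OF _ t])
    show "\<forall>\<^sub>F h in at 0. norm (norm (integral S (f (x0 + h)) - integral S (f x0) - L h) / norm h) \<le> norm h * integral S g"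
      unfolding eventually_at
    proof (intro exI[of _ \<delta>] conjI ballI impI \<delta>)
      fix h :: 'p assume h: "h \<noteq> 0 \<and> dist h 0 < \<delta>"
      then have "norm (integral S (f (x0 + h)) - integral S (f x0) - L h) \<le> (norm h)\<^sup>2 * integral S g"
        by (intro bd) (simp add: dist_norm)
      then show "norm (norm (integral S (f (x0 + h)) - integral S (f x0) - L h) / norm h) \<le> norm h * integral S g"
        using h by (simp add: divide_le_eq power2_eq_square mult_ac)
    qed
  qed
qed

section \<open>Interchanging the order of integration\<close>

lemma integrable_lborel_interior:
  fixes g :: "real \<Rightarrow> real"
  assumes SU: "interval_with_interior S U" and g: "continuous_on U g" "\<And>x. x \<in> U \<Longrightarrow> 0 \<le> g x" "g integrable_on S"
  shows "integrable lborel (\<lambda>x. if x \<in> U then g x else 0)"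
proof -
  let ?g = "\<lambda>x. if x \<in> U then g x else 0"
  have "(?g has_integral integral S g) UNIV"
    unfolding has_integral_interior_UNIV[OF SU] using g(3) by blast
  then have "?g integrable_on UNIV" by (rule has_integral_integrable)
  then have "?g absolutely_integrable_on UNIV"
    by (rule nonnegative_absolutely_integrable_1) (use g(2) in simp)
  then have "integrable lebesgue ?g" by (simp add: set_integrable_def)
  moreover have "(\<lambda>x. indicator U x *\<^sub>R g x) \<in> borel_measurable borel"
    using interval_with_interior_open[OF SU] g(1) by (intro borel_measurable_continuous_on_indicator) auto
  moreover have "(\<lambda>x. indicator U x *\<^sub>R g x) = ?g" by (auto simp: indicator_def)
  ultimately show ?thesis by (simp add: integrable_completion)
qed

text \<open>The values need not lie in a separable space, so Bochner integration is not available;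
functionals reduce the claim to real-valued functions.\<close>

lemma fubini_banach:
  fixes f :: "real \<Rightarrow> real \<Rightarrow> 'a::banach"
  assumes W: "open W" and f: "continuous_on W (\<lambda>p. f (fst p) (snd p))"
    and fg: "\<And>x y. (x, y) \<in> W \<Longrightarrow> norm (f x y) \<le> g1 x * g2 y"
    and g: "integrable lborel g1" "integrable lborel g2"
    and F1: "\<And>x. ((\<lambda>y. if (x, y) \<in> W then f x y else 0) has_integral F1 x) UNIV"
    and F2: "\<And>y. ((\<lambda>x. if (x, y) \<in> W then f x y else 0) has_integral F2 y) UNIV"
    and I: "(F1 has_integral I1) UNIV" "(F2 has_integral I2) UNIV"
  shows "I1 = I2"
proof (rule eq_if_functionals_eq)
  fix \<phi> :: "'a \<Rightarrow> real" assume \<phi>: "bounded_linear \<phi>"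
  interpret \<phi>: bounded_linear \<phi> by fact
  obtain K where K: "K > 0" "\<And>x. norm (\<phi> x) \<le> norm x * K" using \<phi>.pos_bounded by blast
  define h where "h x y = (if (x, y) \<in> W then \<phi> (f x y) else 0)" for x y
  have hb: "norm (h x y) \<le> norm (K * (g1 x * g2 y))" for x y
  proof (cases "(x, y) \<in> W")
    case True
    have "norm (h x y) \<le> norm (f x y) * K" using K(2) True by (simp add: h_def)
    also have "\<dots> \<le> (g1 x * g2 y) * K" using fg[OF True] K(1) by simp
    also have "\<dots> \<le> norm (K * (g1 x * g2 y))" by (simp add: mult.commute)
    finally show ?thesis .
  qed (simp add: h_def)
  have "(\<lambda>p. indicator W p *\<^sub>R \<phi> (f (fst p) (snd p))) \<in> borel_measurable borel"
    by (rule borel_measurable_continuous_on_indicator)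
      (use W in \<open>auto intro!: \<phi>.continuous_on f\<close>)
  then have "(\<lambda>p. h (fst p) (snd p)) \<in> borel_measurable borel"
    by (rule measurable_cong[THEN iffD1, rotated]) (auto simp: indicator_def h_def)
  then have hm: "case_prod h \<in> borel_measurable (lborel \<Otimes>\<^sub>M lborel)"
    by (simp add: lborel_prod case_prod_beta')
  have gm: "g1 \<in> borel_measurable lborel" "g2 \<in> borel_measurable lborel" using g by auto
  have gi: "integrable (lborel \<Otimes>\<^sub>M lborel) (\<lambda>(x, y). K * (g1 x * g2 y))"
  proof (rule lborel_pair.Fubini_integrable)
    show "(\<lambda>(x, y). K * (g1 x * g2 y)) \<in> borel_measurable (lborel \<Otimes>\<^sub>M lborel)"
      using gm by measurable
    have "integrable lborel (\<lambda>x. \<bar>K\<bar> * \<bar>g1 x\<bar> * (\<integral>y. \<bar>g2 y\<bar> \<partial>lborel))"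
      using g(1) by simp
    then show "integrable lborel (\<lambda>x. \<integral>y. norm (case (x, y) of (x, y) \<Rightarrow> K * (g1 x * g2 y)) \<partial>lborel)"
      by (simp add: abs_mult mult.assoc)
    show "AE x in lborel. integrable lborel (\<lambda>y. case (x, y) of (x, y) \<Rightarrow> K * (g1 x * g2 y))"
      using g(2) by simp
  qed
  have hi: "integrable (lborel \<Otimes>\<^sub>M lborel) (case_prod h)"
    by (rule Bochner_Integration.integrable_bound[OF gi hm]) (use hb in auto)
  have hi1: "integrable lborel (h x)" for x
  proof (rule Bochner_Integration.integrable_bound)
    show "integrable lborel (\<lambda>y. K * (g1 x * g2 y))" using g(2) by simp
    show "h x \<in> borel_measurable lborel" using measurable_Pair2[OF hm, of x] by simp
  qed (use hb in auto)
  have hi2: "integrable lborel (\<lambda>x. h x y)" for y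
  proof (rule Bochner_Integration.integrable_bound)
    show "integrable lborel (\<lambda>x. K * (g1 x * g2 y))" using g(1) by simp
    show "(\<lambda>x. h x y) \<in> borel_measurable lborel" using measurable_Pair1[OF hm, of y] by simp
  qed (use hb in auto)
  have \<phi>if: "\<phi> (if b then z else 0) = (if b then \<phi> z else 0)" for b z by (simp add: \<phi>.zero)
  have e1: "(\<integral>y. h x y \<partial>lborel) = \<phi> (F1 x)" for x
    using has_integral_unique[OF has_integral_integral_lborel[OF hi1[of x]]
        has_integral_linear[OF F1[of x] \<phi>, unfolded o_def \<phi>if, folded h_def]] .
  have e2: "(\<integral>x. h x y \<partial>lborel) = \<phi> (F2 y)" for y
    using has_integral_unique[OF has_integral_integral_lborel[OF hi2[of y]]
        has_integral_linear[OF F2[of y] \<phi>, unfolded o_def \<phi>if, folded h_def]] .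
  have i1: "integrable lborel (\<lambda>x. \<phi> (F1 x))"
    using lborel_pair.integrable_fst'[OF hi] e1 by simp
  have "integrable (lborel \<Otimes>\<^sub>M lborel) (\<lambda>(x, y). h y x)"
    using lborel_pair.integrable_product_swap[OF hi] by simp
  from lborel_pair.integrable_fst'[OF this] have i2: "integrable lborel (\<lambda>y. \<phi> (F2 y))"
    using e2 by simp
  have "\<phi> I1 = (\<integral>x. \<phi> (F1 x) \<partial>lborel)"
    by (rule has_integral_unique[OF has_integral_linear[OF I(1) \<phi>, unfolded o_def]
          has_integral_integral_lborel[OF i1]])
  also have "\<dots> = (\<integral>x. (\<integral>y. h x y \<partial>lborel) \<partial>lborel)" by (simp add: e1)
  also have "\<dots> = (\<integral>y. (\<integral>x. h x y \<partial>lborel) \<partial>lborel)"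
    by (rule lborel_pair.Fubini_integral[OF hi, symmetric])
  also have "\<dots> = (\<integral>y. \<phi> (F2 y) \<partial>lborel)" by (simp add: e2)
  also have "\<dots> = \<phi> I2"
    by (rule has_integral_unique[OF has_integral_integral_lborel[OF i2]
          has_integral_linear[OF I(2) \<phi>, unfolded o_def]])
  finally show "\<phi> I1 = \<phi> I2" .
qed

text \<open>The product majorant does double duty: it makes the inner integrals continuous and
  dominated, hence integrable in the outer variable, and it licenses the interchange.\<close>

lemma fubini_interval:
  fixes f :: "real \<Rightarrow> real \<Rightarrow> 'a::banach"
  assumes SU1: "interval_with_interior S1 U1" and SU2: "interval_with_interior S2 U2"
    and f: "continuous_on (U1 \<times> U2) (\<lambda>p. f (fst p) (snd p))"
    and fg: "\<And>x y. x \<in> U1 \<Longrightarrow> y \<in> U2 \<Longrightarrow> norm (f x y) \<le> g1 x * g2 y"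
    and g1: "continuous_on U1 g1" "\<And>x. x \<in> U1 \<Longrightarrow> 0 \<le> g1 x" "g1 integrable_on S1"
    and g2: "continuous_on U2 g2" "\<And>x. x \<in> U2 \<Longrightarrow> 0 \<le> g2 x" "g2 integrable_on S2"
  shows "(\<lambda>x. integral S2 (f x)) integrable_on S1"
    and "(\<lambda>y. integral S1 (\<lambda>x. f x y)) integrable_on S2"
    and "integral S1 (\<lambda>x. integral S2 (f x)) = integral S2 (\<lambda>y. integral S1 (\<lambda>x. f x y))"
proof -
  have c1: "continuous_on U2 (f x)" if "x \<in> U1" for x
    using continuous_on_compose2[OF f continuous_on_Pair[OF continuous_on_const[of _ x] continuous_on_id], of U2] that
    by (simp add: image_subset_iff)
  have c2: "continuous_on U1 (\<lambda>x. f x y)" if "y \<in> U2" for y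
    using continuous_on_compose2[OF f continuous_on_Pair[OF continuous_on_id continuous_on_const[of _ y]], of U1] that
    by (simp add: image_subset_iff)
  have i1: "f x integrable_on S2" if x: "x \<in> U1" for x
    by (rule integrable_dominated[OF SU2 c1[OF x], of "\<lambda>y. g1 x * g2 y"]) (use integrable_cmul[OF g2(3), of "g1 x"] fg x in auto)
  have i2: "(\<lambda>x. f x y) integrable_on S1" if y: "y \<in> U2" for y
    by (rule integrable_dominated[OF SU1 c2[OF y], of "\<lambda>x. g2 y * g1 x"])
      (use integrable_cmul[OF g1(3), of "g2 y"] fg y in \<open>auto simp: mult.commute\<close>)
  show I1: "(\<lambda>x. integral S2 (f x)) integrable_on S1"
  proof (rule integrable_dominated[OF SU1, of _ "\<lambda>x. integral S2 g2 * g1 x"])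
    show "continuous_on U1 (\<lambda>x. integral S2 (f x))"
      by (rule continuous_on_integral_dominated[OF SU2 _ _ g1(1) g2(3)]) (use c1 c2 fg g2 in auto)
    show "norm (integral S2 (f x)) \<le> integral S2 g2 * g1 x" if "x \<in> U1" for x
      using integral_norm_bound_interior[OF SU2 i1[OF that], of "\<lambda>y. g1 x * g2 y"]
        integrable_cmul[OF g2(3), of "g1 x"] fg that by (auto simp: mult.commute)
  qed (use integrable_cmul[OF g1(3), of "integral S2 g2"] in simp)
  show I2: "(\<lambda>y. integral S1 (\<lambda>x. f x y)) integrable_on S2"
  proof (rule integrable_dominated[OF SU2, of _ "\<lambda>y. integral S1 g1 * g2 y"])
    show "continuous_on U2 (\<lambda>y. integral S1 (\<lambda>x. f x y))"
      by (rule continuous_on_integral_dominated[OF SU1 _ _ g2(1) g1(3)])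
        (use c1 c2 fg g1 in \<open>auto simp: mult.commute\<close>)
    show "norm (integral S1 (\<lambda>x. f x y)) \<le> integral S1 g1 * g2 y" if "y \<in> U2" for y
      using integral_norm_bound_interior[OF SU1 i2[OF that], of "\<lambda>x. g2 y * g1 x"]
        integrable_cmul[OF g1(3), of "g2 y"] fg that by (auto simp: mult.commute)
  qed (use integrable_cmul[OF g2(3), of "integral S1 g1"] in simp)
  show "integral S1 (\<lambda>x. integral S2 (f x)) = integral S2 (\<lambda>y. integral S1 (\<lambda>x. f x y))"
  proof (rule fubini_banach[of "U1 \<times> U2" f "\<lambda>x. if x \<in> U1 then g1 x else 0" "\<lambda>y. if y \<in> U2 then g2 y else 0"
        "\<lambda>x. if x \<in> U1 then integral S2 (f x) else 0"
        "\<lambda>y. if y \<in> U2 then integral S1 (\<lambda>x. f x y) else 0"])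
    show "open (U1 \<times> U2)"
      using interval_with_interior_open[OF SU1] interval_with_interior_open[OF SU2] by (rule open_Times)
    show "((\<lambda>y. if (x, y) \<in> U1 \<times> U2 then f x y else 0) has_integral (if x \<in> U1 then integral S2 (f x) else 0)) UNIV" for x
      using has_integral_interior_UNIV[OF SU2, of "f x"] i1[of x] by (cases "x \<in> U1") (auto simp: integrable_integral)
    show "((\<lambda>x. if (x, y) \<in> U1 \<times> U2 then f x y else 0) has_integral (if y \<in> U2 then integral S1 (\<lambda>x. f x y) else 0)) UNIV" for y
      using has_integral_interior_UNIV[OF SU1, of "\<lambda>x. f x y"] i2[of y] by (cases "y \<in> U2") (auto simp: integrable_integral)
    show "((\<lambda>x. if x \<in> U1 then integral S2 (f x) else 0) has_integral integral S1 (\<lambda>x. integral S2 (f x))) UNIV"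
      unfolding has_integral_interior_UNIV[OF SU1] by (rule integrable_integral[OF I1])
    show "((\<lambda>y. if y \<in> U2 then integral S1 (\<lambda>x. f x y) else 0) has_integral integral S2 (\<lambda>y. integral S1 (\<lambda>x. f x y))) UNIV"
      unfolding has_integral_interior_UNIV[OF SU2] by (rule integrable_integral[OF I2])
  qed (use f fg integrable_lborel_interior[OF SU1 g1] integrable_lborel_interior[OF SU2 g2] in auto)
qed

section \<open>Contour integrals in complex Banach spaces\<close>

text \<open>The complex scalar multiplication is an explicit parameter so that one theory of contour
  integrals serves three spaces: X, the bounded operators on X, and the complex numbers.\<close>

locale complex_banach =
  fixes smc :: "complex \<Rightarrow> 'y::banach \<Rightarrow> 'y"
  assumes complex_structure: "complex_structure smc"
begin

lemma smc_of_real: "smc (complex_of_real r) x = r *\<^sub>R x"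
  and smc_mult: "smc (a * b) x = smc a (smc b x)"
  and smc_add_left: "smc (a + b) x = smc a x + smc b x"
  and smc_add_right: "smc a (x + y) = smc a x + smc a y"
  and norm_smc: "norm (smc a x) = cmod a * norm x"
  using complex_structure unfolding complex_structure_def by metis+

lemma smc_one: "smc 1 x = x"
  using smc_of_real[of 1 x] by simp

lemma smc_commute: "smc a (smc b x) = smc b (smc a x)"
  by (metis smc_mult mult.commute)

sublocale smc: bounded_bilinear smc
proof
  show "smc (r *\<^sub>R a) x = r *\<^sub>R smc a x" for r a x
    by (simp add: scaleR_conv_of_real smc_mult smc_of_real)
  show "smc a (r *\<^sub>R x) = r *\<^sub>R smc a x" for r a x
    by (metis smc_commute smc_of_real)
  show "\<exists>K. \<forall>a x. norm (smc a x) \<le> norm a * norm x * K"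
    by (intro exI[of _ 1]) (simp add: norm_smc)
qed (simp_all add: smc_add_left smc_add_right)

lemmas smc_zero_left = smc.zero_left
  and smc_minus_left = smc.minus_left and smc_minus_right = smc.minus_right
  and smc_diff_left = smc.diff_left and smc_diff_right = smc.diff_right

text \<open>The contour of \<open>G_op\<close> with its radius set free. A radius independent of t
  allows differentiation in t and integration in time over a fixed contour. The factor 1 / (2 pi i)
  is left out.\<close>

definition gamma_int :: "real \<Rightarrow> real \<Rightarrow> (complex \<Rightarrow> 'y) \<Rightarrow> 'y" where
  "gamma_int \<theta> r f =
     - integral {r..} (\<lambda>\<rho>. smc (cis (- \<theta>)) (f (complex_of_real \<rho> * cis (- \<theta>))))
     + integral {- \<theta>..\<theta>} (\<lambda>\<phi>. smc (\<i> * complex_of_real r * cis \<phi>) (f (complex_of_real r * cis \<phi>)))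
     + integral {r..} (\<lambda>\<rho>. smc (cis \<theta>) (f (complex_of_real \<rho> * cis \<theta>)))"

end

text \<open>Closed in the angle, unlike \<open>sector\<close>: the two rays of the contour lie on
  the boundary. The polar form matches the parametrisations in \<open>gamma_int\<close>.\<close>

definition closed_sector :: "real \<Rightarrow> complex set" where
  "closed_sector \<theta> = {complex_of_real \<rho> * cis \<phi> | \<rho> \<phi>. \<rho> > 0 \<and> \<bar>\<phi>\<bar> \<le> \<theta>}"

lemma closed_sectorI: "\<rho> > 0 \<Longrightarrow> \<bar>\<phi>\<bar> \<le> \<theta> \<Longrightarrow> complex_of_real \<rho> * cis \<phi> \<in> closed_sector \<theta>"
  by (auto simp: closed_sector_def)

lemma integrable_on_powr_Ici:
  assumes "(1::real) < e" "0 < r"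
  shows "(\<lambda>\<rho>. C * \<rho> powr (- e)) integrable_on {r..}"
    and "integral {r..} (\<lambda>\<rho>. C * \<rho> powr (- e)) = C * (r powr (1 - e) / (e - 1))"
proof -
  have "((\<lambda>\<rho>. \<rho> powr (- e)) has_integral - (r powr (- e + 1)) / (- e + 1)) {r..}"
    using assms by (intro has_integral_powr_to_inf) auto
  moreover have "- (r powr (- e + 1)) / (- e + 1) = r powr (1 - e) / (e - 1)"
    using assms by (simp add: field_simps)
  ultimately have "((\<lambda>\<rho>. \<rho> powr (- e)) has_integral r powr (1 - e) / (e - 1)) {r..}" by simp
  from has_integral_mult_right[OF this, of C]
  show "(\<lambda>\<rho>. C * \<rho> powr (- e)) integrable_on {r..}"
    and "integral {r..} (\<lambda>\<rho>. C * \<rho> powr (- e)) = C * (r powr (1 - e) / (e - 1))"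
    by (rule has_integral_integrable, rule integral_unique)
qed

context complex_banach
begin

lemma continuous_on_ray:
  assumes "continuous_on (closed_sector \<theta>) f" "\<bar>\<phi>\<bar> \<le> \<theta>" "X \<subseteq> {0<..}"
  shows "continuous_on X (\<lambda>\<rho>. smc c (f (complex_of_real \<rho> * cis \<phi>)))"
  by (intro smc.continuous_on continuous_intros continuous_on_compose2[OF assms(1)])
    (use assms in \<open>auto intro!: closed_sectorI\<close>)

lemma continuous_on_arc:
  assumes "continuous_on (closed_sector \<theta>) f" "0 < r"
  shows "continuous_on {- \<theta>..\<theta>} (\<lambda>\<phi>. smc (\<i> * complex_of_real r * cis \<phi>) (f (complex_of_real r * cis \<phi>)))"
  by (intro smc.continuous_on continuous_intros continuous_on_compose2[OF assms(1)])
    (use assms in \<open>auto intro!: closed_sectorI\<close>)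

lemma integrable_on_ray:
  assumes f: "continuous_on (closed_sector \<theta>) f" "\<bar>\<phi>\<bar> \<le> \<theta>" and r: "0 < r" "1 < e"
    and bd: "\<And>\<rho>. r \<le> \<rho> \<Longrightarrow> norm (f (complex_of_real \<rho> * cis \<phi>)) \<le> C * \<rho> powr (- e)"
  shows "(\<lambda>\<rho>. smc (cis \<phi>) (f (complex_of_real \<rho> * cis \<phi>))) integrable_on {r..}"
    and "norm (integral {r..} (\<lambda>\<rho>. smc (cis \<phi>) (f (complex_of_real \<rho> * cis \<phi>)))) \<le> C * (r powr (1 - e) / (e - 1))"
proof -
  show i: "(\<lambda>\<rho>. smc (cis \<phi>) (f (complex_of_real \<rho> * cis \<phi>))) integrable_on {r..}"
  proof (rule integrable_dominated)
    show "continuous_on {r<..} (\<lambda>\<rho>. smc (cis \<phi>) (f (complex_of_real \<rho> * cis \<phi>)))"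
      by (rule continuous_on_ray[OF f]) (use r in auto)
    show "(\<lambda>\<rho>. C * \<rho> powr (- e)) integrable_on {r..}" by (rule integrable_on_powr_Ici) (use r in auto)
  qed (use bd in \<open>auto simp: norm_smc\<close>)
  have "norm (integral {r..} (\<lambda>\<rho>. smc (cis \<phi>) (f (complex_of_real \<rho> * cis \<phi>))))
      \<le> integral {r..} (\<lambda>\<rho>. C * \<rho> powr (- e))"
    by (rule integral_norm_bound_integral[OF i integrable_on_powr_Ici(1)])
      (use r bd in \<open>auto simp: norm_smc\<close>)
  then show "norm (integral {r..} (\<lambda>\<rho>. smc (cis \<phi>) (f (complex_of_real \<rho> * cis \<phi>)))) \<le> C * (r powr (1 - e) / (e - 1))"
    using integrable_on_powr_Ici(2)[OF r(2,1)] by simp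
qed

lemma norm_arc_integral_le:
  assumes f: "continuous_on (closed_sector \<theta>) f" and r: "0 < r" and \<theta>: "0 \<le> \<theta>"
    and bd: "\<And>\<phi>. \<bar>\<phi>\<bar> \<le> \<theta> \<Longrightarrow> norm (f (complex_of_real r * cis \<phi>)) \<le> B"
  shows "norm (integral {- \<theta>..\<theta>} (\<lambda>\<phi>. smc (\<i> * complex_of_real r * cis \<phi>) (f (complex_of_real r * cis \<phi>))))
    \<le> 2 * \<theta> * r * B"
proof -
  have "norm (integral {- \<theta>..\<theta>} (\<lambda>\<phi>. smc (\<i> * complex_of_real r * cis \<phi>) (f (complex_of_real r * cis \<phi>))))
      \<le> r * B * (\<theta> - - \<theta>)"
    by (rule integral_bound[OF _ continuous_on_arc[OF f r]])
      (use r bd \<theta> in \<open>auto simp: norm_smc norm_mult intro!: mult_left_mono\<close>)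
  then show ?thesis by (simp add: mult_ac)
qed

lemma norm_gamma_int_le:
  assumes f: "continuous_on (closed_sector \<theta>) f" and r: "0 < r" "1 < e" and \<theta>: "0 \<le> \<theta>"
    and bd: "\<And>\<rho> \<phi>. r \<le> \<rho> \<Longrightarrow> \<bar>\<phi>\<bar> = \<theta> \<Longrightarrow> norm (f (complex_of_real \<rho> * cis \<phi>)) \<le> C * \<rho> powr (- e)"
    and bd': "\<And>\<phi>. \<bar>\<phi>\<bar> \<le> \<theta> \<Longrightarrow> norm (f (complex_of_real r * cis \<phi>)) \<le> B"
  shows "norm (gamma_int \<theta> r f) \<le> 2 * C * (r powr (1 - e) / (e - 1)) + 2 * \<theta> * r * B"
proof -
  have a: "norm (integral {r..} (\<lambda>\<rho>. smc (cis (- \<theta>)) (f (complex_of_real \<rho> * cis (- \<theta>))))) \<le> C * (r powr (1 - e) / (e - 1))"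
    by (rule integrable_on_ray(2)[OF f _ r bd]) (use \<theta> in auto)
  have b: "norm (integral {r..} (\<lambda>\<rho>. smc (cis \<theta>) (f (complex_of_real \<rho> * cis \<theta>)))) \<le> C * (r powr (1 - e) / (e - 1))"
    by (rule integrable_on_ray(2)[OF f _ r bd]) (use \<theta> in auto)
  have tri: "norm (- p + q + s) \<le> norm p + norm q + norm s" for p q s :: 'y
    using norm_triangle_ineq[of "- p + q" s] norm_triangle_ineq[of "- p" q] by simp
  show ?thesis unfolding gamma_int_def
    using a b norm_arc_integral_le[OF f r(1) \<theta> bd'] by (intro order_trans[OF tri]) linarith
qed

text \<open>The derivative in \<open>r\<close> of the arc integral is the difference of the boundary values,
because \<open>r \<partial>\<^sub>r\<close> and \<open>- \<i> \<partial>\<^sub>\<phi>\<close> agree on complex differentiable functions.\<close>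

lemma arc_integral_diff:
  assumes f: "\<And>z. z \<in> closed_sector \<theta> \<Longrightarrow> (f has_derivative (\<lambda>h. smc h (f' z))) (at z)"
    and f': "continuous_on (closed_sector \<theta>) f'"
    and r: "0 < r0" "r0 \<le> r1" and \<theta>: "0 \<le> \<theta>"
  defines "A \<equiv> \<lambda>r. integral {- \<theta>..\<theta>} (\<lambda>\<phi>. smc (\<i> * complex_of_real r * cis \<phi>) (f (complex_of_real r * cis \<phi>)))"
  shows "((\<lambda>\<rho>. smc (cis \<theta>) (f (complex_of_real \<rho> * cis \<theta>))
            - smc (cis (- \<theta>)) (f (complex_of_real \<rho> * cis (- \<theta>)))) has_integral (A r1 - A r0)) {r0..r1}"
proof (rule fundamental_theorem_of_calculus[OF r(2)])
  fix r assume rr: "r \<in> {r0..r1}"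
  then have r0: "r > 0" using r by simp
  have fc: "continuous_on (closed_sector \<theta>) f"
    by (rule has_derivative_continuous_on, rule has_derivative_at_withinI, rule f)
  define g where "g x t = smc (\<i> * cis t) (f (complex_of_real x * cis t))
      + smc (\<i> * complex_of_real x * cis t) (smc (cis t) (f' (complex_of_real x * cis t)))" for x t
  have dcis: "(cis has_vector_derivative \<i> * cis t) (at t within X)" for t X
    by (auto simp: has_vector_derivative_def intro!: derivative_eq_intros)
  have fch: "((\<lambda>x. f (w x)) has_vector_derivative smc w' (f' (w x))) (at x within X)"
    if "(w has_vector_derivative w') (at x within X)" "w x \<in> closed_sector \<theta>" for w w' x X
    using vector_derivative_diff_chain_within[OF that(1) has_derivative_at_withinI[OF f[OF that(2)]]]
    by (simp add: o_def)
  have "((\<lambda>x. integral (cbox (- \<theta>) \<theta>) (\<lambda>t. smc (\<i> * complex_of_real x * cis t) (f (complex_of_real x * cis t))))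
      has_vector_derivative integral (cbox (- \<theta>) \<theta>) (g r)) (at r within {r0..r1})"
  proof (rule leibniz_rule_vector_derivative)
    fix x t assume x: "x \<in> {r0..r1}" and t: "t \<in> cbox (- \<theta>) \<theta>"
    have S: "complex_of_real x * cis t \<in> closed_sector \<theta>" using x t r by (intro closed_sectorI) auto
    have d1: "((\<lambda>x. complex_of_real x * cis t) has_vector_derivative cis t) (at x within {r0..r1})"
      by (auto simp: has_vector_derivative_def scaleR_conv_of_real intro!: derivative_eq_intros)
    have d2: "((\<lambda>x. \<i> * complex_of_real x * cis t) has_vector_derivative \<i> * cis t) (at x within {r0..r1})"
      by (auto simp: has_vector_derivative_def scaleR_conv_of_real intro!: derivative_eq_intros)
    show "((\<lambda>x. smc (\<i> * complex_of_real x * cis t) (f (complex_of_real x * cis t))) has_vector_derivative g x t)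
        (at x within {r0..r1})"
      using smc.has_vector_derivative[OF d2 fch[OF d1 S]] by (simp add: g_def add.commute)
  next
    fix x assume "x \<in> {r0..r1}"
    then show "(\<lambda>t. smc (\<i> * complex_of_real x * cis t) (f (complex_of_real x * cis t))) integrable_on cbox (- \<theta>) \<theta>"
      using continuous_on_arc[OF fc, of x] r by (intro integrable_continuous) auto
  next
    show "continuous_on ({r0..r1} \<times> cbox (- \<theta>) \<theta>) (\<lambda>(x, t). g x t)"
      unfolding g_def case_prod_beta
      by (intro smc.continuous_on continuous_intros continuous_on_compose2[OF fc] continuous_on_compose2[OF f'])
        (use r in \<open>auto intro!: closed_sectorI\<close>)
  qed (use rr in auto)
  moreover have "(g r has_integral (smc (cis \<theta>) (f (complex_of_real r * cis \<theta>))
            - smc (cis (- \<theta>)) (f (complex_of_real r * cis (- \<theta>))))) {- \<theta>..\<theta>}"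
  proof (rule fundamental_theorem_of_calculus)
    fix t assume t: "t \<in> {- \<theta>..\<theta>}"
    have S: "complex_of_real r * cis t \<in> closed_sector \<theta>" using r0 t by (intro closed_sectorI) auto
    have "((\<lambda>t. complex_of_real r * cis t) has_vector_derivative complex_of_real r * (\<i> * cis t)) (at t within {- \<theta>..\<theta>})"
      by (intro has_vector_derivative_mult_right dcis)
    from smc.has_vector_derivative[OF dcis fch[OF this S]]
    show "((\<lambda>t. smc (cis t) (f (complex_of_real r * cis t))) has_vector_derivative g r t) (at t within {- \<theta>..\<theta>})"
      by (simp add: g_def add.commute smc_mult[symmetric] mult_ac)
  qed (use \<theta> in simp)
  ultimately show "(A has_vector_derivative (smc (cis \<theta>) (f (complex_of_real r * cis \<theta>))
            - smc (cis (- \<theta>)) (f (complex_of_real r * cis (- \<theta>))))) (at r within {r0..r1})"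
    by (simp add: A_def integral_unique)
qed

text \<open>Cauchy's theorem for a truncated sector: by \<open>arc_integral_diff\<close> the two
  arcs differ by exactly the segments of the rays between the two radii. The decay serves only to
  make the ray integrals converge.\<close>

lemma gamma_int_radius:
  assumes f: "\<And>z. z \<in> closed_sector \<theta> \<Longrightarrow> (f has_derivative (\<lambda>h. smc h (f' z))) (at z)"
    and f': "continuous_on (closed_sector \<theta>) f'"
    and r: "0 < r0" "r0 \<le> r1" and \<theta>: "0 \<le> \<theta>" and e: "1 < e"
    and bd: "\<And>\<rho> \<phi>. r0 \<le> \<rho> \<Longrightarrow> \<bar>\<phi>\<bar> = \<theta> \<Longrightarrow> norm (f (complex_of_real \<rho> * cis \<phi>)) \<le> C * \<rho> powr (- e)"
  shows "gamma_int \<theta> r1 f = gamma_int \<theta> r0 f"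
proof -
  have fc: "continuous_on (closed_sector \<theta>) f"
    by (rule has_derivative_continuous_on, rule has_derivative_at_withinI, rule f)
  let ?k = "\<lambda>\<phi> \<rho>. smc (cis \<phi>) (f (complex_of_real \<rho> * cis \<phi>))"
  have split: "integral {r0..} (?k \<phi>) = integral {r0..r1} (?k \<phi>) + integral {r1..} (?k \<phi>)"
    and ii: "?k \<phi> integrable_on {r0..r1}" if \<phi>: "\<bar>\<phi>\<bar> = \<theta>" for \<phi>
  proof -
    show i: "?k \<phi> integrable_on {r0..r1}"
      by (rule integrable_continuous_interval, rule continuous_on_ray[OF fc]) (use \<phi> r in auto)
    have j: "?k \<phi> integrable_on {r1..}"
      by (rule integrable_on_ray(1)[OF fc _ _ e, where C = C]) (use r \<phi> bd in auto)
    have u: "{r0..} = {r0..r1} \<union> {r1..}" using r by auto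
    show "integral {r0..} (?k \<phi>) = integral {r0..r1} (?k \<phi>) + integral {r1..} (?k \<phi>)"
      unfolding u by (rule integral_Un[OF i j], rule negligible_subset[OF negligible_sing[of r1]]) auto
  qed
  have d: "integral {r0..r1} (\<lambda>\<rho>. ?k \<theta> \<rho> - ?k (- \<theta>) \<rho>) =
      integral {- \<theta>..\<theta>} (\<lambda>\<phi>. smc (\<i> * complex_of_real r1 * cis \<phi>) (f (complex_of_real r1 * cis \<phi>)))
      - integral {- \<theta>..\<theta>} (\<lambda>\<phi>. smc (\<i> * complex_of_real r0 * cis \<phi>) (f (complex_of_real r0 * cis \<phi>)))"
    by (rule integral_unique, rule arc_integral_diff[OF f f' r \<theta>])
  have "integral {r0..r1} (\<lambda>\<rho>. ?k \<theta> \<rho> - ?k (- \<theta>) \<rho>) = integral {r0..r1} (?k \<theta>) - integral {r0..r1} (?k (- \<theta>))"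
    by (rule integral_diff) (use ii \<theta> in auto)
  note A = diff_eq_eq[THEN iffD1, OF trans[OF this[symmetric] d, symmetric]]
  have s: "integral {r0..} (?k \<theta>) = integral {r0..r1} (?k \<theta>) + integral {r1..} (?k \<theta>)"
    "integral {r0..} (?k (- \<theta>)) = integral {r0..r1} (?k (- \<theta>)) + integral {r1..} (?k (- \<theta>))"
    by (rule split, use \<theta> in simp)+
  show ?thesis unfolding gamma_int_def A s by simp
qed

text \<open>Here the decay holds in the whole sector, so the arc of radius x contributes at most a
  multiple of x * x^(-e), and so do the rays. The integral is independent of x, hence 0.\<close>

lemma gamma_int_eq_0:
  assumes f: "\<And>z. z \<in> closed_sector \<theta> \<Longrightarrow> (f has_derivative (\<lambda>h. smc h (f' z))) (at z)"
    and f': "continuous_on (closed_sector \<theta>) f'"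
    and r: "0 < r" and \<theta>: "0 \<le> \<theta>" and e: "1 < e"
    and bd: "\<And>\<rho> \<phi>. r \<le> \<rho> \<Longrightarrow> \<bar>\<phi>\<bar> \<le> \<theta> \<Longrightarrow> norm (f (complex_of_real \<rho> * cis \<phi>)) \<le> C * \<rho> powr (- e)"
  shows "gamma_int \<theta> r f = 0"
proof -
  have fc: "continuous_on (closed_sector \<theta>) f"
    by (rule has_derivative_continuous_on, rule has_derivative_at_withinI, rule f)
  define B where "B x = (2 * C / (e - 1) + 2 * \<theta> * C) * x powr (1 - e)" for x :: real
  have le: "norm (gamma_int \<theta> r f) \<le> B x" if x: "x \<ge> r" for x
  proof -
    have x0: "x > 0" using x r by simp
    have "gamma_int \<theta> r f = gamma_int \<theta> x f"
      by (rule gamma_int_radius[OF f f' r x \<theta> e bd, symmetric]) auto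
    also have "norm \<dots> \<le> 2 * C * (x powr (1 - e) / (e - 1)) + 2 * \<theta> * x * (C * x powr (- e))"
      by (rule norm_gamma_int_le[OF fc x0 e \<theta> bd bd]) (use x in auto)
    also have "\<dots> = B x"
      using x0 powr_add[of x 1 "- e"] by (simp add: B_def field_simps)
    finally show ?thesis .
  qed
  have "(B \<longlongrightarrow> (2 * C / (e - 1) + 2 * \<theta> * C) * 0) at_top"
    unfolding B_def by (intro tendsto_mult tendsto_const tendsto_neg_powr filterlim_ident) (use e in auto)
  then have "(B \<longlongrightarrow> 0) at_top" by simp
  then have "norm (gamma_int \<theta> r f) \<le> 0"
    by (rule tendsto_lowerbound) (auto intro!: eventually_at_top_linorderI le)
  then show ?thesis by simp
qed

end

section \<open>Scalar kernels\<close>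

lemma has_integral_reflect_Icc:
  fixes f :: "real \<Rightarrow> 'a::banach"
  shows "((\<lambda>s. f (t - s)) has_integral i) {0..t} \<longleftrightarrow> (f has_integral i) {0..t}"
proof -
  have "(f has_integral i) {0..t} \<longleftrightarrow> ((f \<circ> (+) t) has_integral i) {- t..0}"
    by (subst has_integral_shift_Icc_real) simp
  also have "\<dots> \<longleftrightarrow> ((\<lambda>x. (f \<circ> (+) t) (- x)) has_integral i) {- 0..- (- t)}"
    by (subst has_integral_reflect_real) simp
  finally show ?thesis by (simp add: o_def)
qed

lemma has_integral_powr_reflect:
  assumes "a > -1" "0 \<le> (t::real)"
  shows "((\<lambda>s. (t - s) powr a) has_integral (t powr (a + 1) / (a + 1))) {0..t}"
  unfolding has_integral_reflect_Icc[of "\<lambda>s. s powr a"] by (rule has_integral_powr_from_0) (use assms in auto)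

lemma norm_exp_second_order:
  fixes z w :: complex
  shows "norm (exp (z + w) - exp z - w * exp z) \<le> exp (Re z) * exp \<bar>Re w\<bar> * (norm w)\<^sup>2"
proof -
  have "norm (exp w - 1 - w) \<le> exp \<bar>Re w\<bar> * (norm w)\<^sup>2"
    using Taylor_exp[of w 1] by (simp add: algebra_simps power2_eq_square)
  then have "norm (exp z) * norm (exp w - 1 - w) \<le> norm (exp z) * (exp \<bar>Re w\<bar> * (norm w)\<^sup>2)"
    by (rule mult_left_mono) simp
  moreover have "exp (z + w) - exp z - w * exp z = exp z * (exp w - 1 - w)"
    by (simp add: exp_add algebra_simps)
  ultimately show ?thesis by (simp only: norm_mult norm_exp_eq_Re mult.assoc)
qed

lemma complex_banach_times: "complex_banach ((*) :: complex \<Rightarrow> complex \<Rightarrow> complex)"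
  by unfold_locales (auto simp: complex_structure_def scaleR_conv_of_real algebra_simps norm_mult)

lemma mem_closed_sectorD:
  assumes "z \<in> closed_sector \<theta>" "\<theta> < pi"
  shows "z \<noteq> 0" "z \<notin> \<real>\<^sub>\<le>\<^sub>0" "\<bar>Arg z\<bar> \<le> \<theta>"
proof -
  obtain \<rho> \<phi> where z: "z = complex_of_real \<rho> * cis \<phi>" "\<rho> > 0" "\<bar>\<phi>\<bar> \<le> \<theta>"
    using assms(1) by (auto simp: closed_sector_def)
  have "Arg z = \<phi>"
    unfolding z(1) using z assms(2) by (intro Arg_unique) (auto simp: cis_conv_exp)
  then show "\<bar>Arg z\<bar> \<le> \<theta>" using z by simp
  show z0: "z \<noteq> 0" using z by simp
  show "z \<notin> \<real>\<^sub>\<le>\<^sub>0"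
  proof
    assume "z \<in> \<real>\<^sub>\<le>\<^sub>0"
    then have "Arg z = pi" using z0 by (simp add: Arg_eq_pi complex_nonpos_Reals_iff complex_eq_iff)
    then show False using \<open>\<bar>Arg z\<bar> \<le> \<theta>\<close> assms(2) by simp
  qed
qed

text \<open>Write exp z = 1 + z g(z) with g entire and G a primitive of g. Then \<phi> - i G(R cis
  \<phi>) is an antiderivative of the integrand, and the G terms cancel because the endpoints - pi
  and pi give the same point of the circle.\<close>

lemma integral_exp_circle:
  "integral {- pi..pi} (\<lambda>\<phi>. exp (complex_of_real R * cis \<phi>)) = 2 * pi"
proof -
  define g where "g z = (if z = 0 then deriv exp 0 else (exp z - exp 0) / (z - 0))" for z :: complex
  have "g holomorphic_on UNIV" unfolding g_def by (rule pole_lemma_open) (auto intro: holomorphic_intros)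
  then obtain G where "\<And>z. z \<in> UNIV \<Longrightarrow> (G has_field_derivative g z) (at z within UNIV)"
    using holomorphic_convex_primitive'[of UNIV g] by auto
  then have G: "(G has_field_derivative g z) (at z)" for z by simp
  have e: "exp z = 1 + z * g z" for z by (simp add: g_def)
  have "((\<lambda>\<phi>. complex_of_real \<phi> - \<i> * G (complex_of_real R * cis \<phi>)) has_vector_derivative
      exp (complex_of_real R * cis \<phi>)) (at \<phi> within {- pi..pi})" for \<phi>
  proof -
    have "(cis has_vector_derivative \<i> * cis \<phi>) (at \<phi> within {- pi..pi})"
      by (auto simp: has_vector_derivative_def intro!: derivative_eq_intros)
    then have "((\<lambda>\<phi>. complex_of_real R * cis \<phi>) has_vector_derivative complex_of_real R * (\<i> * cis \<phi>)) (at \<phi> within {- pi..pi})"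
      by (rule has_vector_derivative_mult_right)
    from field_vector_diff_chain_within[OF this has_field_derivative_at_within[OF G]]
    have "((\<lambda>\<phi>. G (complex_of_real R * cis \<phi>)) has_vector_derivative
        complex_of_real R * (\<i> * cis \<phi>) * g (complex_of_real R * cis \<phi>)) (at \<phi> within {- pi..pi})"
      by (simp add: o_def)
    from has_vector_derivative_mult_right[OF this, of \<i>]
    have d: "((\<lambda>\<phi>. \<i> * G (complex_of_real R * cis \<phi>)) has_vector_derivative
        \<i> * (complex_of_real R * (\<i> * cis \<phi>) * g (complex_of_real R * cis \<phi>))) (at \<phi> within {- pi..pi})" .
    have "(complex_of_real has_vector_derivative 1) (at \<phi> within {- pi..pi})"
      by (auto simp: has_vector_derivative_def scaleR_conv_of_real intro!: derivative_eq_intros)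
    from has_vector_derivative_diff[OF this d]
    have "((\<lambda>\<phi>. complex_of_real \<phi> - \<i> * G (complex_of_real R * cis \<phi>)) has_vector_derivative
      1 - (\<i> * \<i>) * (complex_of_real R * cis \<phi> * g (complex_of_real R * cis \<phi>))) (at \<phi> within {- pi..pi})"
      by (simp only: mult_ac)
    then show ?thesis by (subst e) simp
  qed
  then have "((\<lambda>\<phi>. exp (complex_of_real R * cis \<phi>)) has_integral
     ((complex_of_real pi - \<i> * G (complex_of_real R * cis pi)) -
      (complex_of_real (- pi) - \<i> * G (complex_of_real R * cis (- pi))))) {- pi..pi}"
    by (intro fundamental_theorem_of_calculus) auto
  moreover have "cis (- pi) = cis pi" by (simp add: cis.ctr complex_eq_iff)
  ultimately show ?thesis by (simp add: integral_unique)
qed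

lemma cos_le_cos_boundary:
  assumes "0 \<le> \<theta>" "\<theta> \<le> \<bar>\<phi>\<bar>" "\<bar>\<phi>\<bar> \<le> pi" shows "cos \<phi> \<le> cos \<theta>"
  using cos_monotone_0_pi_le[of \<theta> "\<bar>\<phi>\<bar>"] assms by simp

text \<open>For x > 1 compare x^m with x^n and keep the single term of index n of the exponential
  series; for x \<le> 1 the power is at most 1.\<close>

lemma exp_neg_le_powr:
  fixes x :: real
  assumes "x > 0" "0 \<le> m" "m \<le> real n" shows "exp (- x) \<le> fact n * x powr (- m)"
proof -
  have "x powr m \<le> fact n * exp x"
  proof (cases "x \<le> 1")
    case True
    have "x powr m \<le> 1" using True assms by (simp add: powr_le1)
    also have "1 \<le> fact n * exp x" using assms(1) by (simp add: mult_ge1_I)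
    finally show ?thesis .
  next
    case False
    then have "x powr m \<le> x powr real n" using assms by (intro powr_mono) auto
    also have "\<dots> = x ^ n" using assms by (simp add: powr_realpow)
    also have "x ^ n \<le> fact n * exp x"
    proof -
      have "inverse (fact n) * x ^ n \<le> (\<Sum>k. inverse (fact k) * x ^ k)"
        using sum_le_suminf[OF summable_exp[of x], of "{n}"] assms(1) by auto
      also have "\<dots> = exp x" by (simp add: exp_def scaleR_conv_of_real)
      finally show ?thesis by (simp add: field_simps)
    qed
    finally show ?thesis .
  qed
  then show ?thesis using assms(1) by (simp add: exp_minus powr_minus field_simps)
qed

text \<open>This is the residue at 0, and it produces the identity operator subtracted from G. The
  radius is sent to infinity: the arc completed to a full circle gives 2 pi i by
  \<open>integral_exp_circle\<close>, while on the added arc, where cos \<phi> \<le> cos \<theta> <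
  0, and on the rays the contributions vanish.\<close>

lemma gamma_int_exp_div:
  assumes \<theta>: "pi / 2 < \<theta>" "\<theta> < pi" and t: "0 < t" and r: "0 < r"
  shows "complex_banach.gamma_int (*) \<theta> r (\<lambda>z. exp (z * complex_of_real t) / z) = 2 * pi * \<i>"
proof -
  interpret complex_banach "(*) :: complex \<Rightarrow> complex \<Rightarrow> complex" by (rule complex_banach_times)
  let ?f = "\<lambda>z. exp (z * complex_of_real t) / z"
  define \<kappa> where "\<kappa> = - cos \<theta>"
  have \<kappa>: "\<kappa> > 0" using \<theta> by (simp add: \<kappa>_def cos_lt_zero_pi)
  have nz: "z \<noteq> 0" if "z \<in> closed_sector \<theta>" for z using mem_closed_sectorD[OF that] \<theta> by simp
  define f' where "f' z = exp (z * complex_of_real t) * complex_of_real t / z - exp (z * complex_of_real t) / (z * z)" for z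
  have f: "(?f has_derivative (\<lambda>h. h * f' z)) (at z)" if "z \<in> closed_sector \<theta>" for z
    unfolding f'_def using nz[OF that]
    by (auto intro!: derivative_eq_intros simp: field_simps)
  have f'c: "continuous_on (closed_sector \<theta>) f'"
    unfolding f'_def by (intro continuous_intros) (use nz in auto)
  have fc: "continuous_on (closed_sector \<theta>) ?f"
    by (intro continuous_intros) (use nz in auto)
  have bd: "norm (?f (complex_of_real \<rho> * cis \<phi>)) \<le> (1 / (\<kappa> * t)) * \<rho> powr (- 2)" if \<rho>: "\<rho> > 0" and "\<bar>\<phi>\<bar> = \<theta>" for \<rho> \<phi>
  proof -
    have "cos \<phi> = - \<kappa>" using that by (auto simp: \<kappa>_def abs_if split: if_splits)
    then have "norm (?f (complex_of_real \<rho> * cis \<phi>)) = exp (- (\<kappa> * t * \<rho>)) / \<rho>"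
      using \<rho> by (simp add: norm_divide norm_mult mult_ac)
    also have "\<dots> \<le> (\<kappa> * t * \<rho>) powr (- 1) / \<rho>"
      using exp_neg_le_powr[of "\<kappa> * t * \<rho>" 1 1] \<rho> \<kappa> t by (intro divide_right_mono) auto
    also have "\<dots> = (1 / (\<kappa> * t)) * \<rho> powr (- 2)"
      using \<rho> \<kappa> t by (simp add: powr_minus_divide field_simps power2_eq_square)
    finally show ?thesis .
  qed
  define B where "B x = 2 * (1 / (\<kappa> * t)) * (x powr (- 1)) + 2 * pi * exp (- (\<kappa> * t * x))" for x :: real
  have le: "norm (gamma_int \<theta> r ?f - 2 * pi * \<i>) \<le> B x" if x: "x \<ge> r" for x
  proof -
    have x0: "x > 0" using x r by simp
    have "gamma_int \<theta> r ?f = gamma_int \<theta> x ?f"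
      by (rule gamma_int_radius[OF f f'c r x _ _ bd, symmetric]) (use \<theta> r in auto)
    let ?a = "\<lambda>\<phi>. \<i> * exp (complex_of_real (x * t) * cis \<phi>)"
    have aeq: "\<i> * complex_of_real x * cis \<phi> * ?f (complex_of_real x * cis \<phi>) = ?a \<phi>" for \<phi>
      using x0 by (simp add: mult_ac)
    have ai: "?a integrable_on {a..b}" for a b
      by (intro integrable_continuous_interval continuous_intros)
    have alg: "u + v = w \<Longrightarrow> c + d = v \<Longrightarrow> w = p \<Longrightarrow> c - p = - (u + d)" for u v w c d p :: complex
      by auto
    have i1: "integral {- pi..- \<theta>} ?a + integral {- \<theta>..pi} ?a = integral {- pi..pi} ?a"
      by (rule Henstock_Kurzweil_Integration.integral_combine[OF _ _ ai]) (use \<theta> in auto)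
    have i2: "integral {- \<theta>..\<theta>} ?a + integral {\<theta>..pi} ?a = integral {- \<theta>..pi} ?a"
      by (rule Henstock_Kurzweil_Integration.integral_combine[OF _ _ ai]) (use \<theta> in auto)
    have i3: "integral {- pi..pi} ?a = 2 * pi * \<i>"
      using integral_exp_circle[of "x * t"] by simp
    have arc: "integral {- \<theta>..\<theta>} ?a - 2 * pi * \<i> = - (integral {- pi..- \<theta>} ?a + integral {\<theta>..pi} ?a)"
      by (rule alg[OF i1 i2 i3])
    have small: "norm (integral {a..b} ?a) \<le> exp (- (\<kappa> * t * x)) * (b - a)"
      if "a \<le> b" "\<And>\<phi>. \<phi> \<in> {a..b} \<Longrightarrow> \<theta> \<le> \<bar>\<phi>\<bar> \<and> \<bar>\<phi>\<bar> \<le> pi" for a b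
    proof (rule integral_bound[OF that(1)])
      show "continuous_on {a..b} ?a" by (intro continuous_intros)
      fix \<phi> assume "\<phi> \<in> {a..b}"
      then have "cos \<phi> \<le> - \<kappa>" using cos_le_cos_boundary[of \<theta> \<phi>] that(2) \<theta> by (auto simp: \<kappa>_def)
      then have "x * t * cos \<phi> \<le> x * t * (- \<kappa>)" using x0 t by (intro mult_left_mono) auto
      then show "norm (?a \<phi>) \<le> exp (- (\<kappa> * t * x))"
        by (simp add: norm_mult mult_ac)
    qed
    have s1: "norm (integral {- pi..- \<theta>} ?a) \<le> exp (- (\<kappa> * t * x)) * (- \<theta> - - pi)"
      by (rule small) (use \<theta> in auto)
    have s2: "norm (integral {\<theta>..pi} ?a) \<le> exp (- (\<kappa> * t * x)) * (pi - \<theta>)"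
      by (rule small) (use \<theta> in auto)
    have ray: "norm (integral {x..} (\<lambda>\<rho>. cis \<phi> * ?f (complex_of_real \<rho> * cis \<phi>))) \<le> (1 / (\<kappa> * t)) * (x powr (1 - 2) / (2 - 1))"
      if "\<bar>\<phi>\<bar> = \<theta>" for \<phi>
      by (rule integrable_on_ray(2)[OF fc _ x0]) (use that bd x0 in auto)
    have ab: "\<bar>\<theta>\<bar> = \<theta>" "\<bar>- \<theta>\<bar> = \<theta>" using \<theta> pi_gt_zero by linarith+
    have tri: "norm (- p + q + s - c) \<le> norm p + norm (q - c) + norm s" for p q s c :: complex
      using norm_triangle_ineq[of "- p + (q - c)" s] norm_triangle_ineq[of "- p" "q - c"] by (simp add: algebra_simps)
    have "norm (gamma_int \<theta> x ?f - 2 * pi * \<i>) \<le> B x"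
      unfolding gamma_int_def aeq
    proof (rule order_trans[OF tri])
      have "norm (integral {- \<theta>..\<theta>} ?a - 2 * pi * \<i>) \<le> exp (- (\<kappa> * t * x)) * (2 * pi)"
      proof -
        have "norm (integral {- \<theta>..\<theta>} ?a - 2 * pi * \<i>) \<le> exp (- (\<kappa> * t * x)) * (- \<theta> - - pi) + exp (- (\<kappa> * t * x)) * (pi - \<theta>)"
          unfolding arc norm_minus_cancel using s1 s2 by (intro norm_triangle_le add_mono)
        also have "\<dots> = exp (- (\<kappa> * t * x)) * (2 * (pi - \<theta>))" by (simp add: algebra_simps)
        also have "\<dots> \<le> exp (- (\<kappa> * t * x)) * (2 * pi)" using \<theta> by (intro mult_left_mono) auto
        finally show ?thesis .
      qed
      moreover have "B x = (1 / (\<kappa> * t)) * (x powr (1 - 2) / (2 - 1)) + exp (- (\<kappa> * t * x)) * (2 * pi) + (1 / (\<kappa> * t)) * (x powr (1 - 2) / (2 - 1))"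
        by (simp add: B_def)
      ultimately show "norm (integral {x..} (\<lambda>\<rho>. cis (- \<theta>) * ?f (complex_of_real \<rho> * cis (- \<theta>)))) +
         norm (integral {- \<theta>..\<theta>} ?a - 2 * pi * \<i>) +
         norm (integral {x..} (\<lambda>\<rho>. cis \<theta> * ?f (complex_of_real \<rho> * cis \<theta>))) \<le> B x"
        using ray[OF ab(1)] ray[OF ab(2)] by linarith
    qed
    then show ?thesis using \<open>gamma_int \<theta> r ?f = gamma_int \<theta> x ?f\<close> by simp
  qed
  have "(B \<longlongrightarrow> 2 * (1 / (\<kappa> * t)) * 0 + 2 * pi * 0) at_top"
    unfolding B_def
  proof (intro tendsto_add tendsto_mult tendsto_const tendsto_neg_powr filterlim_ident)
    show "((\<lambda>x. exp (- (\<kappa> * t * x))) \<longlongrightarrow> 0) at_top"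
    proof (rule filterlim_compose[OF exp_at_bot])
      show "filterlim (\<lambda>x. - (\<kappa> * t * x)) at_bot at_top"
        unfolding filterlim_uminus_at_bot minus_minus
        using filterlim_tendsto_pos_mult_at_top[OF tendsto_const[of "\<kappa> * t"] _ filterlim_ident] \<kappa> t by simp
    qed
  qed simp
  then have B0: "(B \<longlongrightarrow> 0) at_top" by simp
  have "norm (gamma_int \<theta> r ?f - 2 * pi * \<i>) \<le> 0"
    by (rule tendsto_lowerbound[OF B0 eventually_at_top_linorderI[OF le]]) simp_all
  then show ?thesis by simp
qed

section \<open>The incomplete Gamma function of a complex argument\<close>

definition low_gamma :: "real \<Rightarrow> real \<Rightarrow> complex \<Rightarrow> complex" where
  "low_gamma \<alpha> t z = integral {0..t} (\<lambda>s. complex_of_real (s powr (\<alpha> - 1)) * exp (- (z * complex_of_real s)))"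

lemma exp_mult_le:
  assumes "0 \<le> s" "s \<le> t" shows "exp (Re (- (z * complex_of_real s))) \<le> exp (cmod z * t)"
proof -
  have "(- Re z) * s \<le> \<bar>Re z\<bar> * s" using assms by (intro mult_right_mono) auto
  also have "\<dots> \<le> cmod z * t" using assms abs_Re_le_cmod[of z] by (intro mult_mono) auto
  finally show ?thesis by simp
qed

lemma low_gamma_integrable:
  assumes "0 < \<alpha>" "0 \<le> t"
  shows "(\<lambda>s. complex_of_real (s powr (\<alpha> - 1)) * exp (- (z * complex_of_real s))) integrable_on {0..t}"
proof (rule integrable_dominated[OF interval_with_interior_Icc])
  show "continuous_on {0<..<t} (\<lambda>s. complex_of_real (s powr (\<alpha> - 1)) * exp (- (z * complex_of_real s)))"
    by (intro continuous_intros) auto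
  have "(\<lambda>s. s powr (\<alpha> - 1)) integrable_on {0..t}" using assms by (intro integrable_on_powr_from_0) auto
  from integrable_cmul[OF this, of "exp (cmod z * t)"]
  show "(\<lambda>s. exp (cmod z * t) * s powr (\<alpha> - 1)) integrable_on {0..t}" by simp
  show "norm (complex_of_real (s powr (\<alpha> - 1)) * exp (- (z * complex_of_real s))) \<le> exp (cmod z * t) * s powr (\<alpha> - 1)"
    if "s \<in> {0<..<t}" for s
    using exp_mult_le[of s t z] that by (simp add: norm_mult mult.commute mult_right_mono)
qed

lemma low_gamma_derivative:
  assumes \<alpha>: "0 < \<alpha>" and t: "0 \<le> t"
  shows "(low_gamma \<alpha> t has_field_derivative - low_gamma (\<alpha> + 1) t z) (at z)"
  unfolding has_field_derivative_def low_gamma_def[of \<alpha> t, abs_def]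
proof (rule has_derivative_integral_dominated[OF interval_with_interior_Icc, where \<delta> = 1
      and f' = "\<lambda>h s. - (complex_of_real (s powr (\<alpha> + 1 - 1)) * exp (- (z * complex_of_real s))) * h"
      and g = "\<lambda>s. exp (cmod z * t) * exp t * t\<^sup>2 * s powr (\<alpha> - 1)"])
  show "(\<lambda>s. complex_of_real (s powr (\<alpha> - 1)) * exp (- ((z + h) * complex_of_real s))) integrable_on {0..t}" for h
    by (rule low_gamma_integrable[OF \<alpha> t])
  show "bounded_linear ((*) (- low_gamma (\<alpha> + 1) t z))" by (rule bounded_linear_mult_right)
  show "((\<lambda>s. - (complex_of_real (s powr (\<alpha> + 1 - 1)) * exp (- (z * complex_of_real s))) * h) has_integral
     - low_gamma (\<alpha> + 1) t z * h) {0..t}" for h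
    unfolding low_gamma_def
    by (intro has_integral_mult_left has_integral_neg integrable_integral low_gamma_integrable) (use \<alpha> t in auto)
  have "(\<lambda>s. s powr (\<alpha> - 1)) integrable_on {0..t}" using assms by (intro integrable_on_powr_from_0) auto
  from integrable_cmul[OF this, of "exp (cmod z * t) * exp t * t\<^sup>2"]
  show "(\<lambda>s. exp (cmod z * t) * exp t * t\<^sup>2 * s powr (\<alpha> - 1)) integrable_on {0..t}" by simp
  fix h :: complex and s assume h: "norm h < 1" and s: "s \<in> {0<..<t}"
  let ?w = "- (h * complex_of_real s)" and ?z = "- (z * complex_of_real s)"
  have eq: "complex_of_real (s powr (\<alpha> - 1)) * exp (- ((z + h) * complex_of_real s)) -
        complex_of_real (s powr (\<alpha> - 1)) * exp ?z -
        - (complex_of_real (s powr (\<alpha> + 1 - 1)) * exp ?z) * h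
      = complex_of_real (s powr (\<alpha> - 1)) * (exp (?z + ?w) - exp ?z - ?w * exp ?z)"
    using s powr_add[of s "\<alpha> - 1" 1] by (simp add: algebra_simps)
  have "norm (exp (?z + ?w) - exp ?z - ?w * exp ?z) \<le> exp (Re ?z) * exp \<bar>Re ?w\<bar> * (norm ?w)\<^sup>2"
    by (rule norm_exp_second_order)
  also have "\<dots> \<le> exp (cmod z * t) * exp t * ((norm h)\<^sup>2 * t\<^sup>2)"
  proof (intro mult_mono exp_mult_le)
    have "\<bar>Re h\<bar> * s \<le> 1 * t" using h s abs_Re_le_cmod[of h] by (intro mult_mono) auto
    then show "exp \<bar>Re ?w\<bar> \<le> exp t" using s by (simp add: abs_mult)
    show "(norm ?w)\<^sup>2 \<le> (norm h)\<^sup>2 * t\<^sup>2"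
      using s by (simp add: norm_mult power_mult_distrib mult_left_mono power_mono)
  qed (use s in auto)
  finally have "s powr (\<alpha> - 1) * norm (exp (?z + ?w) - exp ?z - ?w * exp ?z)
      \<le> s powr (\<alpha> - 1) * (exp (cmod z * t) * exp t * ((norm h)\<^sup>2 * t\<^sup>2))"
    by (rule mult_left_mono) simp
  then show "norm (complex_of_real (s powr (\<alpha> - 1)) * exp (- ((z + h) * complex_of_real s)) -
        complex_of_real (s powr (\<alpha> - 1)) * exp ?z -
        - (complex_of_real (s powr (\<alpha> + 1 - 1)) * exp ?z) * h)
      \<le> (norm h)\<^sup>2 * (exp (cmod z * t) * exp t * t\<^sup>2 * s powr (\<alpha> - 1))"
    unfolding eq by (simp add: norm_mult mult_ac)
qed simp

text \<open>Integration by parts: differentiate s^\<alpha> exp (- z s) and integrate over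
  [0, t].\<close>

lemma low_gamma_recurrence:
  assumes \<alpha>: "0 < \<alpha>" and t: "0 \<le> t"
  shows "complex_of_real (t powr \<alpha>) * exp (- (z * complex_of_real t))
    = complex_of_real \<alpha> * low_gamma \<alpha> t z - z * low_gamma (\<alpha> + 1) t z"
proof -
  let ?F = "\<lambda>s. complex_of_real (s powr \<alpha>) * exp (- (z * complex_of_real s))"
  let ?f = "\<lambda>a s. complex_of_real (s powr (a - 1)) * exp (- (z * complex_of_real s))"
  have "((\<lambda>s. complex_of_real \<alpha> * ?f \<alpha> s - z * ?f (\<alpha> + 1) s) has_integral ?F t - ?F 0) {0..t}"
  proof (rule fundamental_theorem_of_calculus_interior[OF t])
    show "continuous_on {0..t} ?F"
      by (intro continuous_intros continuous_on_powr') (use \<alpha> in auto)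
    fix s assume s: "s \<in> {0<..<t}"
    have "((\<lambda>s. s powr \<alpha>) has_vector_derivative \<alpha> * s powr (\<alpha> - 1)) (at s)"
      using s by (auto simp: has_real_derivative_iff_has_vector_derivative[symmetric] intro!: derivative_eq_intros)
    then have 1: "((\<lambda>s. complex_of_real (s powr \<alpha>)) has_vector_derivative complex_of_real (\<alpha> * s powr (\<alpha> - 1))) (at s)"
      by (rule bounded_linear.has_vector_derivative[OF bounded_linear_of_real])
    have "((\<lambda>w. exp (- (z * w))) has_field_derivative - (z * exp (- (z * complex_of_real s)))) (at (complex_of_real s))"
      by (auto intro!: derivative_eq_intros)
    then have 2: "((\<lambda>s. exp (- (z * complex_of_real s))) has_vector_derivative - (z * exp (- (z * complex_of_real s)))) (at s)"
      by (rule has_vector_derivative_real_field)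
    show "(?F has_vector_derivative complex_of_real \<alpha> * ?f \<alpha> s - z * ?f (\<alpha> + 1) s) (at s)"
      using has_vector_derivative_mult[OF 1 2] by (simp add: algebra_simps)
  qed
  moreover have "((\<lambda>s. complex_of_real \<alpha> * ?f \<alpha> s - z * ?f (\<alpha> + 1) s) has_integral
      (complex_of_real \<alpha> * low_gamma \<alpha> t z - z * low_gamma (\<alpha> + 1) t z)) {0..t}"
    unfolding low_gamma_def
    by (intro has_integral_diff has_integral_mult_right integrable_integral low_gamma_integrable) (use \<alpha> t in auto)
  ultimately show ?thesis using \<alpha> by (simp add: has_integral_unique)
qed

text \<open>The differentiated function is the lower incomplete Gamma function at (\<alpha>, z t).
  The recurrence cancels both integrals in the product rule, leaving an elementary derivative whose
  modulus is known exactly on every arc.\<close>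

lemma powr_low_gamma_derivative:
  assumes \<alpha>: "0 < \<alpha>" and t: "0 \<le> t" and z: "z \<notin> \<real>\<^sub>\<le>\<^sub>0"
  shows "((\<lambda>z. z powr complex_of_real \<alpha> * low_gamma \<alpha> t z) has_field_derivative
    z powr (complex_of_real \<alpha> - 1) * (complex_of_real (t powr \<alpha>) * exp (- (z * complex_of_real t)))) (at z)"
proof -
  have z0: "z \<noteq> 0" using z by auto
  have p: "z powr complex_of_real \<alpha> = z powr (complex_of_real \<alpha> - 1) * z"
    using z0 by (simp add: powr_diff)
  show ?thesis
    by (rule derivative_eq_intros has_field_derivative_powr[OF z] low_gamma_derivative[OF \<alpha> t] refl)+
      (simp add: p low_gamma_recurrence[OF \<alpha> t] algebra_simps)
qed

lemma has_integral_exp_Ici: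
  "((\<lambda>x. exp (- x)) has_integral exp (- c)) {c..}" for c :: real
  using has_integral_exp_minus_to_infinity[of 1 c] by simp

text \<open>After the substitution x = \<rho> s the left side is the tail of the Gamma integral
  beyond \<rho> t, where x^(\<alpha> - 1) is decreasing and can be taken out at its largest
  value.\<close>

lemma low_gamma_pos_real:
  assumes \<alpha>: "0 < \<alpha>" "\<alpha> < 1" and t: "0 < t" and \<rho>: "0 < \<rho>"
  shows "norm (complex_of_real (Gamma \<alpha>) - complex_of_real (\<rho> powr \<alpha>) * low_gamma \<alpha> t (complex_of_real \<rho>))
    \<le> (\<rho> * t) powr (\<alpha> - 1) * exp (- (\<rho> * t))"
proof -
  define x0 where "x0 = \<rho> * t"
  have x0: "x0 > 0" using t \<rho> by (simp add: x0_def)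
  define k where "k x = x powr (\<alpha> - 1) / exp x" for x :: real
  have G: "(k has_integral Gamma \<alpha>) {0..}"
    unfolding k_def by (rule Gamma_integral_real[OF \<alpha>(1)])
  have i1: "k integrable_on {0..x0}"
    by (rule integrable_on_subinterval[OF has_integral_integrable[OF G]]) auto
  have i2: "k integrable_on {x0..}"
  proof (rule integrable_dominated[OF interval_with_interior_Ici])
    show "continuous_on {x0<..} k" unfolding k_def using x0 by (intro continuous_intros) auto
    show "(\<lambda>x. x0 powr (\<alpha> - 1) * exp (- x)) integrable_on {x0..}"
      using has_integral_mult_right[OF has_integral_exp_Ici] by blast
    show "norm (k x) \<le> x0 powr (\<alpha> - 1) * exp (- x)" if "x \<in> {x0<..}" for x
      using that x0 \<alpha> by (simp add: k_def exp_minus divide_inverse powr_mono2')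
  qed
  have "integral {0..} k = integral {0..x0} k + integral {x0..} k"
  proof -
    have u: "{0..} = {0..x0} \<union> {x0..}" using x0 by auto
    show ?thesis unfolding u
      by (rule integral_Un[OF i1 i2], rule negligible_subset[OF negligible_sing[of x0]]) auto
  qed
  then have D: "Gamma \<alpha> - integral {0..x0} k = integral {x0..} k" using integral_unique[OF G] by simp
  have "norm (integral {x0..} k) \<le> integral {x0..} (\<lambda>x. x0 powr (\<alpha> - 1) * exp (- x))"
  proof (rule integral_norm_bound_integral[OF i2])
    show "(\<lambda>x. x0 powr (\<alpha> - 1) * exp (- x)) integrable_on {x0..}"
      using has_integral_mult_right[OF has_integral_exp_Ici] by blast
    show "norm (k x) \<le> x0 powr (\<alpha> - 1) * exp (- x)" if "x \<in> {x0..}" for x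
      using that x0 \<alpha> by (simp add: k_def exp_minus divide_inverse powr_mono2')
  qed
  also have "\<dots> = x0 powr (\<alpha> - 1) * exp (- x0)"
    by (rule integral_unique, rule has_integral_mult_right, rule has_integral_exp_Ici)
  finally have N: "norm (Gamma \<alpha> - integral {0..x0} k) \<le> x0 powr (\<alpha> - 1) * exp (- x0)" unfolding D .
  have "((\<lambda>s. k (\<rho> * s)) has_integral (1 / \<bar>\<rho>\<bar>) *\<^sub>R integral {0..x0} k) ((\<lambda>x. x / \<rho>) ` {0..x0})"
    by (rule has_integral_stretch_real[OF integrable_integral[OF i1]]) (use \<rho> in simp)
  moreover have "(\<lambda>x. x / \<rho>) ` {0..x0} = {0..t}"
    using \<rho> t by (simp add: x0_def image_divide_atLeastAtMost)
  ultimately have "((\<lambda>s. k (\<rho> * s)) has_integral integral {0..x0} k / \<rho>) {0..t}" using \<rho> by simp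
  from has_integral_mult_right[OF this, of "\<rho> powr (1 - \<alpha>)"]
  have "((\<lambda>s. \<rho> powr (1 - \<alpha>) * k (\<rho> * s)) has_integral \<rho> powr (1 - \<alpha>) * (integral {0..x0} k / \<rho>)) {0..t}" .
  from has_integral_linear[OF this bounded_linear_of_real]
  have "((\<lambda>s. complex_of_real (\<rho> powr (1 - \<alpha>) * k (\<rho> * s))) has_integral
      complex_of_real (\<rho> powr (1 - \<alpha>) * (integral {0..x0} k / \<rho>))) {0..t}" unfolding o_def .
  moreover have "complex_of_real (\<rho> powr (1 - \<alpha>) * k (\<rho> * s))
      = complex_of_real (s powr (\<alpha> - 1)) * exp (- (complex_of_real \<rho> * complex_of_real s))" if "s \<in> {0..t}" for s
  proof -
    have "\<rho> powr (1 - \<alpha>) * (\<rho> * s) powr (\<alpha> - 1) = s powr (\<alpha> - 1)"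
      using \<rho> that by (simp add: powr_mult powr_add[symmetric] mult.assoc[symmetric])
    then have "\<rho> powr (1 - \<alpha>) * k (\<rho> * s) = s powr (\<alpha> - 1) * exp (- (\<rho> * s))"
      by (simp add: k_def exp_minus divide_inverse mult.assoc[symmetric])
    then show ?thesis by (simp add: exp_of_real[symmetric])
  qed
  ultimately have "low_gamma \<alpha> t (complex_of_real \<rho>) = complex_of_real (\<rho> powr (1 - \<alpha>) * (integral {0..x0} k / \<rho>))"
    unfolding low_gamma_def by (intro integral_unique) (rule has_integral_eq[rotated])
  moreover have "\<rho> powr \<alpha> * (\<rho> powr (1 - \<alpha>) * (integral {0..x0} k / \<rho>)) = integral {0..x0} k"
    using \<rho> by (simp add: mult.assoc[symmetric] powr_add[symmetric])
  ultimately have "complex_of_real (\<rho> powr \<alpha>) * low_gamma \<alpha> t (complex_of_real \<rho>) = complex_of_real (integral {0..x0} k)"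
    by (metis of_real_mult)
  then show ?thesis using N unfolding x0_def[symmetric]
    by (metis norm_of_real of_real_diff real_norm_def)
qed
text \<open>With a and b half the sum and half the difference of the angles, cos x - cos \<phi> = 2
  sin a sin b. The mean value theorem gives sin b \<ge> b cos (\<theta> / 2), and sin a \<ge> sin
  \<theta> sin b follows separately for a below and above pi / 2; this explains the constant. Near x
  = \<phi> = 0 no bound better than quadratic is possible.\<close>

lemma cos_diff_lower_bound:
  assumes "0 < \<theta>" "\<theta> < pi"
  obtains c where "c > 0" "\<And>x \<phi>. 0 \<le> x \<Longrightarrow> x \<le> \<phi> \<Longrightarrow> \<phi> \<le> \<theta> \<Longrightarrow> c * (\<phi> - x)\<^sup>2 \<le> cos x - cos \<phi>"
proof -
  have st: "sin \<theta> > 0" using assms by (intro sin_gt_zero) auto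
  have ct: "cos (\<theta> / 2) > 0" using assms by (intro cos_gt_zero_pi) auto
  define c where "c = sin \<theta> * (cos (\<theta> / 2))\<^sup>2 / 2"
  have "c * (\<phi> - x)\<^sup>2 \<le> cos x - cos \<phi>" if x: "0 \<le> x" "x \<le> \<phi>" "\<phi> \<le> \<theta>" for x \<phi>
  proof -
    define a where "a = (\<phi> + x) / 2"
    define b where "b = (\<phi> - x) / 2"
    have ab: "0 \<le> b" "b \<le> a" "a \<le> \<theta>" "b \<le> \<theta> / 2" using x by (auto simp: a_def b_def)
    have sb0: "0 \<le> sin b" using ab assms by (intro sin_ge_zero) auto
    have sb: "b * cos (\<theta> / 2) \<le> sin b"
    proof (cases "b = 0")
      case False
      then have b: "0 < b" using ab by simp
      obtain y where y: "0 < y" "y < b" "sin b - sin 0 = (b - 0) * cos y"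
        using MVT2[OF b, of sin cos] by (auto intro: derivative_eq_intros)
      have "cos (\<theta> / 2) \<le> cos y" using y ab assms by (intro cos_monotone_0_pi_le) auto
      then show ?thesis using y(3) b by simp
    qed simp
    have sa: "sin \<theta> * sin b \<le> sin a"
    proof (cases "a \<le> pi / 2")
      case True
      have "sin \<theta> * sin b \<le> 1 * sin b" using sb0 by (intro mult_right_mono) auto
      also have "sin b \<le> sin a" using True ab by (intro sin_monotone_2pi_le) auto
      finally show ?thesis by simp
    next
      case False
      have "sin \<theta> * sin b \<le> sin \<theta> * 1" using st by (intro mult_left_mono) auto
      also have "sin \<theta> = sin (pi - \<theta>)" by simp
      also have "\<dots> \<le> sin (pi - a)" using False ab assms by (intro sin_monotone_2pi_le) auto
      finally show ?thesis by simp
    qed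
    have "c * (\<phi> - x)\<^sup>2 = 2 * sin \<theta> * ((b * cos (\<theta> / 2)) * (b * cos (\<theta> / 2)))"
      by (simp add: c_def b_def power2_eq_square)
    also have "\<dots> \<le> 2 * sin \<theta> * (sin b * sin b)"
      using sb ab ct st sb0 by (intro mult_left_mono mult_mono) auto
    also have "\<dots> = 2 * (sin \<theta> * sin b) * sin b" by simp
    also have "\<dots> \<le> 2 * sin a * sin b" using sa sb0 by (intro mult_right_mono) auto
    also have "\<dots> = cos x - cos \<phi>"
      using cos_diff_cos[of x \<phi>] by (simp add: a_def b_def add.commute)
    finally show ?thesis .
  qed
  moreover have "c > 0" using st ct by (simp add: c_def)
  ultimately show ?thesis using that by metis
qed

text \<open>For Re z > 0 the bracket is the Laplace transform of s^(\<alpha> - 1) / Gamma(\<alpha>)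
  over (t, \<infinity>), a multiple of an upper incomplete Gamma function; elsewhere it is the
  analytic continuation.\<close>

definition kernel_remainder :: "real \<Rightarrow> real \<Rightarrow> complex \<Rightarrow> complex" where
  "kernel_remainder \<alpha> t z =
     exp (z * complex_of_real t) * (z powr - complex_of_real \<alpha> - low_gamma \<alpha> t z / complex_of_real (Gamma \<alpha>))"

lemma kernel_remainder_holomorphic:
  assumes "0 < \<alpha>" "0 \<le> t" shows "kernel_remainder \<alpha> t holomorphic_on - \<real>\<^sub>\<le>\<^sub>0"
proof -
  have "low_gamma \<alpha> t holomorphic_on - \<real>\<^sub>\<le>\<^sub>0"
    by (rule holomorphic_onI)
      (use low_gamma_derivative[OF assms] in \<open>auto simp: field_differentiable_def intro: has_field_derivative_at_within\<close>)
  then show ?thesis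
    unfolding kernel_remainder_def[abs_def]
    using Gamma_real_pos[of \<alpha>] assms by (intro holomorphic_intros) auto
qed

text \<open>The integral is J^\<alpha> of s \<mapsto> exp (z s) at time t; reflecting s in t - s
  turns it into exp (z t) times a truncated Laplace transform.\<close>

lemma kernel_remainder_eq:
  assumes \<alpha>: "0 < \<alpha>" and t: "0 \<le> t"
  shows "((\<lambda>s. complex_of_real ((t - s) powr (\<alpha> - 1) / Gamma \<alpha>) * exp (z * complex_of_real s)) has_integral
    (exp (z * complex_of_real t) * z powr - complex_of_real \<alpha> - kernel_remainder \<alpha> t z)) {0..t}"
proof -
  have "((\<lambda>s. (exp (z * complex_of_real t) / complex_of_real (Gamma \<alpha>)) *
        (complex_of_real (s powr (\<alpha> - 1)) * exp (- (z * complex_of_real s))))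
      has_integral (exp (z * complex_of_real t) / complex_of_real (Gamma \<alpha>)) * low_gamma \<alpha> t z) {0..t}"
    unfolding low_gamma_def
    by (intro has_integral_mult_right integrable_integral low_gamma_integrable[OF \<alpha> t])
  then have I: "((\<lambda>s. (exp (z * complex_of_real t) / complex_of_real (Gamma \<alpha>)) *
        (complex_of_real ((t - s) powr (\<alpha> - 1)) * exp (- (z * complex_of_real (t - s)))))
      has_integral (exp (z * complex_of_real t) / complex_of_real (Gamma \<alpha>)) * low_gamma \<alpha> t z) {0..t}"
    by (subst (asm) has_integral_reflect_Icc[symmetric])
  have E: "exp (z * complex_of_real t) * exp (- (z * complex_of_real (t - s))) = exp (z * complex_of_real s)" for s
    by (simp add: exp_add[symmetric] algebra_simps)
  have Q: "(exp (z * complex_of_real t) / complex_of_real (Gamma \<alpha>)) *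
        (complex_of_real ((t - s) powr (\<alpha> - 1)) * exp (- (z * complex_of_real (t - s))))
     = complex_of_real ((t - s) powr (\<alpha> - 1) / Gamma \<alpha>) * exp (z * complex_of_real s)" for s
  proof -
    have H: "(u / g) * (k * v) = k / g * (u * v)" for u g k v :: complex by simp
    show ?thesis by (rule trans[OF H]) (simp only: of_real_divide E)
  qed
  have "exp (z * complex_of_real t) / complex_of_real (Gamma \<alpha>) * low_gamma \<alpha> t z
      = exp (z * complex_of_real t) * z powr - complex_of_real \<alpha> - kernel_remainder \<alpha> t z"
    by (simp add: kernel_remainder_def algebra_simps)
  with I show ?thesis unfolding Q by simp
qed

text \<open>On the positive axis the remainder is an incomplete Gamma integral; it is carried to the
other directions by integrating along arcs, where \<open>cos\<close> gains a quadratic term.\<close>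

lemma kernel_remainder_bound:
  assumes \<alpha>: "0 < \<alpha>" "\<alpha> < 1" and t: "0 < t" and r: "0 < r" and \<theta>: "0 < \<theta>" "\<theta> < pi"
  obtains C where "0 \<le> C" "\<And>\<rho> \<phi>. r \<le> \<rho> \<Longrightarrow> \<bar>\<phi>\<bar> \<le> \<theta> \<Longrightarrow>
    norm (kernel_remainder \<alpha> t (complex_of_real \<rho> * cis \<phi>)) \<le> C * \<rho> powr (- 1 / 4)"
proof -
  obtain c where c: "c > 0" "\<And>x \<phi>. 0 \<le> x \<Longrightarrow> x \<le> \<phi> \<Longrightarrow> \<phi> \<le> \<theta> \<Longrightarrow> c * (\<phi> - x)\<^sup>2 \<le> cos x - cos \<phi>"
    using cos_diff_lower_bound[OF \<theta>] by metis
  have G: "Gamma \<alpha> > 0" by (rule Gamma_real_pos) (use \<alpha> in simp)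
  define Y where "Y z = z powr complex_of_real \<alpha> * low_gamma \<alpha> t z" for z
  define C where "C = (t powr (\<alpha> - 1) * r powr (- 3 / 4) + t powr \<alpha> * ((t * c) powr (- 1 / 4) * (2 * pi powr (1 / 2)))) / Gamma \<alpha>"
  have "norm (kernel_remainder \<alpha> t (complex_of_real \<rho> * cis \<phi>)) \<le> C * \<rho> powr (- 1 / 4)"
    if \<rho>: "r \<le> \<rho>" and \<phi>: "\<bar>\<phi>\<bar> \<le> \<theta>" for \<rho> \<phi>
  proof -
    have \<rho>0: "\<rho> > 0" using \<rho> r by simp
    \<comment> \<open>The sign treats both half-planes at once: each point is reached along an arc
      from the positive axis, through the angles \<sigma> x with x from 0 to |\<phi>|.\<close>
    define \<sigma> :: real where "\<sigma> = (if \<phi> \<ge> 0 then 1 else - 1)"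
    define \<psi> where "\<psi> = \<bar>\<phi>\<bar>"
    have \<psi>: "0 \<le> \<psi>" "\<psi> \<le> \<theta>" "\<phi> = \<sigma> * \<psi>" using \<phi> by (auto simp: \<psi>_def \<sigma>_def)
    have \<sigma>: "\<bar>\<sigma>\<bar> = 1" "cos (\<sigma> * x) = cos x" "cos (x * \<sigma>) = cos x" for x by (auto simp: \<sigma>_def)
    define w where "w x = complex_of_real \<rho> * cis (\<sigma> * x)" for x
    have wS: "w x \<in> closed_sector \<theta>" if "x \<in> {0..\<psi>}" for x
      unfolding w_def using that \<psi> \<rho>0 by (intro closed_sectorI) (auto simp: abs_mult \<sigma>)
    note wnz = mem_closed_sectorD[OF wS \<theta>(2)]
    define q where "q x = complex_of_real \<rho> * (complex_of_real \<sigma> * (\<i> * cis (\<sigma> * x))) * ((w x) powr (complex_of_real \<alpha> - 1) * (complex_of_real (t powr \<alpha>) * exp (- (w x * complex_of_real t))))" for x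
    have dw: "(w has_vector_derivative complex_of_real \<rho> * (complex_of_real \<sigma> * (\<i> * cis (\<sigma> * x)))) (at x within X)" for x X
      unfolding w_def has_vector_derivative_def
      by (auto intro!: derivative_eq_intros simp: scaleR_conv_of_real)
    have I: "(q has_integral Y (w \<psi>) - Y (w 0)) {0..\<psi>}"
    proof (rule fundamental_theorem_of_calculus[OF \<psi>(1)])
      fix x assume x: "x \<in> {0..\<psi>}"
      have "(Y has_field_derivative (w x) powr (complex_of_real \<alpha> - 1) *
          (complex_of_real (t powr \<alpha>) * exp (- (w x * complex_of_real t)))) (at (w x))"
        unfolding Y_def[abs_def] by (rule powr_low_gamma_derivative[OF \<alpha>(1) _ wnz(2)[OF x]]) (use t in simp)
      from field_vector_diff_chain_within[OF dw has_field_derivative_at_within[OF this]]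
      show "((\<lambda>x. Y (w x)) has_vector_derivative q x) (at x within {0..\<psi>})"
        by (simp add: o_def q_def)
    qed
    have nq: "norm (q x) = \<rho> powr \<alpha> * t powr \<alpha> * exp (- (\<rho> * t * cos x))" if "x \<in> {0..\<psi>}" for x
    proof -
      have "norm (w x powr (complex_of_real \<alpha> - 1)) = \<rho> powr (\<alpha> - 1)"
        using norm_powr_real_powr'[of "complex_of_real (\<alpha> - 1)" "w x"] \<rho>0 by (simp add: w_def norm_mult)
      then have "norm (q x) = \<rho> * \<rho> powr (\<alpha> - 1) * t powr \<alpha> * exp (- (\<rho> * t * cos x))"
        using \<rho>0 t by (simp add: q_def norm_mult w_def mult_ac \<sigma>)
      also have "\<rho> * \<rho> powr (\<alpha> - 1) = \<rho> powr \<alpha>" using \<rho>0 by (simp add: powr_mult_base)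
      finally show ?thesis .
    qed
    \<comment> \<open>The bound exp (- y) \<le> y^(-1/4) with y = \<rho> t c (\<psi> - x)^2 trades
      the quadratic gain for \<rho>^(-1/4) and the integrable singularity (\<psi> - x)^(-1/2). Any
      exponent strictly between 0 and 1/2 would serve.\<close>
    define b where "b x = t powr \<alpha> * \<rho> powr \<alpha> * exp (- (\<rho> * t * cos \<psi>)) * ((\<rho> * t * c) powr (- 1 / 4) * (\<psi> - x) powr (- 1 / 2))" for x
    have qb: "norm (q x) \<le> b x" if x: "x \<in> {0<..<\<psi>}" for x
    proof -
      have y: "0 < \<rho> * t * (c * (\<psi> - x)\<^sup>2)" using x c(1) \<rho>0 t by simp
      have "\<rho> * t * (c * (\<psi> - x)\<^sup>2) \<le> \<rho> * t * (cos x - cos \<psi>)"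
        using x \<psi> \<rho>0 t by (intro mult_left_mono c(2)) auto
      then have "exp (- (\<rho> * t * cos x)) \<le> exp (- (\<rho> * t * cos \<psi>)) * exp (- (\<rho> * t * (c * (\<psi> - x)\<^sup>2)))"
        by (simp add: exp_add[symmetric] algebra_simps)
      also have "\<dots> \<le> exp (- (\<rho> * t * cos \<psi>)) * (fact 1 * (\<rho> * t * (c * (\<psi> - x)\<^sup>2)) powr (- (1 / 4)))"
        by (intro mult_left_mono exp_neg_le_powr[OF y]) auto
      also have "(\<rho> * t * (c * (\<psi> - x)\<^sup>2)) powr (- (1 / 4)) = (\<rho> * t * c) powr (- 1 / 4) * ((\<psi> - x)\<^sup>2) powr (- 1 / 4)"
        using \<rho>0 t c(1) by (simp add: powr_mult mult.assoc[symmetric])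
      also have "((\<psi> - x)\<^sup>2) powr (- 1 / 4) = (\<psi> - x) powr (- 1 / 2)"
        using x powr_powr[of "\<psi> - x" 2 "- 1 / 4"] by (simp add: powr_numeral)
      finally have "exp (- (\<rho> * t * cos x)) \<le> exp (- (\<rho> * t * cos \<psi>)) * ((\<rho> * t * c) powr (- 1 / 4) * (\<psi> - x) powr (- 1 / 2))"
        by simp
      from mult_left_mono[OF this, of "\<rho> powr \<alpha> * t powr \<alpha>"] show ?thesis
        unfolding b_def using nq[of x] x by (simp add: mult_ac)
    qed
    have bI: "(b has_integral t powr \<alpha> * \<rho> powr \<alpha> * exp (- (\<rho> * t * cos \<psi>)) * ((\<rho> * t * c) powr (- 1 / 4) * (\<psi> powr (- 1 / 2 + 1) / (- 1 / 2 + 1)))) {0..\<psi>}"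
      unfolding b_def by (intro has_integral_mult_right has_integral_powr_reflect) (use \<psi> in auto)
    have Yd: "norm (Y (w \<psi>) - Y (w 0)) \<le> t powr \<alpha> * \<rho> powr \<alpha> * exp (- (\<rho> * t * cos \<psi>)) * ((\<rho> * t * c) powr (- 1 / 4) * (2 * pi powr (1 / 2)))"
    proof -
      have "norm (Y (w \<psi>) - Y (w 0)) \<le> integral {0..\<psi>} b"
        using integral_norm_bound_interior[OF interval_with_interior_Icc has_integral_integrable[OF I] has_integral_integrable[OF bI] qb]
        by (simp add: integral_unique[OF I])
      also have "\<dots> = t powr \<alpha> * \<rho> powr \<alpha> * exp (- (\<rho> * t * cos \<psi>)) * ((\<rho> * t * c) powr (- 1 / 4) * (2 * \<psi> powr (1 / 2)))"
        unfolding integral_unique[OF bI] by simp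
      also have "\<dots> \<le> t powr \<alpha> * \<rho> powr \<alpha> * exp (- (\<rho> * t * cos \<psi>)) * ((\<rho> * t * c) powr (- 1 / 4) * (2 * pi powr (1 / 2)))"
        using \<psi> \<theta> by (intro mult_left_mono powr_mono2) auto
      finally show ?thesis .
    qed
    have Y0: "norm (complex_of_real (Gamma \<alpha>) - Y (w 0)) \<le> (\<rho> * t) powr (\<alpha> - 1) * exp (- (\<rho> * t))"
      using low_gamma_pos_real[OF \<alpha> t \<rho>0] \<rho>0 by (simp add: Y_def w_def powr_of_real)
    have kr: "kernel_remainder \<alpha> t (w \<psi>) = exp (w \<psi> * complex_of_real t) * w \<psi> powr (- complex_of_real \<alpha>) *
        (complex_of_real (Gamma \<alpha>) - Y (w \<psi>)) / complex_of_real (Gamma \<alpha>)"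
      using wnz(1)[of \<psi>] \<psi>(1) G by (simp add: kernel_remainder_def Y_def powr_minus field_simps)
    have nw: "norm (w \<psi> powr (- complex_of_real \<alpha>)) = \<rho> powr (- \<alpha>)"
      using norm_powr_real_powr'[of "complex_of_real (- \<alpha>)" "w \<psi>"] \<rho>0 by (simp add: w_def norm_mult)
    have ne: "norm (exp (w \<psi> * complex_of_real t)) = exp (\<rho> * t * cos \<psi>)"
      by (simp add: w_def mult_ac \<sigma>)
    let ?E = "exp (\<rho> * t * cos \<psi>) * \<rho> powr (- \<alpha>)"
    have "norm (complex_of_real (Gamma \<alpha>) - Y (w \<psi>)) \<le> norm (complex_of_real (Gamma \<alpha>) - Y (w 0)) + norm (Y (w \<psi>) - Y (w 0))"
      using norm_triangle_ineq4[of "complex_of_real (Gamma \<alpha>) - Y (w 0)" "Y (w \<psi>) - Y (w 0)"] by simp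
    also note add_mono[OF Y0 Yd]
    finally have X: "norm (complex_of_real (Gamma \<alpha>) - Y (w \<psi>)) \<le> (\<rho> * t) powr (\<alpha> - 1) * exp (- (\<rho> * t)) +
        t powr \<alpha> * \<rho> powr \<alpha> * exp (- (\<rho> * t * cos \<psi>)) * ((\<rho> * t * c) powr (- 1 / 4) * (2 * pi powr (1 / 2)))" .
    have NK: "norm (kernel_remainder \<alpha> t (w \<psi>)) = ?E * norm (complex_of_real (Gamma \<alpha>) - Y (w \<psi>)) / Gamma \<alpha>"
      unfolding kr norm_mult norm_divide nw ne using G by simp
    have N: "norm (kernel_remainder \<alpha> t (w \<psi>)) \<le> ?E * ((\<rho> * t) powr (\<alpha> - 1) * exp (- (\<rho> * t)) +
        t powr \<alpha> * \<rho> powr \<alpha> * exp (- (\<rho> * t * cos \<psi>)) * ((\<rho> * t * c) powr (- 1 / 4) * (2 * pi powr (1 / 2)))) / Gamma \<alpha>"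
      unfolding NK using G by (intro divide_right_mono mult_left_mono X) auto
    \<comment> \<open>The contribution from the positive axis decays like 1 / \<rho>; it is weakened
      to \<rho>^(-1/4), the surplus \<rho>^(-3/4) being bounded by its value at r.\<close>
    have p1: "?E * ((\<rho> * t) powr (\<alpha> - 1) * exp (- (\<rho> * t))) \<le> t powr (\<alpha> - 1) * r powr (- 3 / 4) * \<rho> powr (- 1 / 4)"
    proof -
      have "?E * ((\<rho> * t) powr (\<alpha> - 1) * exp (- (\<rho> * t))) = exp (\<rho> * t * cos \<psi> - \<rho> * t) * (t powr (\<alpha> - 1) * (\<rho> powr (- \<alpha>) * \<rho> powr (\<alpha> - 1)))"
        using \<rho>0 t by (simp add: powr_mult exp_diff exp_minus field_simps)
      also have "\<rho> powr (- \<alpha>) * \<rho> powr (\<alpha> - 1) = \<rho> powr (- 3 / 4) * \<rho> powr (- 1 / 4)"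
        using \<rho>0 by (simp add: powr_add[symmetric])
      also have "exp (\<rho> * t * cos \<psi> - \<rho> * t) * (t powr (\<alpha> - 1) * (\<rho> powr (- 3 / 4) * \<rho> powr (- 1 / 4))) \<le> 1 * (t powr (\<alpha> - 1) * (r powr (- 3 / 4) * \<rho> powr (- 1 / 4)))"
      proof (intro mult_mono)
        have "\<rho> * t * cos \<psi> \<le> \<rho> * t * 1" using \<rho>0 t by (intro mult_left_mono) auto
        then show "exp (\<rho> * t * cos \<psi> - \<rho> * t) \<le> 1" by simp
        show "\<rho> powr (- 3 / 4) \<le> r powr (- 3 / 4)" using \<rho> r by (intro powr_mono2') auto
      qed auto
      finally show ?thesis by simp
    qed
    have p2: "?E * (t powr \<alpha> * \<rho> powr \<alpha> * exp (- (\<rho> * t * cos \<psi>)) * ((\<rho> * t * c) powr (- 1 / 4) * (2 * pi powr (1 / 2))))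
        = t powr \<alpha> * ((t * c) powr (- 1 / 4) * (2 * pi powr (1 / 2))) * \<rho> powr (- 1 / 4)"
    proof -
      have "(\<rho> * t * c) powr (- 1 / 4) = \<rho> powr (- 1 / 4) * (t * c) powr (- 1 / 4)"
        using \<rho>0 t c(1) by (simp add: powr_mult mult.assoc)
      moreover have "exp (\<rho> * t * cos \<psi>) * exp (- (\<rho> * t * cos \<psi>)) = 1" by (simp add: exp_add[symmetric])
      moreover have "\<rho> powr (- \<alpha>) * \<rho> powr \<alpha> = 1" using \<rho>0 by (simp add: powr_add[symmetric])
      moreover have "(E * R') * (T * R * E' * (P * Q)) = (E * E') * (R' * R) * (T * P * Q)" for E R' T R E' P Q :: real
        by simp
      ultimately show ?thesis by (simp add: mult_ac)
    qed
    have "norm (kernel_remainder \<alpha> t (w \<psi>)) \<le> (t powr (\<alpha> - 1) * r powr (- 3 / 4) * \<rho> powr (- 1 / 4) +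
        t powr \<alpha> * ((t * c) powr (- 1 / 4) * (2 * pi powr (1 / 2))) * \<rho> powr (- 1 / 4)) / Gamma \<alpha>"
      using N unfolding distrib_left p2 by (rule order_trans) (use p1 G in \<open>simp add: divide_right_mono\<close>)
    also have "\<dots> = C * \<rho> powr (- 1 / 4)" by (simp add: C_def algebra_simps add_divide_distrib)
    finally show ?thesis by (simp add: w_def \<psi>(3))
  qed
  moreover have "0 \<le> C" using G t c(1) by (simp add: C_def)
  ultimately show ?thesis using that by metis
qed

section \<open>Laplace-type contour integrals\<close>

text \<open>The functions for which \<open>gamma_int\<close> converges. Decay is demanded on the two
  boundary rays only, continuity being enough on the arc. Constant and exponent are existential, so
  the predicate is stable under bounded linear maps.\<close>

definition ray_decay :: "real \<Rightarrow> real \<Rightarrow> (complex \<Rightarrow> 'a::real_normed_vector) \<Rightarrow> bool" where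
  "ray_decay \<theta> r f \<longleftrightarrow> continuous_on (closed_sector \<theta>) f \<and>
     (\<exists>C e. 1 < e \<and> (\<forall>\<rho> \<phi>. r \<le> \<rho> \<longrightarrow> \<bar>\<phi>\<bar> = \<theta> \<longrightarrow>
        norm (f (complex_of_real \<rho> * cis \<phi>)) \<le> C * \<rho> powr (- e)))"

lemma ray_decayI:
  assumes "continuous_on (closed_sector \<theta>) f" "1 < e"
    and "\<And>\<rho> \<phi>. r \<le> \<rho> \<Longrightarrow> \<bar>\<phi>\<bar> = \<theta> \<Longrightarrow> norm (f (complex_of_real \<rho> * cis \<phi>)) \<le> C * \<rho> powr (- e)"
  shows "ray_decay \<theta> r f"
  unfolding ray_decay_def using assms by (intro conjI exI[of _ C] exI[of _ e]) auto

lemma bounded_linear_ray_decay: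
  assumes L: "bounded_linear L" and f: "ray_decay \<theta> r f" shows "ray_decay \<theta> r (\<lambda>z. L (f z))"
proof -
  interpret L: bounded_linear L by fact
  obtain K where K: "K > 0" "\<And>x. norm (L x) \<le> norm x * K" using L.pos_bounded by blast
  obtain C e where f': "continuous_on (closed_sector \<theta>) f" "1 < e"
    "\<And>\<rho> \<phi>. r \<le> \<rho> \<Longrightarrow> \<bar>\<phi>\<bar> = \<theta> \<Longrightarrow> norm (f (complex_of_real \<rho> * cis \<phi>)) \<le> C * \<rho> powr (- e)"
    using f unfolding ray_decay_def by blast
  show ?thesis
  proof (rule ray_decayI[where e = e and C = "C * K"])
    show "norm (L (f (complex_of_real \<rho> * cis \<phi>))) \<le> C * K * \<rho> powr (- e)" if "r \<le> \<rho>" "\<bar>\<phi>\<bar> = \<theta>" for \<rho> \<phi>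
    proof -
      have "norm (L (f (complex_of_real \<rho> * cis \<phi>))) \<le> norm (f (complex_of_real \<rho> * cis \<phi>)) * K" by (rule K(2))
      also have "\<dots> \<le> C * \<rho> powr (- e) * K" using f'(3)[OF that] K(1) by (intro mult_right_mono) auto
      finally show ?thesis by (simp add: mult_ac)
    qed
  qed (use f' L.continuous_on in auto)
qed

text \<open>On the rays the exponential beats any power. The order m is left open so that it can be
  tuned to the growth of the other factor and to integrability in t.\<close>

lemma exp_ray_le:
  assumes \<theta>: "cos \<theta> < 0" and \<phi>: "\<bar>\<phi>\<bar> = \<theta>" and \<rho>: "0 < \<rho>" and t: "0 < t" and m: "0 \<le> m" "m \<le> real n"
  shows "norm (exp (complex_of_real \<rho> * cis \<phi> * complex_of_real t)) \<le> fact n * (- cos \<theta> * t) powr (- m) * \<rho> powr (- m)"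
proof -
  have pos: "0 < - cos \<theta>" "0 < - cos \<theta> * t * \<rho>"
    using mult_pos_pos[OF mult_pos_pos[of "- cos \<theta>" t] \<rho>] \<theta> t by auto
  have "cos \<phi> = cos \<theta>" using \<phi> by (metis cos_abs_real)
  then have "norm (exp (complex_of_real \<rho> * cis \<phi> * complex_of_real t)) = exp (- (- cos \<theta> * t * \<rho>))" by (simp add: mult_ac)
  also have "\<dots> \<le> fact n * (- cos \<theta> * t * \<rho>) powr (- m)"
    by (rule exp_neg_le_powr[OF pos(2) m])
  also have "(- cos \<theta> * t * \<rho>) powr (- m) = (- cos \<theta> * t) powr (- m) * \<rho> powr (- m)"
    by (rule powr_mult)
  finally show ?thesis by (simp add: mult.assoc)
qed

context complex_banach
begin

lemma ray_decay_integrable: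
  assumes "ray_decay \<theta> r f" "0 < r" "\<bar>\<phi>\<bar> = \<theta>"
  shows "(\<lambda>\<rho>. smc (cis \<phi>) (f (complex_of_real \<rho> * cis \<phi>))) integrable_on {r..}"
proof -
  obtain C e where f': "continuous_on (closed_sector \<theta>) f" "1 < e"
    "\<And>\<rho> \<phi>. r \<le> \<rho> \<Longrightarrow> \<bar>\<phi>\<bar> = \<theta> \<Longrightarrow> norm (f (complex_of_real \<rho> * cis \<phi>)) \<le> C * \<rho> powr (- e)"
    using assms(1) unfolding ray_decay_def by blast
  show ?thesis
    by (rule integrable_on_ray(1)[OF f'(1) _ assms(2) f'(2) f'(3)]) (use assms(3) in auto)
qed

lemma arc_integrable:
  assumes "ray_decay \<theta> r f" "0 < r"
  shows "(\<lambda>\<phi>. smc (\<i> * complex_of_real r * cis \<phi>) (f (complex_of_real r * cis \<phi>))) integrable_on {- \<theta>..\<theta>}"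
  using continuous_on_arc[of \<theta> f r] assms by (intro integrable_continuous_interval) (auto simp: ray_decay_def)

lemma gamma_int_linear:
  assumes L: "bounded_linear L" and Lc: "\<And>c x. L (smc c x) = smc c (L x)"
    and f: "ray_decay \<theta> r f" and r: "0 < r" and \<theta>: "0 \<le> \<theta>"
  shows "gamma_int \<theta> r (\<lambda>z. L (f z)) = L (gamma_int \<theta> r f)"
proof -
  interpret L: bounded_linear L by fact
  show ?thesis
    unfolding gamma_int_def Lc[symmetric] L.add L.neg
    using integral_linear[OF ray_decay_integrable[OF f r, of \<theta>] L] integral_linear[OF ray_decay_integrable[OF f r, of "- \<theta>"] L]
      integral_linear[OF arc_integrable[OF f r] L] \<theta> by (simp add: o_def)
qed

lemma gamma_int_diff:
  assumes f: "ray_decay \<theta> r f" and g: "ray_decay \<theta> r g" and r: "0 < r" and \<theta>: "0 \<le> \<theta>"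
  shows "gamma_int \<theta> r (\<lambda>z. f z - g z) = gamma_int \<theta> r f - gamma_int \<theta> r g"
proof -
  have a: "\<bar>\<theta>\<bar> = \<theta>" "\<bar>- \<theta>\<bar> = \<theta>" using \<theta> by auto
  show ?thesis
    unfolding gamma_int_def smc_diff_right
      integral_diff[OF ray_decay_integrable[OF f r a(1)] ray_decay_integrable[OF g r a(1)]]
      integral_diff[OF ray_decay_integrable[OF f r a(2)] ray_decay_integrable[OF g r a(2)]]
      integral_diff[OF arc_integrable[OF f r] arc_integrable[OF g r]]
    by simp
qed

lemma gamma_int_scalar:
  assumes f: "ray_decay \<theta> r f" and r: "0 < r" and \<theta>: "0 \<le> \<theta>"
  shows "gamma_int \<theta> r (\<lambda>z. smc (f z) x) = smc (complex_banach.gamma_int (*) \<theta> r f) x"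
proof -
  interpret C: complex_banach "(*) :: complex \<Rightarrow> complex \<Rightarrow> complex" by (rule complex_banach_times)
  have a: "\<bar>\<theta>\<bar> = \<theta>" "\<bar>- \<theta>\<bar> = \<theta>" using \<theta> by auto
  have L: "bounded_linear (\<lambda>c. smc c x)" by (rule smc.bounded_linear_left)
  show ?thesis
    unfolding gamma_int_def C.gamma_int_def smc_add_left smc_minus_left smc_mult[symmetric]
      integral_linear[OF C.ray_decay_integrable[OF f r a(1)] L, unfolded o_def, symmetric]
      integral_linear[OF C.ray_decay_integrable[OF f r a(2)] L, unfolded o_def, symmetric]
      integral_linear[OF C.arc_integrable[OF f r] L, unfolded o_def, symmetric] ..
qed

lemma gamma_int_cong:
  assumes "\<And>z. z \<in> closed_sector \<theta> \<Longrightarrow> f z = g z" "0 < r" "0 \<le> \<theta>"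
  shows "gamma_int \<theta> r f = gamma_int \<theta> r g"
proof -
  have "f (complex_of_real \<rho> * cis \<phi>) = g (complex_of_real \<rho> * cis \<phi>)" if "r \<le> \<rho>" "\<bar>\<phi>\<bar> \<le> \<theta>" for \<rho> \<phi>
    by (rule assms(1), rule closed_sectorI) (use assms that in auto)
  then show ?thesis
    unfolding gamma_int_def using assms
    by (intro arg_cong2[of _ _ _ _ "(+)"] arg_cong[of _ _ uminus] Henstock_Kurzweil_Integration.integral_cong) auto
qed

lemma norm_exp_weight_le:
  assumes \<theta>: "cos \<theta> < 0" and B: "\<And>z. z \<in> closed_sector \<theta> \<Longrightarrow> norm (B z) \<le> C * norm z powr m"
    and t: "0 < t" and \<rho>: "0 < \<rho>" and \<phi>: "\<bar>\<phi>\<bar> = \<theta>" and p: "0 \<le> p" "p \<le> real n"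
  shows "norm (smc (exp (complex_of_real \<rho> * cis \<phi> * complex_of_real t)) (B (complex_of_real \<rho> * cis \<phi>)))
    \<le> fact n * C * (- cos \<theta> * t) powr (- p) * \<rho> powr (m - p)"
proof -
  have S: "complex_of_real \<rho> * cis \<phi> \<in> closed_sector \<theta>" using \<rho> \<phi> by (intro closed_sectorI) auto
  have "norm (smc (exp (complex_of_real \<rho> * cis \<phi> * complex_of_real t)) (B (complex_of_real \<rho> * cis \<phi>)))
      \<le> (fact n * (- cos \<theta> * t) powr (- p) * \<rho> powr (- p)) * (C * \<rho> powr m)"
    unfolding norm_smc using B[OF S] \<rho>
    by (intro mult_mono exp_ray_le[OF \<theta> \<phi> \<rho> t p]) (auto simp: norm_mult)
  then show ?thesis using \<rho> by (simp add: powr_diff powr_minus field_simps)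
qed

lemma exp_weight_ray_decay:
  assumes \<theta>: "cos \<theta> < 0" and Bc: "continuous_on (closed_sector \<theta>) B"
    and B: "\<And>z. z \<in> closed_sector \<theta> \<Longrightarrow> norm (B z) \<le> C * norm z powr m"
    and t: "0 < t" and r: "0 < r"
  shows "ray_decay \<theta> r (\<lambda>z. smc (exp (z * complex_of_real t)) (B z))"
proof -
  \<comment> \<open>The power taken from the exponential below, m + 2 + (|m| - m), equals |m| + 2
    and is therefore nonnegative. What exceeds the required \<rho>^(-2) is \<rho>^(-(|m| - m)),
    which is largest at \<rho> = r.\<close>
  obtain n :: nat where n: "\<bar>m\<bar> + 2 \<le> real n" using real_arch_simple by blast
  show ?thesis
  proof (rule ray_decayI[where e = 2 and C = "fact n * C * (- cos \<theta> * t) powr (- (m + 2 + (\<bar>m\<bar> - m)))* r powr (- (\<bar>m\<bar> - m))"])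
    show "continuous_on (closed_sector \<theta>) (\<lambda>z. smc (exp (z * complex_of_real t)) (B z))"
      by (intro smc.continuous_on continuous_intros Bc)
    fix \<rho> \<phi> :: real assume h: "r \<le> \<rho>" "\<bar>\<phi>\<bar> = \<theta>"
    have \<rho>: "0 < \<rho>" using h r by simp
    have C0: "0 \<le> C"
    proof -
      have "complex_of_real 1 * cis \<phi> \<in> closed_sector \<theta>" using h by (intro closed_sectorI) auto
      from B[OF this] have "norm (B (complex_of_real 1 * cis \<phi>)) \<le> C" by (simp add: norm_mult)
      then show ?thesis using norm_ge_zero[of "B (complex_of_real 1 * cis \<phi>)"] by linarith
    qed
    have "norm (smc (exp (complex_of_real \<rho> * cis \<phi> * complex_of_real t)) (B (complex_of_real \<rho> * cis \<phi>)))
      \<le> fact n * C * (- cos \<theta> * t) powr (- (m + 2 + (\<bar>m\<bar> - m))) * \<rho> powr (m - (m + 2 + (\<bar>m\<bar> - m)))"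
      by (rule norm_exp_weight_le[OF \<theta> B t \<rho> h(2)]) (use n in auto)
    also have "\<rho> powr (m - (m + 2 + (\<bar>m\<bar> - m))) = \<rho> powr (- (\<bar>m\<bar> - m)) * \<rho> powr (- 2)"
      by (simp add: powr_add[symmetric] algebra_simps)
    also have "fact n * C * (- cos \<theta> * t) powr (- (m + 2 + (\<bar>m\<bar> - m))) * (\<rho> powr (- (\<bar>m\<bar> - m)) * \<rho> powr (- 2))
      \<le> fact n * C * (- cos \<theta> * t) powr (- (m + 2 + (\<bar>m\<bar> - m))) * (r powr (- (\<bar>m\<bar> - m)) * \<rho> powr (- 2))"
      using C0 h r by (intro mult_left_mono mult_right_mono powr_mono2') auto
    finally show "norm (smc (exp (complex_of_real \<rho> * cis \<phi> * complex_of_real t)) (B (complex_of_real \<rho> * cis \<phi>)))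
      \<le> fact n * C * (- cos \<theta> * t) powr (- (m + 2 + (\<bar>m\<bar> - m))) * r powr (- (\<bar>m\<bar> - m)) * \<rho> powr (- 2)"
      by (simp add: mult_ac)
  qed simp
qed

text \<open>One piece \<gamma> of the contour, with its velocity absorbed into \<open>B\<close>. The
  second-order remainder of the exponential over times within \<delta> of t costs the extra factor
  exp (|Re \<gamma>| \<delta>) in the majorant.\<close>

lemma laplace_integral_derivative:
  fixes B :: "real \<Rightarrow> 'y"
  assumes SU: "interval_with_interior S U" and \<delta>: "0 < \<delta>"
    and i0: "\<And>s. \<bar>s - t\<bar> < \<delta> \<Longrightarrow> (\<lambda>x. smc (exp (\<gamma> x * complex_of_real s)) (B x)) integrable_on S"
    and i1: "(\<lambda>x. smc (exp (\<gamma> x * complex_of_real t)) (smc (\<gamma> x) (B x))) integrable_on S"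
    and g: "g integrable_on S"
    and gb: "\<And>x. x \<in> U \<Longrightarrow> exp (Re (\<gamma> x) * t) * exp (\<bar>Re (\<gamma> x)\<bar> * \<delta>) * (norm (\<gamma> x))\<^sup>2 * norm (B x) \<le> g x"
  shows "((\<lambda>s. integral S (\<lambda>x. smc (exp (\<gamma> x * complex_of_real s)) (B x))) has_vector_derivative
    integral S (\<lambda>x. smc (exp (\<gamma> x * complex_of_real t)) (smc (\<gamma> x) (B x)))) (at t)"
  unfolding has_vector_derivative_def
proof (rule has_derivative_integral_dominated[OF SU \<delta>,
      where f' = "\<lambda>h x. h *\<^sub>R smc (exp (\<gamma> x * complex_of_real t)) (smc (\<gamma> x) (B x))", OF _ _ _ g])
  show "(\<lambda>x. smc (exp (\<gamma> x * complex_of_real (t + h))) (B x)) integrable_on S" if "norm h < \<delta>" for h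
    by (rule i0) (use that in simp)
  show "bounded_linear (\<lambda>h. h *\<^sub>R integral S (\<lambda>x. smc (exp (\<gamma> x * complex_of_real t)) (smc (\<gamma> x) (B x))))"
    by (rule bounded_linear_scaleR_left)
  show "((\<lambda>x. h *\<^sub>R smc (exp (\<gamma> x * complex_of_real t)) (smc (\<gamma> x) (B x))) has_integral
      h *\<^sub>R integral S (\<lambda>x. smc (exp (\<gamma> x * complex_of_real t)) (smc (\<gamma> x) (B x)))) S" for h
    by (intro has_integral_cmul integrable_integral i1)
  fix h x assume h: "norm (h :: real) < \<delta>" and x: "x \<in> U"
  let ?z = "\<gamma> x * complex_of_real t" and ?w = "\<gamma> x * complex_of_real h"
  have "smc (exp (\<gamma> x * complex_of_real (t + h))) (B x) - smc (exp ?z) (B x) - h *\<^sub>R smc (exp ?z) (smc (\<gamma> x) (B x))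
      = smc (exp (?z + ?w) - exp ?z - ?w * exp ?z) (B x)"
    by (simp add: smc_diff_left smc_add_left smc_mult[symmetric] smc_of_real[symmetric] algebra_simps)
  also have "norm \<dots> = norm (exp (?z + ?w) - exp ?z - ?w * exp ?z) * norm (B x)" by (rule norm_smc)
  finally have e: "norm (smc (exp (\<gamma> x * complex_of_real (t + h))) (B x) - smc (exp ?z) (B x) - h *\<^sub>R smc (exp ?z) (smc (\<gamma> x) (B x)))
      = norm (exp (?z + ?w) - exp ?z - ?w * exp ?z) * norm (B x)" .
  have "norm (exp (?z + ?w) - exp ?z - ?w * exp ?z) \<le> exp (Re ?z) * exp \<bar>Re ?w\<bar> * (norm ?w)\<^sup>2"
    by (rule norm_exp_second_order)
  also have "\<dots> \<le> exp (Re (\<gamma> x) * t) * exp (\<bar>Re (\<gamma> x)\<bar> * \<delta>) * ((norm h)\<^sup>2 * (norm (\<gamma> x))\<^sup>2)"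
    using h by (intro mult_mono) (auto simp: norm_mult abs_mult power_mult_distrib mult_left_mono)
  finally have "norm (exp (?z + ?w) - exp ?z - ?w * exp ?z) * norm (B x)
      \<le> exp (Re (\<gamma> x) * t) * exp (\<bar>Re (\<gamma> x)\<bar> * \<delta>) * ((norm h)\<^sup>2 * (norm (\<gamma> x))\<^sup>2) * norm (B x)"
    by (rule mult_right_mono) simp
  also have "\<dots> = (norm h)\<^sup>2 * (exp (Re (\<gamma> x) * t) * exp (\<bar>Re (\<gamma> x)\<bar> * \<delta>) * (norm (\<gamma> x))\<^sup>2 * norm (B x))"
    by (simp add: mult_ac)
  also have "\<dots> \<le> (norm h)\<^sup>2 * g x" by (intro mult_left_mono gb x) simp
  finally show "norm (smc (exp (\<gamma> x * complex_of_real (t + h))) (B x) - smc (exp ?z) (B x) - h *\<^sub>R smc (exp ?z) (smc (\<gamma> x) (B x)))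
      \<le> (norm h)\<^sup>2 * g x" unfolding e .
qed

lemma gamma_int_exp_derivative:
  assumes \<theta>: "0 \<le> \<theta>" "cos \<theta> < 0" and Bc: "continuous_on (closed_sector \<theta>) B"
    and B: "\<And>z. z \<in> closed_sector \<theta> \<Longrightarrow> norm (B z) \<le> C * norm z powr m"
    and t: "0 < t" and r: "0 < r"
  shows "((\<lambda>s. gamma_int \<theta> r (\<lambda>z. smc (exp (z * complex_of_real s)) (B z))) has_vector_derivative
    gamma_int \<theta> r (\<lambda>z. smc (exp (z * complex_of_real t)) (smc z (B z)))) (at t)"
proof -
  have zBc: "continuous_on (closed_sector \<theta>) (\<lambda>z. smc z (B z))"
    by (intro smc.continuous_on continuous_intros Bc)
  have zB: "norm (smc z (B z)) \<le> C * norm z powr (m + 1)" if "z \<in> closed_sector \<theta>" for z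
    using mult_left_mono[OF B[OF that], of "norm z"] powr_mult_base[of "norm z" m] by (simp add: norm_smc mult_ac add.commute)
  have zz: "norm (smc z (smc z (B z))) \<le> C * norm z powr (m + 1 + 1)" if "z \<in> closed_sector \<theta>" for z
    using mult_left_mono[OF zB[OF that], of "norm z"] powr_mult_base[of "norm z" "m + 1"] by (simp add: norm_smc mult_ac add.commute)
  note d0 = exp_weight_ray_decay[OF \<theta>(2) Bc B _ r]
  note d1 = exp_weight_ray_decay[OF \<theta>(2) zBc zB t r]
  have ray: "((\<lambda>s. integral {r..} (\<lambda>\<rho>. smc (cis \<phi>) (smc (exp (complex_of_real \<rho> * cis \<phi> * complex_of_real s)) (B (complex_of_real \<rho> * cis \<phi>)))))
      has_vector_derivative integral {r..} (\<lambda>\<rho>. smc (cis \<phi>) (smc (exp (complex_of_real \<rho> * cis \<phi> * complex_of_real t))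
         (smc (complex_of_real \<rho> * cis \<phi>) (B (complex_of_real \<rho> * cis \<phi>)))))) (at t)"
    if \<phi>: "\<bar>\<phi>\<bar> = \<theta>" for \<phi>
  proof -
    let ?B = "\<lambda>\<rho>. smc (cis \<phi>) (B (complex_of_real \<rho> * cis \<phi>))"
    have zzc: "continuous_on (closed_sector \<theta>) (\<lambda>z. smc z (smc z (B z)))"
      by (intro smc.continuous_on continuous_intros Bc)
    \<comment> \<open>With \<delta> = t / 2 the extra factor consumes half of the decay on the rays.
      What remains is the exponential at time t / 2, so decay at that time, with the two powers of z
      from the remainder, supplies the majorant.\<close>
    have "ray_decay \<theta> r (\<lambda>z. smc (exp (z * complex_of_real (t / 2))) (smc z (smc z (B z))))"
      by (rule exp_weight_ray_decay[OF \<theta>(2) zzc zz _ r]) (use t in auto)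
    then obtain C' e where Ce: "1 < e" "\<And>\<rho>. r \<le> \<rho> \<Longrightarrow> norm (smc (exp (complex_of_real \<rho> * cis \<phi> * complex_of_real (t / 2)))
        (smc (complex_of_real \<rho> * cis \<phi>) (smc (complex_of_real \<rho> * cis \<phi>) (B (complex_of_real \<rho> * cis \<phi>))))) \<le> C' * \<rho> powr (- e)"
      using \<phi> unfolding ray_decay_def by blast
    have "((\<lambda>s. integral {r..} (\<lambda>\<rho>. smc (exp (complex_of_real \<rho> * cis \<phi> * complex_of_real s)) (?B \<rho>)))
      has_vector_derivative integral {r..} (\<lambda>\<rho>. smc (exp (complex_of_real \<rho> * cis \<phi> * complex_of_real t))
         (smc (complex_of_real \<rho> * cis \<phi>) (?B \<rho>)))) (at t)"
    proof (rule laplace_integral_derivative[OF interval_with_interior_Ici, where \<delta> = "t / 2"])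
      show "(\<lambda>\<rho>. smc (exp (complex_of_real \<rho> * cis \<phi> * complex_of_real s)) (?B \<rho>)) integrable_on {r..}" if "\<bar>s - t\<bar> < t / 2" for s
      proof -
        have "0 < s" using that t by linarith
        then show ?thesis using ray_decay_integrable[OF d0[of s] r \<phi>] by (simp add: smc_mult[symmetric] mult_ac)
      qed
      show "(\<lambda>\<rho>. smc (exp (complex_of_real \<rho> * cis \<phi> * complex_of_real t)) (smc (complex_of_real \<rho> * cis \<phi>) (?B \<rho>))) integrable_on {r..}"
        using ray_decay_integrable[OF d1 r \<phi>] by (simp add: smc_mult[symmetric] mult_ac)
      show "(\<lambda>\<rho>. C' * \<rho> powr (- e)) integrable_on {r..}" by (rule integrable_on_powr_Ici[OF Ce(1) r])
      fix \<rho> assume \<rho>: "\<rho> \<in> {r<..}"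
      have c: "cos \<phi> = cos \<theta>" using \<phi> by (metis cos_abs_real)
      have "exp (Re (complex_of_real \<rho> * cis \<phi>) * t) * exp (\<bar>Re (complex_of_real \<rho> * cis \<phi>)\<bar> * (t / 2)) = exp (Re (complex_of_real \<rho> * cis \<phi>) * (t / 2))"
        using \<theta>(2) \<rho> r by (simp add: exp_add[symmetric] c abs_mult)
      then show "exp (Re (complex_of_real \<rho> * cis \<phi>) * t) * exp (\<bar>Re (complex_of_real \<rho> * cis \<phi>)\<bar> * (t / 2)) *
           (norm (complex_of_real \<rho> * cis \<phi>))\<^sup>2 * norm (?B \<rho>) \<le> C' * \<rho> powr (- e)"
        using Ce(2)[of \<rho>] \<rho> by (simp add: norm_smc norm_mult power2_eq_square mult.assoc)
    qed (use t in auto)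
    then show ?thesis by (simp add: smc_mult[symmetric] mult_ac)
  qed
  have arc: "((\<lambda>s. integral {- \<theta>..\<theta>} (\<lambda>\<phi>. smc (\<i> * complex_of_real r * cis \<phi>) (smc (exp (complex_of_real r * cis \<phi> * complex_of_real s)) (B (complex_of_real r * cis \<phi>)))))
      has_vector_derivative integral {- \<theta>..\<theta>} (\<lambda>\<phi>. smc (\<i> * complex_of_real r * cis \<phi>) (smc (exp (complex_of_real r * cis \<phi> * complex_of_real t))
         (smc (complex_of_real r * cis \<phi>) (B (complex_of_real r * cis \<phi>)))))) (at t)"
  proof -
    let ?B = "\<lambda>\<phi>. smc (\<i> * complex_of_real r * cis \<phi>) (B (complex_of_real r * cis \<phi>))"
    have "((\<lambda>s. integral {- \<theta>..\<theta>} (\<lambda>\<phi>. smc (exp (complex_of_real r * cis \<phi> * complex_of_real s)) (?B \<phi>)))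
      has_vector_derivative integral {- \<theta>..\<theta>} (\<lambda>\<phi>. smc (exp (complex_of_real r * cis \<phi> * complex_of_real t))
         (smc (complex_of_real r * cis \<phi>) (?B \<phi>)))) (at t)"
    proof (rule laplace_integral_derivative[OF interval_with_interior_Icc, where \<delta> = "t / 2" and
          g = "\<lambda>_. exp (r * t) * exp (r * (t / 2)) * r\<^sup>2 * (r * (C * r powr m))"])
      show "(\<lambda>\<phi>. smc (exp (complex_of_real r * cis \<phi> * complex_of_real s)) (?B \<phi>)) integrable_on {- \<theta>..\<theta>}" if "\<bar>s - t\<bar> < t / 2" for s
      proof -
        have "0 < s" using that t by linarith
        then show ?thesis using arc_integrable[OF d0[of s] r] by (simp add: smc_mult[symmetric] mult_ac)
      qed
      show "(\<lambda>\<phi>. smc (exp (complex_of_real r * cis \<phi> * complex_of_real t)) (smc (complex_of_real r * cis \<phi>) (?B \<phi>))) integrable_on {- \<theta>..\<theta>}"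
        using arc_integrable[OF d1 r] by (simp add: smc_mult[symmetric] mult_ac)
      fix \<phi> assume \<phi>: "\<phi> \<in> {- \<theta><..<\<theta>}"
      have S: "complex_of_real r * cis \<phi> \<in> closed_sector \<theta>" using \<phi> r by (intro closed_sectorI) auto
      have "norm (B (complex_of_real r * cis \<phi>)) \<le> C * r powr m" using B[OF S] r by (simp add: norm_mult)
      moreover have "Re (complex_of_real r * cis \<phi>) \<le> r" "\<bar>Re (complex_of_real r * cis \<phi>)\<bar> \<le> r"
        using r mult_left_mono[OF cos_le_one[of \<phi>], of r] mult_left_mono[OF abs_cos_le_one[of \<phi>], of r] by (auto simp: abs_mult)
      ultimately show "exp (Re (complex_of_real r * cis \<phi>) * t) * exp (\<bar>Re (complex_of_real r * cis \<phi>)\<bar> * (t / 2)) *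
           (norm (complex_of_real r * cis \<phi>))\<^sup>2 * norm (?B \<phi>) \<le> exp (r * t) * exp (r * (t / 2)) * r\<^sup>2 * (r * (C * r powr m))"
        using t r by (intro mult_mono) (auto simp: norm_mult norm_smc mult_right_mono)
    qed (use t in auto)
    then show ?thesis by (simp add: smc_mult[symmetric] mult_ac)
  qed
  show ?thesis
    unfolding gamma_int_def
    by (intro has_vector_derivative_add has_vector_derivative_minus ray arc) (use \<theta> in auto)
qed

text \<open>\<open>E\<close> stands for the time integral of exp (z s) against \<open>k\<close>, so
  the interchange is done once for each shape of contour piece, whatever the kernel. The majorant
  separates the singularities in s from the decay in x.\<close>

lemma laplace_fubini:
  fixes B :: "real \<Rightarrow> 'y"
  assumes SU: "interval_with_interior S U" and \<gamma>: "continuous_on U \<gamma>" and Bc: "continuous_on U B"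
    and E: "\<And>z. ((\<lambda>s. complex_of_real (k s) * exp (z * complex_of_real s)) has_integral E z) {0..t}"
    and k: "continuous_on {0<..<t} k"
    and g1: "continuous_on {0<..<t} g1" "\<And>s. s \<in> {0<..<t} \<Longrightarrow> 0 \<le> g1 s" "g1 integrable_on {0..t}"
    and g2: "continuous_on U g2" "\<And>x. x \<in> U \<Longrightarrow> 0 \<le> g2 x" "g2 integrable_on S"
    and bd: "\<And>s x. s \<in> {0<..<t} \<Longrightarrow> x \<in> U \<Longrightarrow> \<bar>k s\<bar> * (exp (Re (\<gamma> x) * s) * norm (B x)) \<le> g1 s * g2 x"
  shows "((\<lambda>s. k s *\<^sub>R integral S (\<lambda>x. smc (exp (\<gamma> x * complex_of_real s)) (B x))) has_integral
    integral S (\<lambda>x. smc (E (\<gamma> x)) (B x))) {0..t}"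
proof -
  define f where "f s x = k s *\<^sub>R smc (exp (\<gamma> x * complex_of_real s)) (B x)" for s x
  have fc: "continuous_on ({0<..<t} \<times> U) (\<lambda>p. f (fst p) (snd p))"
    unfolding f_def
    by (intro continuous_intros smc.continuous_on continuous_on_compose2[OF k] continuous_on_compose2[OF \<gamma>] continuous_on_compose2[OF Bc]) auto
  have fb: "norm (f s x) \<le> g1 s * g2 x" if "s \<in> {0<..<t}" "x \<in> U" for s x
    using bd[OF that] by (simp add: f_def norm_smc)
  note F = fubini_interval[OF interval_with_interior_Icc SU fc fb g1 g2]
  have 1: "integral S (f s) = k s *\<^sub>R integral S (\<lambda>x. smc (exp (\<gamma> x * complex_of_real s)) (B x))" for s
    unfolding f_def by simp
  have 2: "integral {0..t} (\<lambda>s. f s x) = smc (E (\<gamma> x)) (B x)" for x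
  proof (rule integral_unique)
    show "((\<lambda>s. f s x) has_integral smc (E (\<gamma> x)) (B x)) {0..t}"
      using has_integral_linear[OF E[of "\<gamma> x"] smc.bounded_linear_left[of "B x"]]
      by (simp add: o_def f_def smc_mult smc_of_real)
  qed
  show ?thesis
    using integrable_integral[OF F(1)] F(3) unfolding 1 2 by simp
qed

text \<open>\<open>B\<close> of order 1 / |z| alone just fails to be integrable on the rays. Taking
  the power 1/2 from the exponential gives \<rho>^(-3/2) at the price of s^(-1/2), which is still
  integrable at s = 0.\<close>

lemma gamma_int_fubini:
  assumes \<theta>: "0 \<le> \<theta>" "cos \<theta> < 0" and Bc: "continuous_on (closed_sector \<theta>) B"
    and B: "\<And>z. z \<in> closed_sector \<theta> \<Longrightarrow> norm (B z) \<le> C * norm z powr - 1"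
    and t: "0 < t" and r: "0 < r" and a: "0 < a" "a < 1"
    and E: "\<And>z. ((\<lambda>s. complex_of_real ((t - s) powr (a - 1) / G) * exp (z * complex_of_real s)) has_integral E z) {0..t}"
    and G: "0 < G"
  shows "((\<lambda>s. ((t - s) powr (a - 1) / G) *\<^sub>R gamma_int \<theta> r (\<lambda>z. smc (exp (z * complex_of_real s)) (B z))) has_integral
    gamma_int \<theta> r (\<lambda>z. smc (E z) (B z))) {0..t}"
proof -
  let ?k = "\<lambda>s. (t - s) powr (a - 1) / G"
  have kc: "continuous_on {0<..<t} ?k" by (intro continuous_intros) (use G in auto)
  have ki: "?k integrable_on {0..t}"
    using has_integral_powr_reflect[of "a - 1" t] a t by (intro integrable_on_divide) auto
  have C0: "0 \<le> C"
  proof -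
    have "complex_of_real 1 * cis 0 \<in> closed_sector \<theta>" by (intro closed_sectorI) (use \<theta> in auto)
    from B[OF this] have "norm (B (complex_of_real 1 * cis 0)) \<le> C" by (simp add: norm_mult)
    then show ?thesis using norm_ge_zero[of "B (complex_of_real 1 * cis 0)"] by linarith
  qed
  have ray: "((\<lambda>s. ?k s *\<^sub>R integral {r..} (\<lambda>\<rho>. smc (cis \<phi>) (smc (exp (complex_of_real \<rho> * cis \<phi> * complex_of_real s)) (B (complex_of_real \<rho> * cis \<phi>)))))
      has_integral integral {r..} (\<lambda>\<rho>. smc (cis \<phi>) (smc (E (complex_of_real \<rho> * cis \<phi>)) (B (complex_of_real \<rho> * cis \<phi>))))) {0..t}"
    if \<phi>: "\<bar>\<phi>\<bar> = \<theta>" for \<phi>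
  proof -
    let ?B = "\<lambda>\<rho>. smc (cis \<phi>) (B (complex_of_real \<rho> * cis \<phi>))"
    define g1 where "g1 s = ?k s * s powr (- (1 / 2))" for s
    define c where "c = C * (- cos \<theta>) powr (- (1 / 2))"
    have c0: "0 \<le> c" using C0 by (simp add: c_def)
    have g1c: "continuous_on {0<..<t} g1" unfolding g1_def by (intro continuous_intros) (use G in auto)
    have g1i: "g1 integrable_on {0..t}"
    proof (rule integrable_dominated[OF interval_with_interior_Icc g1c])
      have h: "(\<lambda>s. s powr (- (1 / 2))) integrable_on {0..t}" by (rule integrable_on_powr_from_0) (use t in auto)
      \<comment> \<open>The product has a singularity at each end. On each half of the interval one
        factor is bounded by its value at t / 2, so the product is dominated by a sum of two
        integrable functions.\<close>
      show "(\<lambda>s. ((t / 2) powr (a - 1) / G) * s powr (- (1 / 2)) + (t / 2) powr (- (1 / 2)) * ?k s) integrable_on {0..t}"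
        using integrable_cmul[OF h, of "(t / 2) powr (a - 1) / G"] integrable_cmul[OF ki, of "(t / 2) powr (- (1 / 2))"]
        by (intro integrable_add) simp_all
      fix s assume s: "s \<in> {0<..<t}"
      show "norm (g1 s) \<le> ((t / 2) powr (a - 1) / G) * s powr (- (1 / 2)) + (t / 2) powr (- (1 / 2)) * ?k s"
      proof (cases "s \<le> t / 2")
        case True
        have "?k s \<le> (t / 2) powr (a - 1) / G" using True s a G t by (intro divide_right_mono powr_mono2') auto
        then have "g1 s \<le> ((t / 2) powr (a - 1) / G) * s powr (- (1 / 2))" unfolding g1_def by (intro mult_right_mono) auto
        moreover have "0 \<le> g1 s" "0 \<le> (t / 2) powr (- (1 / 2)) * ?k s" using G by (auto simp: g1_def)
        ultimately show ?thesis by simp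
      next
        case False
        have "s powr (- (1 / 2)) \<le> (t / 2) powr (- (1 / 2))" using False s t by (intro powr_mono2') auto
        then have "g1 s \<le> ?k s * (t / 2) powr (- (1 / 2))" unfolding g1_def using G by (intro mult_left_mono) auto
        moreover have "0 \<le> g1 s" "0 \<le> ((t / 2) powr (a - 1) / G) * s powr (- (1 / 2))" using G by (auto simp: g1_def)
        ultimately show ?thesis by (simp add: mult.commute)
      qed
    qed
    have rc: "continuous_on {r<..} ?B" by (rule continuous_on_ray[OF Bc]) (use \<phi> r in auto)
    have "((\<lambda>s. ?k s *\<^sub>R integral {r..} (\<lambda>\<rho>. smc (exp (complex_of_real \<rho> * cis \<phi> * complex_of_real s)) (?B \<rho>)))
      has_integral integral {r..} (\<lambda>\<rho>. smc (E (complex_of_real \<rho> * cis \<phi>)) (?B \<rho>))) {0..t}"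
    proof (rule laplace_fubini[where ?g2.0 = "\<lambda>\<rho>. c * \<rho> powr (- (3 / 2))", OF interval_with_interior_Ici _ rc E kc g1c _ g1i])
      show "(\<lambda>\<rho>. c * \<rho> powr (- (3 / 2))) integrable_on {r..}" by (rule integrable_on_powr_Ici) (use r in auto)
      show "continuous_on {r<..} (\<lambda>\<rho>. c * \<rho> powr (- (3 / 2)))" by (intro continuous_intros) (use r in auto)
      fix s \<rho> assume s: "s \<in> {0<..<t}" and \<rho>: "\<rho> \<in> {r<..}"
      have "norm (smc (exp (complex_of_real \<rho> * cis \<phi> * complex_of_real s)) (B (complex_of_real \<rho> * cis \<phi>)))
          \<le> fact 1 * C * (- cos \<theta> * s) powr (- (1 / 2)) * \<rho> powr (- 1 - 1 / 2)"
        by (rule norm_exp_weight_le[OF \<theta>(2) B _ _ \<phi>]) (use s \<rho> r in auto)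
      also have "\<dots> = s powr (- (1 / 2)) * (c * \<rho> powr (- (3 / 2)))"
        unfolding powr_mult by (simp add: c_def)
      finally have "exp (Re (complex_of_real \<rho> * cis \<phi>) * s) * norm (?B \<rho>) \<le> s powr (- (1 / 2)) * (c * \<rho> powr (- (3 / 2)))"
        by (simp add: norm_smc)
      then have "\<bar>?k s\<bar> * (exp (Re (complex_of_real \<rho> * cis \<phi>) * s) * norm (?B \<rho>)) \<le> \<bar>?k s\<bar> * (s powr (- (1 / 2)) * (c * \<rho> powr (- (3 / 2))))"
        by (rule mult_left_mono) simp
      then show "\<bar>?k s\<bar> * (exp (Re (complex_of_real \<rho> * cis \<phi>) * s) * norm (?B \<rho>)) \<le> g1 s * (c * \<rho> powr (- (3 / 2)))"
        using G by (simp add: g1_def mult_ac)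
    qed (use c0 G in \<open>auto simp: g1_def intro!: continuous_intros\<close>)
    then show ?thesis by (simp add: smc_mult[symmetric] mult_ac)
  qed
  have arc: "((\<lambda>s. ?k s *\<^sub>R integral {- \<theta>..\<theta>} (\<lambda>\<phi>. smc (\<i> * complex_of_real r * cis \<phi>) (smc (exp (complex_of_real r * cis \<phi> * complex_of_real s)) (B (complex_of_real r * cis \<phi>)))))
      has_integral integral {- \<theta>..\<theta>} (\<lambda>\<phi>. smc (\<i> * complex_of_real r * cis \<phi>) (smc (E (complex_of_real r * cis \<phi>)) (B (complex_of_real r * cis \<phi>))))) {0..t}"
  proof -
    let ?B = "\<lambda>\<phi>. smc (\<i> * complex_of_real r * cis \<phi>) (B (complex_of_real r * cis \<phi>))"
    have rc: "continuous_on {- \<theta><..<\<theta>} ?B"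
      by (rule continuous_on_subset[OF continuous_on_arc[OF Bc r]]) auto
    have "((\<lambda>s. ?k s *\<^sub>R integral {- \<theta>..\<theta>} (\<lambda>\<phi>. smc (exp (complex_of_real r * cis \<phi> * complex_of_real s)) (?B \<phi>)))
      has_integral integral {- \<theta>..\<theta>} (\<lambda>\<phi>. smc (E (complex_of_real r * cis \<phi>)) (?B \<phi>))) {0..t}"
    proof (rule laplace_fubini[where ?g2.0 = "\<lambda>\<phi>. exp (r * t) * C", OF interval_with_interior_Icc _ rc E kc kc _ ki])
      fix s \<phi> assume s: "s \<in> {0<..<t}" and \<phi>: "\<phi> \<in> {- \<theta><..<\<theta>}"
      have S: "complex_of_real r * cis \<phi> \<in> closed_sector \<theta>" using \<phi> r by (intro closed_sectorI) auto
      have "norm (B (complex_of_real r * cis \<phi>)) \<le> C / r"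
        using B[OF S] r by (simp add: norm_mult powr_minus divide_inverse)
      then have "norm (?B \<phi>) \<le> C" using r by (simp add: norm_smc norm_mult pos_le_divide_eq mult.commute)
      moreover have "Re (complex_of_real r * cis \<phi>) * s \<le> r * t"
      proof -
        have "r * s * cos \<phi> \<le> r * s * 1" using r s by (intro mult_left_mono) auto
        also have "\<dots> \<le> r * t" using r s by simp
        finally show ?thesis by (simp add: mult_ac)
      qed
      ultimately show "\<bar>?k s\<bar> * (exp (Re (complex_of_real r * cis \<phi>) * s) * norm (?B \<phi>)) \<le> ?k s * (exp (r * t) * C)"
        using G by (intro mult_mono) auto
    qed (use C0 G in \<open>auto intro!: continuous_intros\<close>)
    then show ?thesis by (simp add: smc_mult[symmetric] mult_ac)
  qed
  show ?thesis
    unfolding gamma_int_def scaleR_add_right scaleR_minus_right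
    by (intro has_integral_add has_integral_neg ray arc) (use \<theta> in auto)
qed

end

section \<open>Sectorial operators\<close>

definition (in complex_banach) smc_blinfun :: "complex \<Rightarrow> 'y \<Rightarrow>\<^sub>L 'y" where
  "smc_blinfun c = Blinfun (smc c)"

definition (in complex_banach) op_smc :: "complex \<Rightarrow> 'y \<Rightarrow>\<^sub>L 'y \<Rightarrow> 'y \<Rightarrow>\<^sub>L 'y" where
  "op_smc c B = smc_blinfun c o\<^sub>L B"

lemma (in complex_banach) op_smc_apply: "blinfun_apply (op_smc c B) x = smc c (blinfun_apply B x)"
  by (simp add: op_smc_def smc_blinfun_def bounded_linear_Blinfun_apply smc.bounded_linear_right)

text \<open>Makes contour integrals available in operator norm, so that estimates for G are uniform
  in the vector. Equality of norms follows from the inequality applied both to a and to 1 /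
  a.\<close>

lemma (in complex_banach) complex_banach_op_smc: "complex_banach op_smc"
proof (unfold_locales, unfold complex_structure_def, intro conjI allI)
  show eqs: "op_smc (complex_of_real r) B = r *\<^sub>R B" for r B
    by (rule blinfun_eqI) (simp add: op_smc_apply smc_of_real blinfun.scaleR_left)
  show m: "op_smc (a * b) B = op_smc a (op_smc b B)" for a b B
    by (rule blinfun_eqI) (simp add: op_smc_apply smc_mult)
  show "op_smc (a + b) B = op_smc a B + op_smc b B" for a b B
    by (rule blinfun_eqI) (simp add: op_smc_apply smc_add_left blinfun.add_left)
  show "op_smc a (B + C) = op_smc a B + op_smc a C" for a B C
    by (rule blinfun_eqI) (simp add: op_smc_apply smc_add_right blinfun.add_left)
  fix a B
  have le: "norm (op_smc c B') \<le> cmod c * norm B'" for c and B' :: "'y \<Rightarrow>\<^sub>L 'y"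
  proof (rule norm_blinfun_bound)
    show "norm (blinfun_apply (op_smc c B') x) \<le> cmod c * norm B' * norm x" for x
      using mult_left_mono[OF norm_blinfun[of B' x], of "cmod c"] by (simp add: op_smc_apply norm_smc mult_ac)
  qed simp
  show "norm (op_smc a B) = cmod a * norm B"
  proof (cases "a = 0")
    case True
    then show ?thesis using eqs[of 0 B] by simp
  next
    case False
    have "B = op_smc (1 / a) (op_smc a B)"
      using m[of "1 / a" a B] eqs[of 1 B] False by simp
    then have "norm B \<le> cmod (1 / a) * norm (op_smc a B)" using le by metis
    then have "cmod a * norm B \<le> norm (op_smc a B)" using False by (simp add: norm_divide field_simps)
    then show ?thesis using le[of a B] by simp
  qed
qed

locale sectorial = complex_banach smc
  for smc :: "complex \<Rightarrow> 'x::banach \<Rightarrow> 'x" +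
  fixes D :: "'x set" and A :: "'x \<Rightarrow> 'x" and \<alpha> th :: real
  assumes condition_A: "condition_A smc D A th" and \<alpha>: "0 < \<alpha>" "\<alpha> < 1"
begin

sublocale op: complex_banach op_smc by (rule complex_banach_op_smc)

lemma th: "pi / 2 < th" "th < pi"
  and cos_th: "cos th < 0"
  using condition_A by (auto simp: condition_A_def cos_lt_zero_pi)

lemma D_add: "x \<in> D \<Longrightarrow> y \<in> D \<Longrightarrow> x + y \<in> D"
  and D_smc: "x \<in> D \<Longrightarrow> smc c x \<in> D"
  and A_add: "x \<in> D \<Longrightarrow> y \<in> D \<Longrightarrow> A (x + y) = A x + A y"
  and A_smc: "x \<in> D \<Longrightarrow> A (smc c x) = smc c (A x)"
  using condition_A by (auto simp: condition_A_def closed_dense_op_def)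

abbreviation "\<rho>A \<equiv> resolvent_set smc D A"
abbreviation "R \<equiv> resolvent smc D A"

lemma R_mem: "R z a \<in> D" and R_eq: "smc z (R z a) - A (R z a) = a" if "z \<in> \<rho>A"
proof -
  have "\<exists>!x. x \<in> D \<and> smc z x - A x = a" using that by (simp add: resolvent_set_def)
  from theI'[OF this] show "R z a \<in> D" "smc z (R z a) - A (R z a) = a"
    by (simp_all add: resolvent_def)
qed

lemma R_unique:
  assumes "z \<in> \<rho>A" "x \<in> D" "smc z x - A x = a" shows "R z a = x"
proof -
  have "\<exists>!x. x \<in> D \<and> smc z x - A x = a" using assms(1) by (simp add: resolvent_set_def)
  from the1_equality[OF this] show ?thesis using assms by (simp add: resolvent_def)
qed

lemma R_add: "z \<in> \<rho>A \<Longrightarrow> R z (a + b) = R z a + R z b"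
  by (rule R_unique) (simp_all add: R_mem D_add A_add smc_add_right add_diff_add R_eq)

lemma R_smc: "z \<in> \<rho>A \<Longrightarrow> R z (smc c a) = smc c (R z a)"
  by (rule R_unique) (simp_all add: R_mem D_smc A_smc smc_commute[of z] smc_diff_right[symmetric] R_eq)

lemma bounded_linear_R:
  assumes "z \<in> \<rho>A" shows "bounded_linear (R z)"
proof -
  have "\<exists>M. \<forall>x\<in>D. norm x \<le> M * norm (smc z x - A x)"
    using assms by (simp add: resolvent_set_def)
  then obtain M where "\<forall>x\<in>D. norm x \<le> M * norm (smc z x - A x)" by blast
  then have M: "norm x \<le> M * norm (smc z x - A x)" if "x \<in> D" for x using that by blast
  show ?thesis
  proof (rule bounded_linear_intro[where K = M])
    show "R z (r *\<^sub>R a) = r *\<^sub>R R z a" for r a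
      using R_smc[OF assms, of "complex_of_real r" a] by (simp add: smc_of_real)
    show "norm (R z a) \<le> norm a * M" for a
      using M[OF R_mem[OF assms, of a]] R_eq[OF assms, of a] by (simp add: mult.commute)
  qed (rule R_add[OF assms])
qed

section \<open>The resolvent as an operator-valued function\<close>

definition res :: "complex \<Rightarrow> 'x \<Rightarrow>\<^sub>L 'x" where "res z = Blinfun (R z)"

lemma res_apply: "z \<in> \<rho>A \<Longrightarrow> blinfun_apply (res z) = R z"
  unfolding res_def by (rule bounded_linear_Blinfun_apply[OF bounded_linear_R])

lemma resolvent_identity:
  assumes z: "z \<in> \<rho>A" and w: "w \<in> \<rho>A"
  shows "res z - res w = op_smc (w - z) (res z o\<^sub>L res w)"
proof (rule blinfun_eqI)
  fix a
  let ?x = "R w a"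
  have "smc z ?x - A ?x = a + smc (z - w) ?x"
    using R_eq[OF w, of a] by (simp add: smc_diff_left algebra_simps)
  then have "?x = R z (a + smc (z - w) ?x)" using R_unique[OF z R_mem[OF w]] by metis
  also have "\<dots> = R z a + smc (z - w) (R z ?x)" by (simp add: R_add[OF z] R_smc[OF z])
  finally have "R z a - ?x = - smc (z - w) (R z ?x)" by (metis add_diff_cancel_left' minus_diff_eq)
  also have "\<dots> = smc (w - z) (R z ?x)" by (metis minus_diff_eq smc_minus_left)
  finally show "blinfun_apply (res z - res w) a = blinfun_apply (op_smc (w - z) (res z o\<^sub>L res w)) a"
    by (simp add: blinfun.diff_left res_apply z w op_smc_apply)
qed

text \<open>The inverse of \<open>A\<close>; the sign appears because \<open>res 0\<close> inverts -
  A.\<close>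

definition Sinv :: "'x \<Rightarrow>\<^sub>L 'x" where "Sinv = - res 0"

lemma zero_mem: "0 \<in> \<rho>A" using condition_A by (simp add: condition_A_def)

lemma Sinv_apply: "blinfun_apply Sinv a = - R 0 a"
  by (simp add: Sinv_def blinfun.minus_left res_apply[OF zero_mem])

lemma A_minus: "x \<in> D \<Longrightarrow> A (- x) = - A x" and D_minus: "x \<in> D \<Longrightarrow> - x \<in> D"
  using A_smc[of x "- 1"] D_smc[of x "- 1"] by (simp_all add: smc_minus_left smc_one)

lemma Sinv_mem: "blinfun_apply Sinv a \<in> D" and A_Sinv: "A (blinfun_apply Sinv a) = a"
  using R_mem[OF zero_mem, of a] R_eq[OF zero_mem, of a]
  by (auto simp: Sinv_apply D_minus A_minus smc_zero_left)

lemma Sinv_A: "x \<in> D \<Longrightarrow> blinfun_apply Sinv (A x) = x"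
  using R_unique[OF zero_mem, of x "- A x"] R_smc[OF zero_mem, of "- 1" "A x"]
  by (simp add: Sinv_apply smc_minus_left smc_one smc_zero_left)

text \<open>Apply the inverse of \<open>A\<close> to z R a = a + A (R a). This identity is where the
  operator S (G - I) originates.\<close>

lemma Sinv_res:
  assumes z: "z \<in> \<rho>A"
  shows "op_smc z (Sinv o\<^sub>L res z) = Sinv + res z"
proof (rule blinfun_eqI)
  fix a
  have "smc z (R z a) = a + A (R z a)" using R_eq[OF z, of a] by (simp add: algebra_simps)
  then have "blinfun_apply Sinv (smc z (R z a)) = blinfun_apply Sinv a + R z a"
    using Sinv_A[OF R_mem[OF z, of a]] by (simp add: blinfun.add_right)
  moreover have "blinfun_apply Sinv (smc z (R z a)) = smc z (blinfun_apply Sinv (R z a))"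
    by (simp add: Sinv_apply R_smc[OF zero_mem] smc_minus_right)
  ultimately show "blinfun_apply (op_smc z (Sinv o\<^sub>L res z)) a = blinfun_apply (Sinv + res z) a"
    by (simp add: op_smc_apply res_apply z blinfun.add_left)
qed

lemma Sinv_op_smc: "Sinv o\<^sub>L op_smc c B = op_smc c (Sinv o\<^sub>L B)"
  by (rule blinfun_eqI) (simp add: op_smc_apply Sinv_apply R_smc[OF zero_mem] smc_minus_right)

text \<open>The midpoint of \<alpha> * th and th: the power z^\<alpha> maps the closed sector of
  angle th strictly inside angle \<open>th'\<close>, and \<open>th'\<close> is still strictly below
  th, as the resolvent estimate requires.\<close>

definition th' :: real where "th' = th * (1 + \<alpha>) / 2"

lemma th': "\<alpha> * th < th'" "th' < th" "0 < th'"
proof -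
  have p: "0 < th" using th pi_gt_zero by linarith
  define b where "b = \<alpha> * th"
  have b: "b < th" "0 < b" using p \<alpha> by (simp_all add: b_def)
  have e: "th' = (th + b) / 2" by (simp add: th'_def b_def algebra_simps)
  show "\<alpha> * th < th'" using b by (simp add: e flip: b_def)
  show "th' < th" using b by (simp add: e)
  show "0 < th'" using p b by (simp add: e)
qed

lemma sector_subset: "sector th' \<subseteq> \<rho>A"
  using condition_A th' by (force simp: condition_A_def sector_def)

lemma res_bound: "\<exists>M\<ge>0. \<forall>z\<in>sector th'. norm (res z) \<le> M / cmod z"
proof -
  have "0 < th - th'" "th - th' < th" using th' by auto
  then obtain C where C: "\<And>z a. z \<in> sector (th - (th - th')) \<Longrightarrow> norm (R z a) \<le> C / cmod z * norm a"
    using condition_A unfolding condition_A_def by blast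
  show ?thesis
  proof (intro exI[of _ "max C 0"] conjI ballI)
    fix z assume z: "z \<in> sector th'"
    show "norm (res z) \<le> max C 0 / cmod z"
    proof (rule norm_blinfun_bound)
      fix a
      have "norm (R z a) \<le> C / cmod z * norm a" using C[of z a] z by simp
      also have "\<dots> \<le> max C 0 / cmod z * norm a" by (intro mult_right_mono divide_right_mono) auto
      finally show "norm (blinfun_apply (res z) a) \<le> max C 0 / cmod z * norm a"
        using res_apply sector_subset z by (metis subsetD)
    qed simp
  qed simp
qed

lemma open_sector: "\<beta> \<le> pi \<Longrightarrow> open (sector \<beta>)"
proof -
  assume b: "\<beta> \<le> pi"
  have "sector \<beta> = {z \<in> - \<real>\<^sub>\<le>\<^sub>0. \<bar>Arg z\<bar> \<in> {..<\<beta>}}"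
  proof -
    have "z \<notin> \<real>\<^sub>\<le>\<^sub>0" if "z \<noteq> 0" "\<bar>Arg z\<bar> < \<beta>" for z
      using that b Arg_eq_pi[of z] by (auto simp: complex_nonpos_Reals_iff complex_eq_iff)
    then show ?thesis by (auto simp: sector_def)
  qed
  moreover have "open \<dots>"
    by (rule continuous_open_preimage[unfolded vimage_def Int_def Collect_mem_eq mem_Collect_eq])
      (auto intro!: continuous_intros continuous_on_Arg closed_nonpos_Reals_complex open_Compl)
  ultimately show ?thesis by simp
qed

lemma res_continuous: "continuous_on (sector th') res"
  unfolding continuous_on_def
proof
  obtain M where M: "M \<ge> 0" "\<And>z. z \<in> sector th' \<Longrightarrow> norm (res z) \<le> M / cmod z" using res_bound by blast
  fix z assume z: "z \<in> sector th'"
  have z0: "z \<noteq> 0" using z by (simp add: sector_def)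
  have "((\<lambda>w. cmod (z - w) * (M / cmod w * (M / cmod z))) \<longlongrightarrow> cmod (z - z) * (M / cmod z * (M / cmod z))) (at z within sector th')"
    by (intro tendsto_intros) (use z0 in auto)
  then have t: "((\<lambda>w. cmod (z - w) * (M / cmod w * (M / cmod z))) \<longlongrightarrow> 0) (at z within sector th')" by simp
  have "((\<lambda>w. res w - res z) \<longlongrightarrow> 0) (at z within sector th')"
  proof (rule Lim_null_comparison[OF _ t])
    have "norm (res w - res z) \<le> cmod (z - w) * (M / cmod w * (M / cmod z))" if w: "w \<in> sector th'" for w
    proof -
      have "norm (res w - res z) = cmod (z - w) * norm (res w o\<^sub>L res z)"
        unfolding resolvent_identity[OF subsetD[OF sector_subset w] subsetD[OF sector_subset z]] op.norm_smc ..
      also have "\<dots> \<le> cmod (z - w) * (norm (res w) * norm (res z))"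
        by (intro mult_left_mono norm_blinfun_compose) auto
      also have "\<dots> \<le> cmod (z - w) * (M / cmod w * (M / cmod z))"
        using M w z by (intro mult_left_mono mult_mono) auto
      finally show ?thesis .
    qed
    then show "\<forall>\<^sub>F w in at z within sector th'. norm (res w - res z) \<le> cmod (z - w) * (M / cmod w * (M / cmod z))"
      unfolding eventually_at by (intro exI[of _ 1]) auto
  qed
  then show "(res \<longlongrightarrow> res z) (at z within sector th')" by (simp add: LIM_zero_iff)
qed

lemma res_derivative:
  assumes z: "z \<in> sector th'"
  shows "(res has_derivative (\<lambda>h. op_smc h (- (res z o\<^sub>L res z)))) (at z)"
proof -
  have "(res has_derivative (\<lambda>h. op_smc h (- (res z o\<^sub>L res z)))) (at z within sector th')"
    unfolding has_derivative_iff_norm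
  proof
    show "bounded_linear (\<lambda>h. op_smc h (- (res z o\<^sub>L res z)))" by (rule op.smc.bounded_linear_left)
    have "(res \<longlongrightarrow> res z) (at z within sector th')" using res_continuous z unfolding continuous_on_def by blast
    then have "((\<lambda>w. norm (res w - res z) * norm (res z)) \<longlongrightarrow> norm (res z - res z) * norm (res z)) (at z within sector th')"
      by (intro tendsto_intros)
    then have t: "((\<lambda>w. norm (res w - res z) * norm (res z)) \<longlongrightarrow> 0) (at z within sector th')" by simp
    show "((\<lambda>w. norm (res w - res z - op_smc (w - z) (- (res z o\<^sub>L res z))) / norm (w - z)) \<longlongrightarrow> 0) (at z within sector th')"
    proof (rule Lim_null_comparison[OF _ t])
      have "norm (res w - res z - op_smc (w - z) (- (res z o\<^sub>L res z))) / norm (w - z) \<le> norm (res w - res z) * norm (res z)"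
        if w: "w \<in> sector th'" "w \<noteq> z" for w
      proof -
        have "res w - res z - op_smc (w - z) (- (res z o\<^sub>L res z)) = op_smc (z - w) (res w o\<^sub>L res z) - op_smc (z - w) (res z o\<^sub>L res z)"
          using resolvent_identity[OF subsetD[OF sector_subset w(1)] subsetD[OF sector_subset z]]
          by (simp add: op.smc_minus_right op.smc_diff_left)
        also have "\<dots> = op_smc (z - w) ((res w - res z) o\<^sub>L res z)"
          by (simp only: bounded_bilinear.diff_left[OF bounded_bilinear_blinfun_compose] op.smc_diff_right)
        finally have "norm (res w - res z - op_smc (w - z) (- (res z o\<^sub>L res z))) = cmod (z - w) * norm ((res w - res z) o\<^sub>L res z)"
          by (simp add: op.norm_smc)
        also have "\<dots> \<le> cmod (z - w) * (norm (res w - res z) * norm (res z))"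
          by (intro mult_left_mono norm_blinfun_compose) auto
        finally show ?thesis using w(2) by (simp add: divide_le_eq norm_minus_commute mult_ac)
      qed
      then show "\<forall>\<^sub>F w in at z within sector th'. norm (norm (res w - res z - op_smc (w - z) (- (res z o\<^sub>L res z))) / norm (w - z)) \<le> norm (res w - res z) * norm (res z)"
        unfolding eventually_at by (intro exI[of _ 1]) auto
    qed
  qed
  moreover have "th' \<le> pi" using th' th by simp
  ultimately show ?thesis using at_within_open[OF z open_sector] by simp
qed

section \<open>The resolvent along z^\<alpha> and the contour integrals built from it\<close>

definition \<Psi> :: "complex \<Rightarrow> 'x \<Rightarrow>\<^sub>L 'x" where "\<Psi> z = res (z powr complex_of_real \<alpha>)"

lemma powr_mem_sector:
  assumes z: "z \<in> closed_sector th" shows "z powr complex_of_real \<alpha> \<in> sector th'"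
proof -
  note m = mem_closed_sectorD[OF z th(2)]
  have "\<bar>\<alpha> * Arg z\<bar> \<le> \<alpha> * th" using m(3) \<alpha> by (simp add: abs_mult mult_left_mono)
  also have "\<dots> < th'" by (rule th'(1))
  finally have a: "\<bar>\<alpha> * Arg z\<bar> < th'" .
  have "z powr complex_of_real \<alpha> = complex_of_real (norm z powr \<alpha>) * exp (\<i> * complex_of_real (\<alpha> * Arg z))"
    using m(1) by (simp add: powr_def Ln_Arg exp_add[symmetric] exp_of_real[symmetric] algebra_simps)
  moreover have "norm z powr \<alpha> > 0" using m(1) by simp
  ultimately have "Arg (z powr complex_of_real \<alpha>) = \<alpha> * Arg z"
    using a th' th by (intro Arg_unique[where r = "norm z powr \<alpha>"]) auto
  then show ?thesis using a m(1) by (simp add: sector_def)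
qed

lemma \<Psi>_bound: "\<exists>M\<ge>0. \<forall>z\<in>closed_sector th. norm (\<Psi> z) \<le> M * norm z powr (- \<alpha>)"
proof -
  obtain M where M: "M \<ge> 0" "\<And>z. z \<in> sector th' \<Longrightarrow> norm (res z) \<le> M / cmod z" using res_bound by blast
  have "norm (\<Psi> z) \<le> M * norm z powr (- \<alpha>)" if z: "z \<in> closed_sector th" for z
    using M(2)[OF powr_mem_sector[OF z]] norm_powr_real_powr'[of "complex_of_real \<alpha>" z]
    by (simp add: \<Psi>_def powr_minus divide_inverse)
  then show ?thesis using M(1) by blast
qed

lemma \<Psi>_derivative:
  assumes z: "z \<in> closed_sector th"
  shows "(\<Psi> has_derivative (\<lambda>h. op_smc h (op_smc (complex_of_real \<alpha> * z powr (complex_of_real \<alpha> - 1)) (- (\<Psi> z o\<^sub>L \<Psi> z))))) (at z)"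
proof -
  have "((\<lambda>z. z powr complex_of_real \<alpha>) has_derivative (\<lambda>h. complex_of_real \<alpha> * z powr (complex_of_real \<alpha> - 1) * h)) (at z)"
    using has_field_derivative_powr[OF mem_closed_sectorD(2)[OF z th(2)]] by (simp add: has_field_derivative_def)
  from has_derivative_compose[OF this res_derivative[OF powr_mem_sector[OF z]]]
  show ?thesis unfolding \<Psi>_def by (simp add: op.smc_mult mult.commute)
qed

lemma \<Psi>_continuous: "continuous_on (closed_sector th) \<Psi>"
  by (rule has_derivative_continuous_on, rule has_derivative_at_withinI, rule \<Psi>_derivative)

text \<open>Provides what \<open>gamma_int_radius\<close> and \<open>gamma_int_eq_0\<close> ask for:
  complex differentiability on the closed sector with a continuous derivative, for every scalar
  weight holomorphic off the cut.\<close>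

lemma weighted_resolvent_derivative:
  assumes a: "a holomorphic_on - \<real>\<^sub>\<le>\<^sub>0"
  shows "\<exists>f'. (\<forall>z\<in>closed_sector th. ((\<lambda>z. op_smc (a z) (\<Psi> z)) has_derivative (\<lambda>h. op_smc h (f' z))) (at z))
    \<and> continuous_on (closed_sector th) f'"
proof -
  define f' where "f' z = op_smc (deriv a z) (\<Psi> z) +
    op_smc (a z) (op_smc (complex_of_real \<alpha> * z powr (complex_of_real \<alpha> - 1)) (- (\<Psi> z o\<^sub>L \<Psi> z)))" for z
  have op: "open (- \<real>\<^sub>\<le>\<^sub>0 :: complex set)" by (auto intro: open_Compl closed_nonpos_Reals_complex)
  have sub: "closed_sector th \<subseteq> - \<real>\<^sub>\<le>\<^sub>0" using mem_closed_sectorD(2)[OF _ th(2)] by auto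
  have "((\<lambda>z. op_smc (a z) (\<Psi> z)) has_derivative (\<lambda>h. op_smc h (f' z))) (at z)" if z: "z \<in> closed_sector th" for z
  proof -
    have "(a has_field_derivative deriv a z) (at z)"
      by (rule holomorphic_derivI[OF a op]) (use z sub in auto)
    then have "(a has_derivative (\<lambda>h. deriv a z * h)) (at z)" by (simp add: has_field_derivative_def)
    from op.smc.FDERIV[OF this \<Psi>_derivative[OF z]] show ?thesis
      unfolding f'_def by (simp add: op.smc_add_right op.smc_mult[symmetric] mult_ac add.commute)
  qed
  moreover have "continuous_on (closed_sector th) f'"
  proof -
    have 1: "continuous_on (closed_sector th) a"
      by (rule continuous_on_subset[OF holomorphic_on_imp_continuous_on[OF a] sub])
    have 2: "continuous_on (closed_sector th) (deriv a)"
      by (rule continuous_on_subset[OF holomorphic_on_imp_continuous_on[OF holomorphic_deriv[OF a op]] sub])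
    have 3: "continuous_on (closed_sector th) (\<lambda>z. z powr (complex_of_real \<alpha> - 1))"
      by (rule continuous_on_subset[OF _ sub], rule holomorphic_on_imp_continuous_on) (auto intro!: holomorphic_intros)
    show ?thesis unfolding f'_def
      by (intro continuous_intros op.smc.continuous_on bounded_bilinear.continuous_on[OF bounded_bilinear_blinfun_compose] 1 2 3 \<Psi>_continuous)
  qed
  ultimately show ?thesis by blast
qed

text \<open>Each time derivative of exp (z t) brings down one factor z, whence the power
  \<open>j\<close>.\<close>

definition weight :: "nat \<Rightarrow> complex \<Rightarrow> 'x \<Rightarrow>\<^sub>L 'x" where
  "weight j z = op_smc (z powr (complex_of_real \<alpha> - 1) * z ^ j) (\<Psi> z)"

text \<open>\<open>solop 0\<close> is the solution operator of the homogeneous equation and \<open>solop j\<close> is its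
\<open>j\<close>-th derivative.\<close>

definition solop :: "nat \<Rightarrow> real \<Rightarrow> 'x \<Rightarrow>\<^sub>L 'x" where
  "solop j t = op_smc (1 / (2 * complex_of_real pi * \<i>))
     (op.gamma_int th (1 / t) (\<lambda>z. op_smc (exp (z * complex_of_real t)) (weight j z)))"

lemma th_nonneg: "0 \<le> th" using th pi_gt_zero by linarith

lemma closed_sector_subset: "closed_sector th \<subseteq> - \<real>\<^sub>\<le>\<^sub>0"
  using mem_closed_sectorD(2)[OF _ th(2)] by auto

lemma continuous_on_powr_sector: "continuous_on (closed_sector th) (\<lambda>z. z powr a)"
  by (rule continuous_on_subset[OF _ closed_sector_subset], rule holomorphic_on_imp_continuous_on)
    (auto intro!: holomorphic_intros)

lemma continuous_on_weight: "continuous_on (closed_sector th) (weight j)"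
  unfolding weight_def[abs_def]
  by (intro op.smc.continuous_on continuous_intros continuous_on_powr_sector \<Psi>_continuous)

lemma weight_Suc: "op_smc z (weight j z) = weight (Suc j) z"
  by (simp add: weight_def op.smc_mult[symmetric] mult_ac)

text \<open>The power \<alpha> - 1 of the weight and the power - \<alpha> of the resolvent add up to
  - 1, so \<alpha> drops out and G behaves like an inverse Laplace transform of 1 / z. One constant
  serves all j.\<close>

lemma weight_bound:
  obtains M where "M \<ge> 0" "\<And>j z. z \<in> closed_sector th \<Longrightarrow> norm (weight j z) \<le> M * norm z powr (real j - 1)"
proof -
  obtain M where M: "M \<ge> 0" "\<And>z. z \<in> closed_sector th \<Longrightarrow> norm (\<Psi> z) \<le> M * norm z powr (- \<alpha>)"
    using \<Psi>_bound by blast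
  have "norm (weight j z) \<le> M * norm z powr (real j - 1)" if z: "z \<in> closed_sector th" for j z
  proof -
    have z0: "0 < norm z" using mem_closed_sectorD(1)[OF z th(2)] by simp
    have "norm (weight j z) = norm z powr (\<alpha> - 1) * norm z powr real j * norm (\<Psi> z)"
      using norm_powr_real_powr'[of "complex_of_real (\<alpha> - 1)" z] z0
      by (simp add: weight_def op.norm_smc norm_mult norm_power powr_realpow)
    also have "\<dots> \<le> norm z powr (\<alpha> - 1) * norm z powr real j * (M * norm z powr (- \<alpha>))"
      by (intro mult_left_mono M z) auto
    also have "\<dots> = M * (norm z powr (\<alpha> - 1) * norm z powr real j * norm z powr (- \<alpha>))" by simp
    also have "norm z powr (\<alpha> - 1) * norm z powr real j * norm z powr (- \<alpha>) = norm z powr (real j - 1)"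
      by (simp add: powr_add[symmetric])
    finally show ?thesis .
  qed
  then show ?thesis using M(1) by (rule that[rotated])
qed

lemma exp_weight_decay:
  assumes "0 < t" "0 < r"
  shows "ray_decay th r (\<lambda>z. op_smc (exp (z * complex_of_real t)) (weight j z))"
proof -
  obtain M where M: "\<And>j z. z \<in> closed_sector th \<Longrightarrow> norm (weight j z) \<le> M * norm z powr (real j - 1)"
    using weight_bound by metis
  show ?thesis by (rule op.exp_weight_ray_decay[OF cos_th continuous_on_weight M assms])
qed

text \<open>Frees the radius from 1 / t: operators at different times can then be represented on one
  fixed contour.\<close>

lemma gamma_int_weight_radius:
  assumes t: "0 < t" and r: "0 < r0" "0 < r1"
  shows "op.gamma_int th r0 (\<lambda>z. op_smc (exp (z * complex_of_real t)) (weight j z))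
    = op.gamma_int th r1 (\<lambda>z. op_smc (exp (z * complex_of_real t)) (weight j z))"
proof -
  let ?a = "\<lambda>z. exp (z * complex_of_real t) * (z powr (complex_of_real \<alpha> - 1) * z ^ j)"
  let ?f = "\<lambda>z. op_smc (exp (z * complex_of_real t)) (weight j z)"
  have eq: "?f = (\<lambda>z. op_smc (?a z) (\<Psi> z))" by (simp add: weight_def op.smc_mult[symmetric])
  have "?a holomorphic_on - \<real>\<^sub>\<le>\<^sub>0" by (auto intro!: holomorphic_intros)
  then have "\<exists>f'. (\<forall>z\<in>closed_sector th. (?f has_derivative (\<lambda>h. op_smc h (f' z))) (at z)) \<and> continuous_on (closed_sector th) f'"
    unfolding eq by (rule weighted_resolvent_derivative)
  then obtain f' where f': "\<And>z. z \<in> closed_sector th \<Longrightarrow> (?f has_derivative (\<lambda>h. op_smc h (f' z))) (at z)"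
    "continuous_on (closed_sector th) f'" by blast
  have *: "op.gamma_int th s1 ?f = op.gamma_int th s0 ?f" if s: "0 < s0" "s0 \<le> s1" for s0 s1
  proof -
    obtain C e where Ce: "1 < e" "\<And>\<rho> \<phi>. s0 \<le> \<rho> \<Longrightarrow> \<bar>\<phi>\<bar> = th \<Longrightarrow> norm (?f (complex_of_real \<rho> * cis \<phi>)) \<le> C * \<rho> powr (- e)"
      using exp_weight_decay[OF t s(1)] unfolding ray_decay_def by blast
    show ?thesis by (rule op.gamma_int_radius[OF f' s th_nonneg Ce])
  qed
  show ?thesis using *[of r0 r1] *[of r1 r0] r by (cases "r0 \<le> r1") auto
qed

lemma solop_radius:
  assumes "0 < t" "0 < r"
  shows "solop j t = op_smc (1 / (2 * complex_of_real pi * \<i>))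
     (op.gamma_int th r (\<lambda>z. op_smc (exp (z * complex_of_real t)) (weight j z)))"
  unfolding solop_def using gamma_int_weight_radius[of t "1 / t" r] assms by simp

lemma solop_bound: "\<exists>C\<ge>0. \<forall>t>0. norm (solop j t) \<le> C * t powr (- real j)"
proof -
  obtain M where M: "M \<ge> 0" "\<And>j z. z \<in> closed_sector th \<Longrightarrow> norm (weight j z) \<le> M * norm z powr (real j - 1)"
    using weight_bound by metis
  \<comment> \<open>\<open>F\<close> is the constant on the rays, where the power j + 1 taken from
    the exponential turns the weight of order j - 1 into \<rho>^(-2). On the arc of radius 1 / t the
    exponential is at most exp 1, which explains the other term of \<open>C\<close>.\<close>
  define F where "F = fact (Suc j) * M * (- cos th) powr (- (real j + 1))"
  define C where "C = (2 * F + 2 * th * (exp 1 * M)) / (2 * pi)"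
  have F0: "0 \<le> F" using M(1) by (simp add: F_def)
  have "norm (solop j t) \<le> C * t powr (- real j)" if t: "0 < t" for t
  proof -
    let ?f = "\<lambda>z. op_smc (exp (z * complex_of_real t)) (weight j z)"
    have "norm (op.gamma_int th (1 / t) ?f)
        \<le> 2 * (F * t powr (- (real j + 1))) * ((1 / t) powr (1 - 2) / (2 - 1)) + 2 * th * (1 / t) * (exp 1 * M * (1 / t) powr (real j - 1))"
    proof (rule op.norm_gamma_int_le)
      show "continuous_on (closed_sector th) ?f" using exp_weight_decay[OF t, of 1] by (simp add: ray_decay_def)
      show "norm (?f (complex_of_real \<rho> * cis \<phi>)) \<le> F * t powr (- (real j + 1)) * \<rho> powr (- 2)" if "1 / t \<le> \<rho>" "\<bar>\<phi>\<bar> = th" for \<rho> \<phi>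
      proof -
        have \<rho>: "0 < \<rho>" using t that(1) by (meson divide_pos_pos less_le_trans zero_less_one)
        have "norm (?f (complex_of_real \<rho> * cis \<phi>)) \<le> fact (Suc j) * M * (- cos th * t) powr (- (real j + 1)) * \<rho> powr ((real j - 1) - (real j + 1))"
          by (rule op.norm_exp_weight_le[OF cos_th M(2) t \<rho> that(2)]) auto
        also have "\<dots> = F * t powr (- (real j + 1)) * \<rho> powr (- 2)"
          unfolding powr_mult F_def by simp
        finally show ?thesis .
      qed
      show "norm (?f (complex_of_real (1 / t) * cis \<phi>)) \<le> exp 1 * M * (1 / t) powr (real j - 1)" if "\<bar>\<phi>\<bar> \<le> th" for \<phi>
      proof -
        have "complex_of_real (1 / t) * cis \<phi> \<in> closed_sector th" using t that by (intro closed_sectorI) auto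
        from M(2)[OF this, of j] have w: "norm (weight j (complex_of_real (1 / t) * cis \<phi>)) \<le> M * (1 / t) powr (real j - 1)"
          using t by (simp add: norm_mult norm_divide)
        have "norm (exp (complex_of_real (1 / t) * cis \<phi> * complex_of_real t)) = exp (cos \<phi>)" using t by simp
        also have "\<dots> \<le> exp 1" by simp
        finally show ?thesis using mult_mono[OF _ w] by (simp add: op.norm_smc mult.assoc)
      qed
    qed (use t th_nonneg in auto)
    also have "\<dots> = (2 * F + 2 * th * (exp 1 * M)) * t powr (- real j)"
      using t by (simp add: powr_diff powr_minus powr_add powr_divide powr_realpow field_simps)
    finally have "norm (solop j t) \<le> (1 / (2 * pi)) * ((2 * F + 2 * th * (exp 1 * M)) * t powr (- real j))"
      by (simp add: solop_def op.norm_smc norm_divide norm_mult divide_right_mono)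
    then show ?thesis by (simp add: C_def)
  qed
  moreover have "0 \<le> C" using F0 M(1) th_nonneg by (simp add: C_def)
  ultimately show ?thesis by blast
qed

lemma solop_derivative:
  assumes t: "0 < t"
  shows "(solop j has_vector_derivative solop (Suc j) t) (at t)"
proof -
  obtain M where M: "M \<ge> 0" "\<And>j z. z \<in> closed_sector th \<Longrightarrow> norm (weight j z) \<le> M * norm z powr (real j - 1)"
    using weight_bound by metis
  let ?c = "1 / (2 * complex_of_real pi * \<i>)"
  have "((\<lambda>s. op_smc ?c (op.gamma_int th 1 (\<lambda>z. op_smc (exp (z * complex_of_real s)) (weight j z)))) has_vector_derivative
    op_smc ?c (op.gamma_int th 1 (\<lambda>z. op_smc (exp (z * complex_of_real t)) (op_smc z (weight j z))))) (at t)"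
    by (rule bounded_linear.has_vector_derivative[OF op.smc.bounded_linear_right])
      (rule op.gamma_int_exp_derivative[OF th_nonneg cos_th continuous_on_weight M(2) t], auto)
  then have "((\<lambda>s. op_smc ?c (op.gamma_int th 1 (\<lambda>z. op_smc (exp (z * complex_of_real s)) (weight j z)))) has_vector_derivative
    solop (Suc j) t) (at t)"
    unfolding weight_Suc solop_radius[OF t zero_less_one] .
  then show ?thesis
    by (rule has_vector_derivative_transform_within_open[where S = "{0<..}"]) (use t in \<open>auto simp: solop_radius[OF _ zero_less_one]\<close>)
qed

text \<open>The fractional integral is moved inside the contour, where
  \<open>kernel_remainder_eq\<close> evaluates it. The remainder contributes 0, and the main part
  z^(-\<alpha>) z^(\<alpha> - 1) times the resolvent is the resolvent divided by z, which
  \<open>Sinv_res\<close> rewrites in terms of S.\<close>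

lemma solop_frac_int:
  assumes t: "0 < t"
  shows "((\<lambda>s. ((t - s) powr (\<alpha> - 1) / Gamma \<alpha>) *\<^sub>R solop 0 s) has_integral Sinv o\<^sub>L (solop 0 t - id_blinfun)) {0..t}"
proof -
  define r where "r = 1 / t"
  have r: "0 < r" using t by (simp add: r_def)
  obtain M where M: "M \<ge> 0" "\<And>j z. z \<in> closed_sector th \<Longrightarrow> norm (weight j z) \<le> M * norm z powr (real j - 1)"
    using weight_bound by metis
  have G: "0 < Gamma \<alpha>" by (rule Gamma_real_pos) (use \<alpha> in simp)
  let ?c = "1 / (2 * complex_of_real pi * \<i>)"
  let ?w = "weight 0" and ?kr = "kernel_remainder \<alpha> t"
  let ?E = "\<lambda>z. exp (z * complex_of_real t) * z powr - complex_of_real \<alpha> - ?kr z"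
  let ?g = "\<lambda>z. op_smc (exp (z * complex_of_real t)) (op_smc (z powr - complex_of_real \<alpha>) (?w z))"
  have kint: "((\<lambda>s. complex_of_real ((t - s) powr (\<alpha> - 1) / Gamma \<alpha>) * exp (z * complex_of_real s)) has_integral ?E z) {0..t}" for z
    by (rule kernel_remainder_eq) (use \<alpha> t in auto)
  have I1: "((\<lambda>s. ((t - s) powr (\<alpha> - 1) / Gamma \<alpha>) *\<^sub>R op.gamma_int th r (\<lambda>z. op_smc (exp (z * complex_of_real s)) (?w z))) has_integral
    op.gamma_int th r (\<lambda>z. op_smc (?E z) (?w z))) {0..t}"
    by (rule op.gamma_int_fubini[OF th_nonneg cos_th continuous_on_weight _ t r \<alpha> kint G])
      (use M(2)[of _ 0] in simp)
  from has_integral_linear[OF this op.smc.bounded_linear_right[of ?c]]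
  have "((\<lambda>s. ((t - s) powr (\<alpha> - 1) / Gamma \<alpha>) *\<^sub>R op_smc ?c (op.gamma_int th r (\<lambda>z. op_smc (exp (z * complex_of_real s)) (?w z)))) has_integral
    op_smc ?c (op.gamma_int th r (\<lambda>z. op_smc (?E z) (?w z)))) {0..t}"
    by (simp add: o_def op.smc.scaleR_right)
  then have I2: "((\<lambda>s. ((t - s) powr (\<alpha> - 1) / Gamma \<alpha>) *\<^sub>R solop 0 s) has_integral
    op_smc ?c (op.gamma_int th r (\<lambda>z. op_smc (?E z) (?w z)))) {0..t}"
    by (rule has_integral_spike[OF negligible_sing[of 0], rotated]) (use r in \<open>auto simp: solop_radius\<close>)
  have "\<exists>C\<ge>0. \<forall>\<rho> \<phi>. r \<le> \<rho> \<longrightarrow> \<bar>\<phi>\<bar> \<le> th \<longrightarrow> norm (?kr (complex_of_real \<rho> * cis \<phi>)) \<le> C * \<rho> powr (- 1 / 4)"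
    using kernel_remainder_bound[OF \<alpha> t r _ th(2)] th pi_gt_zero by (metis less_trans pi_half_gt_zero)
  then obtain C where C: "0 \<le> C" "\<And>\<rho> \<phi>. r \<le> \<rho> \<Longrightarrow> \<bar>\<phi>\<bar> \<le> th \<Longrightarrow> norm (?kr (complex_of_real \<rho> * cis \<phi>)) \<le> C * \<rho> powr (- 1 / 4)"
    by blast
  \<comment> \<open>The exponent 5/4 is 1/4 from the remainder plus 1 from the weight. The bound
    holds throughout the closed sector and not only on the rays, so the contour can be pushed to
    infinity.\<close>
  have krb: "norm (op_smc (?kr (complex_of_real \<rho> * cis \<phi>)) (?w (complex_of_real \<rho> * cis \<phi>))) \<le> C * M * \<rho> powr (- (5 / 4))"
    if h: "r \<le> \<rho>" "\<bar>\<phi>\<bar> \<le> th" for \<rho> \<phi>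
  proof -
    have \<rho>: "0 < \<rho>" using h r by simp
    have "norm (?w (complex_of_real \<rho> * cis \<phi>)) \<le> M * \<rho> powr - 1"
      using M(2)[OF closed_sectorI[OF \<rho> h(2)], of 0] \<rho> by (simp add: norm_mult)
    from mult_mono[OF C(2)[OF h] this] have "norm (op_smc (?kr (complex_of_real \<rho> * cis \<phi>)) (?w (complex_of_real \<rho> * cis \<phi>)))
        \<le> (C * \<rho> powr (- 1 / 4)) * (M * \<rho> powr - 1)" using C(1) by (simp add: op.norm_smc)
    also have "\<dots> = C * M * (\<rho> powr (- 1 / 4) * \<rho> powr - 1)" by simp
    also have "\<rho> powr (- 1 / 4) * \<rho> powr - 1 = \<rho> powr (- (5 / 4))" unfolding powr_add[symmetric] by simp
    finally show ?thesis .
  qed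
  have krh: "?kr holomorphic_on - \<real>\<^sub>\<le>\<^sub>0" by (rule kernel_remainder_holomorphic) (use \<alpha> t in auto)
  have dkr: "ray_decay th r (\<lambda>z. op_smc (?kr z) (?w z))"
  proof (rule ray_decayI[where e = "5 / 4" and C = "C * M"])
    show "continuous_on (closed_sector th) (\<lambda>z. op_smc (?kr z) (?w z))"
      by (intro op.smc.continuous_on continuous_on_weight
          continuous_on_subset[OF holomorphic_on_imp_continuous_on[OF krh] closed_sector_subset])
  qed (use krb in auto)
  have kr0: "op.gamma_int th r (\<lambda>z. op_smc (?kr z) (?w z)) = 0"
  proof -
    let ?a = "\<lambda>z. ?kr z * z powr (complex_of_real \<alpha> - 1)"
    have eq: "(\<lambda>z. op_smc (?kr z) (?w z)) = (\<lambda>z. op_smc (?a z) (\<Psi> z))"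
      by (simp add: weight_def op.smc_mult[symmetric])
    have "?a holomorphic_on - \<real>\<^sub>\<le>\<^sub>0" by (auto intro!: holomorphic_intros krh)
    then have "\<exists>f'. (\<forall>z\<in>closed_sector th. ((\<lambda>z. op_smc (?kr z) (?w z)) has_derivative (\<lambda>h. op_smc h (f' z))) (at z)) \<and> continuous_on (closed_sector th) f'"
      unfolding eq by (rule weighted_resolvent_derivative)
    then obtain f' where f': "\<And>z. z \<in> closed_sector th \<Longrightarrow> ((\<lambda>z. op_smc (?kr z) (?w z)) has_derivative (\<lambda>h. op_smc h (f' z))) (at z)"
      "continuous_on (closed_sector th) f'" by blast
    have e: "(1::real) < 5 / 4" by simp
    show ?thesis by (rule op.gamma_int_eq_0[OF f' r th_nonneg e krb])
  qed
  have gw: "norm (op_smc (z powr - complex_of_real \<alpha>) (?w z)) \<le> M * norm z powr (- \<alpha> - 1)" if z: "z \<in> closed_sector th" for z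
  proof -
    have "norm (op_smc (z powr - complex_of_real \<alpha>) (?w z)) = norm z powr (- \<alpha>) * norm (?w z)"
      using norm_powr_real_powr'[of "complex_of_real (- \<alpha>)" z] by (simp add: op.norm_smc)
    also have "\<dots> \<le> norm z powr (- \<alpha>) * (M * norm z powr (real 0 - 1))" by (intro mult_left_mono M z) auto
    also have "\<dots> = M * (norm z powr (- \<alpha>) * norm z powr - 1)" by simp
    also have "norm z powr (- \<alpha>) * norm z powr - 1 = norm z powr (- \<alpha> - 1)" unfolding powr_add[symmetric] by simp
    finally show ?thesis .
  qed
  have dg: "ray_decay th r ?g"
    by (rule op.exp_weight_ray_decay[OF cos_th _ gw t r])
      (intro op.smc.continuous_on continuous_on_weight continuous_on_powr_sector)
  have I3: "op.gamma_int th r (\<lambda>z. op_smc (?E z) (?w z)) = op.gamma_int th r ?g"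
  proof -
    have "op.gamma_int th r (\<lambda>z. op_smc (?E z) (?w z)) = op.gamma_int th r (\<lambda>z. ?g z - op_smc (?kr z) (?w z))"
      by (simp add: op.smc_diff_left op.smc_mult)
    also have "\<dots> = op.gamma_int th r ?g" using op.gamma_int_diff[OF dg dkr r th_nonneg] kr0 by simp
    finally show ?thesis .
  qed
  let ?f = "\<lambda>z. op_smc (exp (z * complex_of_real t)) (?w z)"
  have df: "ray_decay th r ?f" by (rule exp_weight_decay[OF t r])
  have bl: "bounded_linear (\<lambda>X. Sinv o\<^sub>L X)"
    by (rule bounded_bilinear.bounded_linear_right[OF bounded_bilinear_blinfun_compose])
  have i1: "Sinv o\<^sub>L op.gamma_int th r ?f = op.gamma_int th r (\<lambda>z. Sinv o\<^sub>L ?f z)"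
    by (rule op.gamma_int_linear[OF bl Sinv_op_smc df r th_nonneg, symmetric])
  let ?e = "\<lambda>z. exp (z * complex_of_real t) / z"
  interpret C: complex_banach "(*) :: complex \<Rightarrow> complex \<Rightarrow> complex" by (rule complex_banach_times)
  have de: "ray_decay th r ?e"
  proof -
    have c: "continuous_on (closed_sector th) (\<lambda>z. 1 / z)"
      by (intro continuous_intros) (use mem_closed_sectorD(1)[OF _ th(2)] in auto)
    have "ray_decay th r (\<lambda>z. exp (z * complex_of_real t) * (1 / z))"
      by (rule C.exp_weight_ray_decay[OF cos_th c _ t r, where C = 1 and m = "- 1"])
        (auto simp: norm_divide powr_minus_divide)
    then show ?thesis by simp
  qed
  have i2: "op.gamma_int th r (\<lambda>z. op_smc (?e z) Sinv) = op_smc (2 * pi * \<i>) Sinv"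
    using op.gamma_int_scalar[OF de r th_nonneg, of Sinv] gamma_int_exp_div[OF th t r] by simp
  have d1: "ray_decay th r (\<lambda>z. Sinv o\<^sub>L ?f z)" by (rule bounded_linear_ray_decay[OF bl df])
  have d2: "ray_decay th r (\<lambda>z. op_smc (?e z) Sinv)"
    by (rule bounded_linear_ray_decay[OF op.smc.bounded_linear_left de])
  have "op.gamma_int th r (\<lambda>z. Sinv o\<^sub>L ?f z) - op.gamma_int th r (\<lambda>z. op_smc (?e z) Sinv)
      = op.gamma_int th r (\<lambda>z. (Sinv o\<^sub>L ?f z) - op_smc (?e z) Sinv)"
    by (rule op.gamma_int_diff[OF d1 d2 r th_nonneg, symmetric])
  \<comment> \<open>Writing z^(\<alpha> - 1) as z^\<alpha> / z, \<open>Sinv_res\<close> splits the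
    integrand for S G into exp (z t) / z times S, whose contour integral is 2 pi i S, and the
    integrand of J^\<alpha> G.\<close>
  also have "\<dots> = op.gamma_int th r ?g"
  proof (rule op.gamma_int_cong[OF _ r th_nonneg])
    fix z assume z: "z \<in> closed_sector th"
    have z0: "z \<noteq> 0" by (rule mem_closed_sectorD(1)[OF z th(2)])
    have S: "op_smc (z powr complex_of_real \<alpha>) (Sinv o\<^sub>L \<Psi> z) = Sinv + \<Psi> z"
      unfolding \<Psi>_def by (rule Sinv_res) (use powr_mem_sector[OF z] sector_subset in auto)
    have "Sinv o\<^sub>L ?f z = op_smc (exp (z * complex_of_real t) * z powr (complex_of_real \<alpha> - 1)) (Sinv o\<^sub>L \<Psi> z)"
      by (simp add: weight_def Sinv_op_smc op.smc_mult)
    also have "exp (z * complex_of_real t) * z powr (complex_of_real \<alpha> - 1) = ?e z * z powr complex_of_real \<alpha>"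
      using z0 by (simp add: powr_diff)
    also have "op_smc (?e z * z powr complex_of_real \<alpha>) (Sinv o\<^sub>L \<Psi> z) = op_smc (?e z) Sinv + op_smc (?e z) (\<Psi> z)"
      unfolding op.smc_mult S op.smc_add_right ..
    also have "op_smc (?e z) (\<Psi> z) = ?g z"
      using z0 by (simp add: weight_def op.smc_mult[symmetric] powr_diff powr_minus)
    finally show "(Sinv o\<^sub>L ?f z) - op_smc (?e z) Sinv = ?g z" by simp
  qed
  finally have "(Sinv o\<^sub>L op.gamma_int th r ?f) - op_smc (2 * pi * \<i>) Sinv = op.gamma_int th r ?g"
    unfolding i1 i2 .
  from arg_cong[OF this, of "op_smc ?c"]
  have "(Sinv o\<^sub>L solop 0 t) - Sinv = op_smc ?c (op.gamma_int th r ?g)"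
    unfolding solop_radius[OF t r] by (simp add: op.smc_diff_right op.smc_mult[symmetric] Sinv_op_smc op.smc_one)
  moreover have "Sinv o\<^sub>L (solop 0 t - id_blinfun) = (Sinv o\<^sub>L solop 0 t) - Sinv"
    by (rule blinfun_eqI) (simp add: blinfun.diff_left blinfun.diff_right)
  ultimately show ?thesis using I2 unfolding I3 by simp
qed

text \<open>Evaluation at a vector is bounded and linear, hence commutes with the three integrals
  taken in operator norm.\<close>

lemma solop_eq_G_op:
  assumes t: "0 < t"
  shows "G_op smc D A \<alpha> th t a = blinfun_apply (solop 0 t) a"
proof -
  let ?f = "\<lambda>z. op_smc (exp (z * complex_of_real t)) (weight 0 z)"
  have r: "0 < 1 / t" using t by simp
  have d: "ray_decay th (1 / t) ?f" by (rule exp_weight_decay[OF t r])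
  have L: "bounded_linear (\<lambda>X :: 'x \<Rightarrow>\<^sub>L 'x. blinfun_apply X a)" by (rule blinfun.bounded_linear_left)
  have ab: "\<bar>th\<bar> = th" "\<bar>- th\<bar> = th" using th_nonneg by auto
  have "blinfun_apply (op.gamma_int th (1 / t) ?f) a = gamma_int th (1 / t) (\<lambda>z. blinfun_apply (?f z) a)"
    unfolding gamma_int_def op.gamma_int_def blinfun.add_left blinfun.minus_left op_smc_apply[symmetric]
      integral_linear[OF op.ray_decay_integrable[OF d r ab(1)] L, unfolded o_def, symmetric]
      integral_linear[OF op.ray_decay_integrable[OF d r ab(2)] L, unfolded o_def, symmetric]
      integral_linear[OF op.arc_integrable[OF d r] L, unfolded o_def, symmetric] ..
  also have "\<dots> = gamma_int th (1 / t) (G_integrand smc D A \<alpha> t a)"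
  proof (rule gamma_int_cong[OF _ r th_nonneg])
    fix z assume z: "z \<in> closed_sector th"
    have "z powr complex_of_real \<alpha> \<in> \<rho>A" using powr_mem_sector[OF z] sector_subset by auto
    then show "blinfun_apply (?f z) a = G_integrand smc D A \<alpha> t a z"
      by (simp add: op_smc_apply weight_def G_integrand_def \<Psi>_def res_apply smc_mult)
  qed
  finally show ?thesis
    unfolding G_op_def Let_def solop_def op_smc_apply gamma_int_def by simp
qed

end

section \<open>Hoelder estimates\<close>

text \<open>The constant is explicit, unlike in \<open>holder_space\<close>, so that it can be
  shared by a whole approximating sequence and traced into the final estimate. Coinciding times are
  harmless since 0 powr \<sigma> = 0.\<close>

definition holder_bound :: "real \<Rightarrow> real \<Rightarrow> real \<Rightarrow> (real \<Rightarrow> 'a::real_normed_vector) \<Rightarrow> bool" where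
  "holder_bound T \<sigma> H F \<longleftrightarrow> 0 \<le> H \<and> (\<forall>s t. 0 \<le> s \<and> s \<le> t \<and> t \<le> T \<longrightarrow> norm (F t - F s) \<le> H * (t - s) powr \<sigma>)"

lemma holder_boundD:
  assumes "holder_bound T \<sigma> H F" "0 \<le> s" "s \<le> t" "t \<le> T"
  shows "norm (F t - F s) \<le> H * (t - s) powr \<sigma>" "norm (F s - F t) \<le> H * (t - s) powr \<sigma>" "0 \<le> H"
  using assms by (auto simp: holder_bound_def norm_minus_commute)

lemma holder_bound_continuous:
  assumes F: "holder_bound T \<sigma> H F" and \<sigma>: "0 < \<sigma>" shows "continuous_on {0..T} F"
  unfolding continuous_on_def
proof
  fix x assume x: "x \<in> {0..T}"
  have "((\<lambda>y. H * \<bar>y - x\<bar> powr \<sigma>) \<longlongrightarrow> H * \<bar>x - x\<bar> powr \<sigma>) (at x within {0..T})"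
    using \<sigma> by (intro tendsto_intros tendsto_powr') auto
  then have t: "((\<lambda>y. H * \<bar>y - x\<bar> powr \<sigma>) \<longlongrightarrow> 0) (at x within {0..T})" by simp
  have "((\<lambda>y. F y - F x) \<longlongrightarrow> 0) (at x within {0..T})"
  proof (rule Lim_null_comparison[OF _ t])
    have "norm (F y - F x) \<le> H * \<bar>y - x\<bar> powr \<sigma>" if "y \<in> {0..T}" for y
      using holder_boundD(1)[OF F, of x y] holder_boundD(2)[OF F, of y x] x that by (cases "x \<le> y") auto
    then show "\<forall>\<^sub>F y in at x within {0..T}. norm (F y - F x) \<le> H * \<bar>y - x\<bar> powr \<sigma>"
      unfolding eventually_at by (intro exI[of _ 1]) auto
  qed
  then show "(F \<longlongrightarrow> F x) (at x within {0..T})" by (simp add: LIM_zero_iff)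
qed

lemma has_integral_powr_reflect_from:
  assumes "a > -1" "p \<le> (t::real)"
  shows "((\<lambda>s. (t - s) powr a) has_integral ((t - p) powr (a + 1) / (a + 1))) {p..t}"
proof -
  have "((\<lambda>s. (t - p - s) powr a) has_integral ((t - p) powr (a + 1) / (a + 1))) {0..t - p}"
    by (rule has_integral_powr_reflect) (use assms in auto)
  then have "((\<lambda>s. (t - s) powr a) \<circ> (+) p has_integral ((t - p) powr (a + 1) / (a + 1))) {0..t - p}"
    by (simp add: o_def algebra_simps)
  then show ?thesis using has_integral_shift_Icc_real[of "\<lambda>s. (t - s) powr a" p _ 0 "t - p"] by simp
qed

context sectorial
begin

lemma solop_bounds_exist:
  "\<exists>C\<ge>0. \<forall>t>0. norm (solop 0 t) \<le> C \<and> norm (solop 1 t) \<le> C / t \<and> norm (solop 2 t) \<le> C / t\<^sup>2"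
proof -
  obtain C0 C1 C2 where C: "\<forall>t>0. norm (solop 0 t) \<le> C0 * t powr (- real 0)"
    "\<forall>t>0. norm (solop 1 t) \<le> C1 * t powr (- real 1)" "\<forall>t>0. norm (solop 2 t) \<le> C2 * t powr (- real 2)"
    "0 \<le> C0" "0 \<le> C1" "0 \<le> C2"
    using solop_bound[of 0] solop_bound[of 1] solop_bound[of 2] by blast
  show ?thesis
  proof (intro exI[of _ "C0 + C1 + C2"] conjI allI impI)
    fix t :: real assume t: "0 < t"
    have "norm (solop 0 t) \<le> C0" using C(1) t by auto
    then show "norm (solop 0 t) \<le> C0 + C1 + C2" using C by linarith
    have "norm (solop 1 t) \<le> C1 * t powr (- 1)" using C(2) t by auto
    also have "\<dots> = C1 / t" using t by (simp add: powr_minus divide_inverse)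
    also have "\<dots> \<le> (C0 + C1 + C2) / t" using t C by (intro divide_right_mono) auto
    finally show "norm (solop 1 t) \<le> (C0 + C1 + C2) / t" .
    have "norm (solop 2 t) \<le> C2 * t powr (- 2)" using C(3) t by auto
    also have "\<dots> = C2 / t\<^sup>2" using t by (simp add: powr_minus divide_inverse)
    also have "\<dots> \<le> (C0 + C1 + C2) / t\<^sup>2" using t C by (intro divide_right_mono) auto
    finally show "norm (solop 2 t) \<le> (C0 + C1 + C2) / t\<^sup>2" .
  qed (use C in simp)
qed

text \<open>One constant, fixed by the operator before any F is considered, so that all later
  estimates are uniform in F.\<close>

definition solop_const :: real where
  "solop_const = (SOME C. C \<ge> 0 \<and> (\<forall>t>0. norm (solop 0 t) \<le> C \<and> norm (solop 1 t) \<le> C / t \<and> norm (solop 2 t) \<le> C / t\<^sup>2))"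

lemma solop_const_nonneg: "0 \<le> solop_const"
  and norm_solop0: "0 < t \<Longrightarrow> norm (solop 0 t) \<le> solop_const"
  and norm_solop1: "0 < t \<Longrightarrow> norm (solop 1 t) \<le> solop_const / t"
  and norm_solop2: "0 < t \<Longrightarrow> norm (solop 2 t) \<le> solop_const / t\<^sup>2"
proof -
  have "solop_const \<ge> 0 \<and> (\<forall>t>0. norm (solop 0 t) \<le> solop_const \<and> norm (solop 1 t) \<le> solop_const / t \<and> norm (solop 2 t) \<le> solop_const / t\<^sup>2)"
    unfolding solop_const_def by (rule someI_ex) (use solop_bounds_exist in blast)
  then show "0 \<le> solop_const" "0 < t \<Longrightarrow> norm (solop 0 t) \<le> solop_const"
    "0 < t \<Longrightarrow> norm (solop 1 t) \<le> solop_const / t" "0 < t \<Longrightarrow> norm (solop 2 t) \<le> solop_const / t\<^sup>2" by blast+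
qed

lemma norm_apply_le:
  assumes "norm B \<le> b" "norm x \<le> c" shows "norm (blinfun_apply B x) \<le> b * c"
proof -
  have "norm (blinfun_apply B x) \<le> norm B * norm x" by (rule norm_blinfun)
  also have "\<dots> \<le> b * c"
    using assms order_trans[OF norm_ge_zero assms(1)] by (intro mult_mono) auto
  finally show ?thesis .
qed

lemma solop_derivative': "0 < t \<Longrightarrow> (solop 0 has_vector_derivative solop 1 t) (at t)"
  "0 < t \<Longrightarrow> (solop 1 has_vector_derivative solop 2 t) (at t)"
  using solop_derivative[of t 0] solop_derivative[of t 1] by (simp_all add: numeral_2_eq_2)

lemma continuous_on_solop: "continuous_on {0<..} (solop j)"
  by (rule continuous_on_vector_derivative, rule has_vector_derivative_at_within, rule solop_derivative) simp

lemma norm_solop_diff_le: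
  assumes t: "0 < t" "t \<le> s" and B: "0 \<le> B" and bd: "\<And>x. t \<le> x \<Longrightarrow> x \<le> s \<Longrightarrow> norm (solop (Suc j) x) \<le> B"
  shows "norm (solop j s - solop j t) \<le> B * (s - t)"
proof -
  have "(solop (Suc j) has_integral solop j s - solop j t) {t..s}"
    by (rule fundamental_theorem_of_calculus[OF t(2)]) (use t in \<open>auto intro!: has_vector_derivative_at_within solop_derivative\<close>)
  from has_integral_bound_real[OF B finite.emptyI this] bd t show ?thesis by auto
qed

lemma norm_solop1_diff: "0 < t \<Longrightarrow> t \<le> s \<Longrightarrow> norm (solop 1 s - solop 1 t) \<le> solop_const / t\<^sup>2 * (s - t)"
proof (rule norm_solop_diff_le)
  fix x assume h: "0 < t" "t \<le> x"
  have "norm (solop (Suc 1) x) \<le> solop_const / x\<^sup>2" using norm_solop2[of x] h by (simp add: numeral_2_eq_2)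
  also have "\<dots> \<le> solop_const / t\<^sup>2"
    using h solop_const_nonneg by (intro divide_left_mono power_mono) auto
  finally show "norm (solop (Suc 1) x) \<le> solop_const / t\<^sup>2" .
qed (use solop_const_nonneg in auto)

lemma norm_solop0_diff: "0 < t \<Longrightarrow> t \<le> s \<Longrightarrow> norm (solop 0 s - solop 0 t) \<le> solop_const / t * (s - t)"
proof (rule norm_solop_diff_le)
  fix x assume h: "0 < t" "t \<le> x"
  have "norm (solop (Suc 0) x) \<le> solop_const / x" using norm_solop1[of x] h by simp
  also have "\<dots> \<le> solop_const / t"
    using h solop_const_nonneg by (intro divide_left_mono) auto
  finally show "norm (solop (Suc 0) x) \<le> solop_const / t" .
qed (use solop_const_nonneg in auto)

text \<open>For \<open>u = K * F\<close> this is \<open>A u + F\<close>, written so that the singularity of the kernel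
meets a Hoelder increment.\<close>

definition wop :: "(real \<Rightarrow> 'x) \<Rightarrow> real \<Rightarrow> 'x" where
  "wop F t = integral {0..t} (\<lambda>s. blinfun_apply (solop 1 (t - s)) (F s - F t)) + blinfun_apply (solop 0 t) (F t)"

lemma continuous_on_solop_apply:
  assumes "continuous_on X f" "continuous_on X \<tau>" "\<And>s. s \<in> X \<Longrightarrow> 0 < \<tau> s"
  shows "continuous_on X (\<lambda>s. blinfun_apply (solop j (\<tau> s)) (f s))"
  by (intro bounded_bilinear.continuous_on[OF bounded_bilinear_blinfun_apply] continuous_on_compose2[OF continuous_on_solop assms(2)] assms(1))
    (use assms(3) in auto)

text \<open>The bound C / (t - s) for G' meets the increment H (t - s)^\<sigma>. The majorant and
  the continuity are exported with the integrability because the passage to the limit in F uses them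
  again.\<close>

lemma solop1_increment_integrable:
  assumes F: "holder_bound T \<sigma> H F" and \<sigma>: "0 < \<sigma>" and t: "0 \<le> t" "t \<le> T"
  shows "(\<lambda>s. blinfun_apply (solop 1 (t - s)) (F s - F t)) integrable_on {0..t}"
    and "\<And>s. s \<in> {0<..<t} \<Longrightarrow> norm (blinfun_apply (solop 1 (t - s)) (F s - F t)) \<le> solop_const * H * (t - s) powr (\<sigma> - 1)"
    and "continuous_on {0<..<t} (\<lambda>s. blinfun_apply (solop 1 (t - s)) (F s - F t))"
    and "(\<lambda>s. solop_const * H * (t - s) powr (\<sigma> - 1)) integrable_on {0..t}"
proof -
  show b: "norm (blinfun_apply (solop 1 (t - s)) (F s - F t)) \<le> solop_const * H * (t - s) powr (\<sigma> - 1)" if s: "s \<in> {0<..<t}" for s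
  proof -
    have "norm (blinfun_apply (solop 1 (t - s)) (F s - F t)) \<le> (solop_const / (t - s)) * (H * (t - s) powr \<sigma>)"
      by (intro norm_apply_le norm_solop1 holder_boundD(2)[OF F]) (use s t in auto)
    also have "\<dots> = solop_const * H * (t - s) powr (\<sigma> - 1)" using s by (simp add: powr_diff)
    finally show ?thesis .
  qed
  show c: "continuous_on {0<..<t} (\<lambda>s. blinfun_apply (solop 1 (t - s)) (F s - F t))"
    by (intro continuous_on_solop_apply continuous_intros continuous_on_subset[OF holder_bound_continuous[OF F \<sigma>]]) (use t in auto)
  show g: "(\<lambda>s. solop_const * H * (t - s) powr (\<sigma> - 1)) integrable_on {0..t}"
    using has_integral_mult_right[OF has_integral_powr_reflect[of "\<sigma> - 1" t], of "solop_const * H"] \<sigma> t by auto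
  show "(\<lambda>s. blinfun_apply (solop 1 (t - s)) (F s - F t)) integrable_on {0..t}"
    by (rule integrable_dominated[OF interval_with_interior_Icc c g b])
qed

text \<open>The sum of the five pieces in \<open>wop_increment_bound\<close>: 2 / \<sigma> + 1 / (1
  - \<sigma>), then 2, 1 / \<sigma>, 1 and 2.\<close>

definition holder_const :: "real \<Rightarrow> real" where
  "holder_const \<sigma> = solop_const * (3 / \<sigma> + 1 / (1 - \<sigma>) + 5)"

lemma holder_const_nonneg: "0 < \<sigma> \<Longrightarrow> \<sigma> < 1 \<Longrightarrow> 0 \<le> holder_const \<sigma>"
  using solop_const_nonneg by (simp add: holder_const_def)

lemma wop_zero: "F 0 = 0 \<Longrightarrow> wop F 0 = 0"
  by (simp add: wop_def)

text \<open>With h = t' - t, the two singular integrals are compared on [0, t] using the same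
  increment F s - F t. Close to t each kernel is estimated by itself; farther away the bound on G''
  gains a factor h. The rest of the integral at t' runs over [t, t'], and the boundary terms G F are
  compared directly.\<close>

lemma wop_increment_bound:
  assumes F: "holder_bound T \<sigma> H F" and F0: "F 0 = 0" and \<sigma>: "0 < \<sigma>" "\<sigma> < 1"
    and t: "0 \<le> t" "t < t'" "t' \<le> T"
  shows "norm (wop F t' - wop F t) \<le> holder_const \<sigma> * H * (t' - t) powr \<sigma>"
proof -
  have H0: "0 \<le> H" using F by (simp add: holder_bound_def)
  define h where "h = t' - t"
  have h: "0 < h" using t by (simp add: h_def)
  define C where "C = solop_const"
  have C0: "0 \<le> C" using solop_const_nonneg by (simp add: C_def)
  define B where "B = C * H * h powr \<sigma>"
  have B0: "0 \<le> B" using C0 H0 by (simp add: B_def)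
  let ?k = "\<lambda>t s. blinfun_apply (solop 1 (t - s)) (F s - F t)"
  have tail: "norm (integral {p..q} (?k q)) \<le> C * H * ((q - p) powr \<sigma> / \<sigma>)" if p: "0 \<le> p" "p \<le> q" "q \<le> T" for p q
  proof -
    have i: "?k q integrable_on {p..q}"
      by (rule integrable_subinterval_real[OF solop1_increment_integrable(1)[OF F \<sigma>(1)]]) (use p in auto)
    have g: "((\<lambda>s. C * H * (q - s) powr (\<sigma> - 1)) has_integral C * H * ((q - p) powr (\<sigma> - 1 + 1) / (\<sigma> - 1 + 1))) {p..q}"
      by (intro has_integral_mult_right has_integral_powr_reflect_from) (use \<sigma> p in auto)
    have "norm (integral {p..q} (?k q)) \<le> integral {p..q} (\<lambda>s. C * H * (q - s) powr (\<sigma> - 1))"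
      by (rule integral_norm_bound_interior[OF interval_with_interior_Icc i has_integral_integrable[OF g]])
        (use solop1_increment_integrable(2)[OF F \<sigma>(1), of q] p in \<open>auto simp: C_def\<close>)
    then show ?thesis unfolding integral_unique[OF g] by simp
  qed
  have G4: "norm (blinfun_apply (solop 0 t') (F t' - F t)) \<le> B"
    unfolding B_def mult.assoc C_def h_def by (intro norm_apply_le norm_solop0 holder_boundD(1)[OF F]) (use t in auto)
  show ?thesis
  proof (cases "t = 0")
    \<comment> \<open>The start is separate because the bounds on \<open>solop\<close> hold only for
      positive times.\<close>
    case True
    have "norm (wop F t') \<le> C * H * ((t' - 0) powr \<sigma> / \<sigma>) + B"
      unfolding wop_def by (rule order_trans[OF norm_triangle_ineq add_mono]) (use tail[of 0 t'] G4 t True F0 in auto)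
    also have "\<dots> = solop_const * (1 / \<sigma> + 1) * (H * h powr \<sigma>)" using True by (simp add: B_def C_def h_def algebra_simps)
    also have "\<dots> \<le> solop_const * (3 / \<sigma> + 1 / (1 - \<sigma>) + 5) * (H * h powr \<sigma>)"
    proof (intro mult_right_mono mult_left_mono)
      have "1 / \<sigma> \<le> 3 / \<sigma>" "0 \<le> 1 / (1 - \<sigma>)" using \<sigma> by (auto simp: divide_right_mono)
      then show "1 / \<sigma> + 1 \<le> 3 / \<sigma> + 1 / (1 - \<sigma>) + 5" by linarith
    qed (use H0 solop_const_nonneg in auto)
    finally show ?thesis using wop_zero[of F] F0 True by (simp add: holder_const_def h_def mult.assoc)
  next
    case False
    then have t0: "0 < t" using t by simp
    define d where "d s = blinfun_apply (solop 1 (t' - s) - solop 1 (t - s)) (F s - F t)" for s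
    \<comment> \<open>\<open>e\<close> is the cost of replacing F t' by F t in the integral at t'.
      It is integrated exactly, to G(t') - G(h) applied to a fixed vector; estimating its norm would
      give log (t' / h).\<close>
    define e where "e s = blinfun_apply (solop 1 (t' - s)) (F t - F t')" for s
    have eI: "(e has_integral blinfun_apply (solop 0 t' - solop 0 h) (F t - F t')) {0..t}"
    proof -
      have "((\<lambda>s. blinfun_apply (- solop 0 (t' - s)) (F t - F t')) has_vector_derivative e s) (at s within {0..t})" if "s \<in> {0..t}" for s
      proof -
        have d1: "((\<lambda>s. t' - s) has_vector_derivative - 1) (at s within {0..t})"
          by (auto simp: has_vector_derivative_def intro!: derivative_eq_intros)
        have "(solop 0 has_vector_derivative solop 1 (t' - s)) (at (t' - s) within (\<lambda>s. t' - s) ` {0..t})"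
          by (rule has_vector_derivative_at_within, rule solop_derivative'(1)) (use that t in auto)
        from vector_diff_chain_within[OF d1 this]
        have "((\<lambda>s. solop 0 (t' - s)) has_vector_derivative - solop 1 (t' - s)) (at s within {0..t})" by (simp add: o_def)
        from bounded_linear.has_vector_derivative[OF blinfun.bounded_linear_left has_vector_derivative_minus[OF this]]
        show ?thesis by (simp add: e_def)
      qed
      then have "(e has_integral blinfun_apply (- solop 0 (t' - t)) (F t - F t') - blinfun_apply (- solop 0 (t' - 0)) (F t - F t')) {0..t}"
        using t by (intro fundamental_theorem_of_calculus) auto
      then show ?thesis by (simp add: h_def blinfun.minus_left blinfun.diff_left)
    qed
    have ki': "?k t' integrable_on {0..t'}"
      by (rule solop1_increment_integrable(1)[OF F \<sigma>(1)]) (use t in auto)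
    have ki: "?k t integrable_on {0..t}"
      by (rule solop1_increment_integrable(1)[OF F \<sigma>(1)]) (use t in auto)
    have ki0: "?k t' integrable_on {0..t}" by (rule integrable_subinterval_real[OF ki']) (use t in auto)
    have dk: "d s = ?k t' s - ?k t s - e s" for s
      by (simp add: d_def e_def blinfun.diff_left blinfun.diff_right algebra_simps)
    have dI: "(d has_integral (integral {0..t} (?k t') - integral {0..t} (?k t) - blinfun_apply (solop 0 t' - solop 0 h) (F t - F t'))) {0..t}"
      by (rule has_integral_eq[OF dk[symmetric]])
        (intro has_integral_diff integrable_integral ki0 ki eI)
    note di = has_integral_integrable[OF dI] and d_int = integral_unique[OF dI]
    have split: "integral {0..t} (?k t') + integral {t..t'} (?k t') = integral {0..t'} (?k t')"
      by (rule Henstock_Kurzweil_Integration.integral_combine[OF _ _ ki']) (use t in auto)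
    have D: "wop F t' - wop F t = integral {0..t} d + blinfun_apply (solop 0 t' - solop 0 h) (F t - F t')
        + integral {t..t'} (?k t') + blinfun_apply (solop 0 t') (F t' - F t) + blinfun_apply (solop 0 t' - solop 0 t) (F t)"
    proof -
      have alg: "(p + q + b) - (u + v) = (p - u - w) + w + q + (b - c) + (c - v)" for p q u v b c w :: 'x
        by simp
      show ?thesis
        unfolding d_int wop_def split[symmetric] alg[of _ _ _ _ _ "blinfun_apply (solop 0 t' - solop 0 h) (F t - F t')" "blinfun_apply (solop 0 t') (F t)"]
        by (simp only: blinfun.diff_left blinfun.diff_right)
    qed
    have G2: "norm (blinfun_apply (solop 0 t' - solop 0 h) (F t - F t')) \<le> 2 * B"
    proof -
      have "norm (solop 0 t' - solop 0 h) \<le> C + C"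
        unfolding C_def by (rule order_trans[OF norm_triangle_ineq4 add_mono[OF norm_solop0 norm_solop0]]) (use t h in auto)
      moreover have "norm (F t - F t') \<le> H * h powr \<sigma>" unfolding h_def by (rule holder_boundD(2)[OF F]) (use t in auto)
      ultimately have "norm (blinfun_apply (solop 0 t' - solop 0 h) (F t - F t')) \<le> (C + C) * (H * h powr \<sigma>)"
        by (rule norm_apply_le)
      then show ?thesis by (simp add: B_def algebra_simps)
    qed
    have G3: "norm (integral {t..t'} (?k t')) \<le> B / \<sigma>"
      using tail[of t t'] t by (simp add: B_def h_def)
    have Ft: "norm (F t) \<le> H * t powr \<sigma>" using holder_boundD(1)[OF F, of 0 t] F0 t by simp
    \<comment> \<open>F 0 = 0 enters here through norm (F t) \<le> H t^\<sigma>. For t \<le> h this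
      already suffices with bounded G; for t > h the difference of G is at most C h / t, and h
      t^(\<sigma> - 1) \<le> h^\<sigma>.\<close>
    have G5: "norm (blinfun_apply (solop 0 t' - solop 0 t) (F t)) \<le> 2 * B"
    proof (cases "t \<le> h")
      case True
      have "norm (solop 0 t' - solop 0 t) \<le> C + C"
        unfolding C_def by (rule order_trans[OF norm_triangle_ineq4 add_mono[OF norm_solop0 norm_solop0]]) (use t t0 in auto)
      then have "norm (blinfun_apply (solop 0 t' - solop 0 t) (F t)) \<le> (C + C) * (H * t powr \<sigma>)" by (rule norm_apply_le[OF _ Ft])
      also have "\<dots> \<le> (C + C) * (H * h powr \<sigma>)"
        using True t \<sigma> C0 H0 by (intro mult_left_mono powr_mono2) auto
      finally show ?thesis by (simp add: B_def algebra_simps)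
    next
      case False
      have "norm (solop 0 t' - solop 0 t) \<le> C / t * h"
        unfolding C_def h_def by (rule norm_solop0_diff) (use t t0 in auto)
      then have "norm (blinfun_apply (solop 0 t' - solop 0 t) (F t)) \<le> (C / t * h) * (H * t powr \<sigma>)" by (rule norm_apply_le[OF _ Ft])
      also have "\<dots> = C * H * (h * t powr (\<sigma> - 1))" using t0 by (simp add: powr_diff)
      also have "\<dots> \<le> C * H * (h * h powr (\<sigma> - 1))"
        using False h \<sigma> C0 H0 by (intro mult_left_mono powr_mono2') auto
      also have "\<dots> = B" using h by (simp add: B_def powr_mult_base)
      finally show ?thesis using B0 by linarith
    qed
    have G1: "norm (integral {0..t} d) \<le> B * (2 / \<sigma> + 1 / (1 - \<sigma>))"
    proof -
      \<comment> \<open>The border at distance h from t, or 0 if t < h. On [p, t] both kernels are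
        of size 1 / (t - s) and give h^\<sigma> / \<sigma>; on [0, p] the difference is at most C h
        / (t - s)^2, and integrating h (t - s)^(\<sigma> - 2) gives h^\<sigma> / (1 -
        \<sigma>).\<close>
      define p where "p = max 0 (t - h)"
      have p: "0 \<le> p" "p \<le> t" "t - p \<le> h" using t0 h by (auto simp: p_def)
      have inc: "norm (F s - F t) \<le> H * (t - s) powr \<sigma>" if "s \<in> {0<..<t}" for s
        by (rule holder_boundD(2)[OF F]) (use that t in auto)
      have dp: "d integrable_on {0..p}" "d integrable_on {p..t}"
        using integrable_subinterval_real[OF di] p by auto
      have "integral {0..t} d = integral {0..p} d + integral {p..t} d"
        by (rule Henstock_Kurzweil_Integration.integral_combine[OF p(1,2) di, symmetric])
      moreover have "norm (integral {p..t} d) \<le> B * (2 / \<sigma>)"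
      proof -
        have g: "((\<lambda>s. 2 * C * H * (t - s) powr (\<sigma> - 1)) has_integral 2 * C * H * ((t - p) powr (\<sigma> - 1 + 1) / (\<sigma> - 1 + 1))) {p..t}"
          by (intro has_integral_mult_right has_integral_powr_reflect_from) (use \<sigma> p in auto)
        have "norm (integral {p..t} d) \<le> integral {p..t} (\<lambda>s. 2 * C * H * (t - s) powr (\<sigma> - 1))"
        proof (rule integral_norm_bound_interior[OF interval_with_interior_Icc dp(2) has_integral_integrable[OF g]])
          fix s assume s: "s \<in> {p<..<t}"
          have "C / (t' - s) \<le> C / (t - s)" using s t C0 by (intro divide_left_mono) auto
          then have "norm (solop 1 (t' - s) - solop 1 (t - s)) \<le> 2 * C / (t - s)"
            using norm_triangle_ineq4[of "solop 1 (t' - s)" "solop 1 (t - s)"] norm_solop1[of "t' - s"] norm_solop1[of "t - s"] s t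
            by (auto simp: C_def)
          from norm_apply_le[OF this inc] have "norm (d s) \<le> 2 * C / (t - s) * (H * (t - s) powr \<sigma>)"
            using s p by (auto simp: d_def)
          also have "\<dots> = 2 * C * H * (t - s) powr (\<sigma> - 1)" using s by (simp add: powr_diff)
          finally show "norm (d s) \<le> 2 * C * H * (t - s) powr (\<sigma> - 1)" .
        qed
        also have "\<dots> = 2 * C * H * (t - p) powr \<sigma> / \<sigma>" unfolding integral_unique[OF g] by simp
        also have "\<dots> \<le> 2 * C * H * h powr \<sigma> / \<sigma>"
          using p C0 H0 \<sigma> by (intro divide_right_mono mult_left_mono powr_mono2) auto
        finally show ?thesis by (simp add: B_def mult_ac)
      qed
      moreover have "norm (integral {0..p} d) \<le> B * (1 / (1 - \<sigma>))"
      proof (cases "p = 0")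
        case True
        then show ?thesis using B0 \<sigma> by simp
      next
        case False
        then have ph: "p = t - h" "0 < p" by (auto simp: p_def)
        let ?P = "\<lambda>s. (t - s) powr (\<sigma> - 1) / (1 - \<sigma>)"
        have "((\<lambda>s. (t - s) powr (\<sigma> - 2)) has_integral ?P p - ?P 0) {0..p}"
        proof (rule fundamental_theorem_of_calculus[OF p(1)])
          fix s assume "s \<in> {0..p}"
          then have s: "0 < t - s" using ph h by simp
          have "(?P has_real_derivative (\<sigma> - 1) * (t - s) powr (\<sigma> - 1 - 1) * (- 1) / (1 - \<sigma>)) (at s within {0..p})"
            using s \<sigma>(2) by (auto intro!: derivative_eq_intros)
          also have "(\<sigma> - 1) * (t - s) powr (\<sigma> - 1 - 1) * (- 1) / (1 - \<sigma>) = (t - s) powr (\<sigma> - 2)"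
          proof -
            have "1 - \<sigma> \<noteq> 0" using \<sigma>(2) by linarith
            then show ?thesis by (simp add: divide_eq_eq algebra_simps)
          qed
          finally show "(?P has_vector_derivative (t - s) powr (\<sigma> - 2)) (at s within {0..p})"
            by (simp add: has_real_derivative_iff_has_vector_derivative)
        qed
        from has_integral_mult_right[OF this, of "C * H * h"]
        have g: "((\<lambda>s. C * H * h * (t - s) powr (\<sigma> - 2)) has_integral C * H * h * (?P p - ?P 0)) {0..p}" .
        have "norm (integral {0..p} d) \<le> integral {0..p} (\<lambda>s. C * H * h * (t - s) powr (\<sigma> - 2))"
        proof (rule integral_norm_bound_interior[OF interval_with_interior_Icc dp(1) has_integral_integrable[OF g]])
          fix s assume s: "s \<in> {0<..<p}"
          then have ts: "0 < t - s" using p by simp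
          have "norm (solop 1 (t' - s) - solop 1 (t - s)) \<le> C / (t - s)\<^sup>2 * ((t' - s) - (t - s))"
            unfolding C_def by (rule norm_solop1_diff) (use ts t in auto)
          then have "norm (solop 1 (t' - s) - solop 1 (t - s)) \<le> C / (t - s)\<^sup>2 * h" by (simp add: h_def)
          from norm_apply_le[OF this inc] have "norm (d s) \<le> C / (t - s)\<^sup>2 * h * (H * (t - s) powr \<sigma>)"
            using s p by (auto simp: d_def)
          also have "\<dots> = C * H * h * (t - s) powr (\<sigma> - 2)" using ts by (simp add: powr_diff)
          finally show "norm (d s) \<le> C * H * h * (t - s) powr (\<sigma> - 2)" .
        qed
        also have "\<dots> = C * H * h * (?P p - ?P 0)" by (rule integral_unique[OF g])
        also have "\<dots> \<le> C * H * h * ?P p" using C0 H0 h \<sigma> by (intro mult_left_mono) auto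
        also have "\<dots> = C * H * (h * h powr (\<sigma> - 1)) / (1 - \<sigma>)" by (simp add: ph)
        also have "h * h powr (\<sigma> - 1) = h powr \<sigma>" using h by (simp add: powr_mult_base)
        finally show ?thesis by (simp add: B_def mult_ac)
      qed
      ultimately show ?thesis
        using norm_triangle_ineq[of "integral {0..p} d" "integral {p..t} d"] by (simp add: algebra_simps)
    qed
    have tri: "norm (a1 + a2 + a3 + a4 + a5) \<le> norm a1 + norm a2 + norm a3 + norm a4 + norm a5" for a1 a2 a3 a4 a5 :: 'x
      by (intro norm_triangle_le add_mono order_refl)
    have "norm (wop F t' - wop F t) \<le> B * (2 / \<sigma> + 1 / (1 - \<sigma>)) + 2 * B + B / \<sigma> + B + 2 * B"
      unfolding D by (rule order_trans[OF tri]) (intro add_mono G1 G2 G3 G4 G5)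
    also have "\<dots> = holder_const \<sigma> * H * (t' - t) powr \<sigma>"
      by (simp add: B_def C_def holder_const_def h_def algebra_simps add_divide_distrib)
    finally show ?thesis .
  qed
qed

lemma wop_holder_bound:
  assumes "holder_bound T \<sigma> H F" "F 0 = 0" "0 < \<sigma>" "\<sigma> < 1"
  shows "holder_bound T \<sigma> (holder_const \<sigma> * H) (wop F)"
  unfolding holder_bound_def
proof (intro conjI allI impI)
  show "0 \<le> holder_const \<sigma> * H" using assms holder_const_nonneg by (simp add: holder_bound_def)
  fix s t assume h: "0 \<le> s \<and> s \<le> t \<and> t \<le> T"
  show "norm (wop F t - wop F s) \<le> holder_const \<sigma> * H * (t - s) powr \<sigma>"
    using wop_increment_bound[OF assms, of s t] h by (cases "s = t") auto
qed

end

text \<open>Averages over the backward windows [t - 1/(n + 1), t]. Averaging translates does not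
  increase the Hoelder constant, the derivative is a difference quotient of F, and looking backwards
  keeps the value 0 at time 0.\<close>

lemma steklov_approximation:
  fixes F :: "real \<Rightarrow> 'a::banach"
  assumes F: "holder_bound T \<sigma> H F" and F0: "F 0 = 0" and \<sigma>: "0 < \<sigma>" and T: "0 \<le> T"
  obtains Fn fn where "\<And>n. holder_bound T \<sigma> H (Fn n)" "\<And>n. Fn n 0 = (0::'a)"
    "\<And>n. continuous_on UNIV (fn n)" "\<And>n s. (Fn n has_vector_derivative fn n s) (at s)"
    "\<And>t. t \<in> {0..T} \<Longrightarrow> (\<lambda>n::nat. Fn n t) \<longlonglongrightarrow> F t"
proof -
  have H0: "0 \<le> H" using F by (simp add: holder_bound_def)
  \<comment> \<open>F is extended by its boundary values. Clamping the time is nonexpansive, so the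
    Hoelder constant survives, and left of 0 the extension is F 0 = 0.\<close>
  define Fx where "Fx s = F (max 0 (min s T))" for s
  have Fxle: "norm (Fx t - Fx s) \<le> H * (t - s) powr \<sigma>" if "s \<le> t" for s t
  proof -
    have "norm (Fx t - Fx s) \<le> H * (max 0 (min t T) - max 0 (min s T)) powr \<sigma>"
      unfolding Fx_def by (rule holder_boundD(1)[OF F]) (use that T in auto)
    also have "\<dots> \<le> H * (t - s) powr \<sigma>"
      using that T \<sigma> H0 by (intro mult_left_mono powr_mono2) auto
    finally show ?thesis .
  qed
  have Fxc: "continuous_on X Fx" for X
    unfolding Fx_def using T
    by (intro continuous_on_compose2[OF holder_bound_continuous[OF F \<sigma>]] continuous_intros) auto
  have Fxi: "Fx integrable_on {a..b}" for a b by (rule integrable_continuous_interval[OF Fxc])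
  define e :: "nat \<Rightarrow> real" where "e n = 1 / real (Suc n)" for n
  have e: "0 < e n" for n by (simp add: e_def)
  define Fn where "Fn n t = (1 / e n) *\<^sub>R integral {- e n..0} (\<lambda>x. Fx (t + x))" for n t
  define fn where "fn n t = (1 / e n) *\<^sub>R (Fx t - Fx (t - e n))" for n t
  have sc: "continuous_on X (\<lambda>x. Fx (t + x))" for t X
    by (rule continuous_on_compose2[OF Fxc[of UNIV]]) (auto intro!: continuous_intros)
  have si: "(\<lambda>x. Fx (t + x)) integrable_on {a..b}" for t a b by (rule integrable_continuous_interval[OF sc])
  show ?thesis
  proof (rule that)
    fix n
    show "holder_bound T \<sigma> H (Fn n)"
      unfolding holder_bound_def
    proof (intro conjI allI impI H0)
      fix s t assume st: "0 \<le> s \<and> s \<le> t \<and> t \<le> T"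
      have "norm (integral {- e n..0} (\<lambda>x. Fx (t + x) - Fx (s + x))) \<le> H * (t - s) powr \<sigma> * (0 - - e n)"
      proof (rule integral_bound)
        show "continuous_on {- e n..0} (\<lambda>x. Fx (t + x) - Fx (s + x))" by (intro continuous_intros sc)
        show "norm (Fx (t + x) - Fx (s + x)) \<le> H * (t - s) powr \<sigma>" for x using Fxle[of "s + x" "t + x"] st by simp
      qed (use e[of n] in simp)
      moreover have "Fn n t - Fn n s = (1 / e n) *\<^sub>R integral {- e n..0} (\<lambda>x. Fx (t + x) - Fx (s + x))"
        unfolding Fn_def integral_diff[OF si si] by (simp add: scaleR_diff_right)
      ultimately show "norm (Fn n t - Fn n s) \<le> H * (t - s) powr \<sigma>" using e[of n] by (simp add: field_simps)
    qed
    have "integral {- e n..0} (\<lambda>x. Fx (0 + x)) = integral {- e n..0} (\<lambda>x. 0)"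
      by (rule Henstock_Kurzweil_Integration.integral_cong) (use F0 T in \<open>auto simp: Fx_def min_def max_def\<close>)
    then show "Fn n 0 = 0" by (simp add: Fn_def)
    show "continuous_on UNIV (fn n)"
      unfolding fn_def[abs_def]
      by (intro continuous_intros Fxc continuous_on_compose2[OF Fxc[of UNIV]]) auto
    fix s
    \<comment> \<open>The fixed window with a translated integrand suits the Hoelder bound. For the
      derivative the average is rewritten as a difference of a primitive \<open>P\<close>, based far
      enough to the left to be differentiable at both s and s - e n.\<close>
    define a where "a = s - e n - 1"
    define P where "P y = integral {a..y} Fx" for y
    have P: "(P has_vector_derivative Fx y) (at y)" if "a < y" for y
    proof -
      have "(P has_vector_derivative Fx y) (at y within {a..y + 1})"
        unfolding P_def[abs_def] by (rule integral_has_vector_derivative[OF Fxc]) (use that in auto)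
      then show ?thesis using that by (simp add: at_within_Icc_at)
    qed
    have d: "((\<lambda>t. t - e n) has_vector_derivative 1) (at s)"
      by (auto simp: has_vector_derivative_def intro!: derivative_eq_intros)
    have P2: "(P has_vector_derivative Fx (s - e n)) (at (s - e n))" by (rule P) (simp add: a_def)
    have "((\<lambda>t. P (t - e n)) has_vector_derivative Fx (s - e n)) (at s)"
      using vector_diff_chain_at[OF d P2] by (simp add: o_def)
    then have "((\<lambda>t. P t - P (t - e n)) has_vector_derivative Fx s - Fx (s - e n)) (at s)"
      by (intro has_vector_derivative_diff P) (use e[of n] in \<open>simp add: a_def\<close>)
    from bounded_linear.has_vector_derivative[OF bounded_linear_scaleR_right[of "1 / e n"] this]
    have "((\<lambda>t. (1 / e n) *\<^sub>R (P t - P (t - e n))) has_vector_derivative fn n s) (at s)"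
      by (simp add: fn_def)
    then show "(Fn n has_vector_derivative fn n s) (at s)"
    proof (rule has_vector_derivative_transform_within_open[where S = "{s - 1<..}"])
      fix t assume "t \<in> {s - 1<..}"
      then have t: "a \<le> t - e n" by (simp add: a_def)
      have "integral {a..t - e n} Fx + integral {t - e n..t} Fx = integral {a..t} Fx"
        by (rule Henstock_Kurzweil_Integration.integral_combine[OF t _ Fxi]) (use e[of n] in simp)
      then have "P t - P (t - e n) = integral {t - e n..t} Fx" unfolding P_def by (metis add_diff_cancel_left')
      also have "\<dots> = integral {- e n..0} (\<lambda>x. Fx (t + x))"
        using has_integral_shift_Icc_real[of Fx t _ "- e n" 0] integrable_integral[OF Fxi[of "t - e n" t]]
        by (intro integral_unique[symmetric]) (simp add: o_def add.commute)
      finally show "(1 / e n) *\<^sub>R (P t - P (t - e n)) = Fn n t" by (simp add: Fn_def)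
    qed auto
  next
    fix t assume t: "t \<in> {0..T}"
    have "(\<lambda>n. H * e n powr \<sigma>) \<longlonglongrightarrow> H * 0 powr \<sigma>"
      unfolding e_def using \<sigma> by (intro tendsto_intros tendsto_powr' LIMSEQ_Suc[OF lim_1_over_n]) auto
    then have lim: "(\<lambda>n. H * e n powr \<sigma>) \<longlonglongrightarrow> 0" by simp
    have "(\<lambda>n. Fn n t - F t) \<longlonglongrightarrow> 0"
    proof (rule Lim_null_comparison[OF always_eventually lim], rule allI)
      fix n
      have "norm (integral {- e n..0} (\<lambda>x. Fx (t + x) - Fx t)) \<le> H * e n powr \<sigma> * (0 - - e n)"
      proof (rule integral_bound)
        show "continuous_on {- e n..0} (\<lambda>x. Fx (t + x) - Fx t)" by (intro continuous_intros sc)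
        fix x assume x: "x \<in> {- e n..0}"
        have "norm (Fx (t + x) - Fx t) \<le> H * (t - (t + x)) powr \<sigma>" using Fxle[of "t + x" t] x by (simp add: norm_minus_commute)
        also have "\<dots> \<le> H * e n powr \<sigma>" using x H0 \<sigma> by (intro mult_left_mono powr_mono2) auto
        finally show "norm (Fx (t + x) - Fx t) \<le> H * e n powr \<sigma>" .
      qed (use e[of n] in simp)
      moreover have "Fn n t - Fx t = (1 / e n) *\<^sub>R integral {- e n..0} (\<lambda>x. Fx (t + x) - Fx t)"
      proof -
        have "integral {- e n..0} (\<lambda>x. Fx (t + x) - Fx t) = integral {- e n..0} (\<lambda>x. Fx (t + x)) - e n *\<^sub>R Fx t"
          using e[of n] by (subst integral_diff[OF si]) (auto simp: integral_const_real)
        then show ?thesis using e[of n] by (simp add: Fn_def scaleR_diff_right)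
      qed
      moreover have "Fx t = F t" using t by (simp add: Fx_def)
      ultimately show "norm (Fn n t - F t) \<le> H * e n powr \<sigma>" using e[of n] by (simp add: field_simps)
    qed
    then show "(\<lambda>n. Fn n t) \<longlonglongrightarrow> F t" by (simp add: LIM_zero_iff)
  qed
qed

section \<open>The inhomogeneous equation\<close>

context sectorial
begin

text \<open>By \<open>solop_frac_int\<close> this is J^\<alpha> G, the primitive of the kernel
  K.\<close>

definition Vop :: "real \<Rightarrow> 'x \<Rightarrow>\<^sub>L 'x" where "Vop t = Sinv o\<^sub>L (solop 0 t - id_blinfun)"

lemma Gamma_pos: "0 < Gamma \<alpha>" by (rule Gamma_real_pos) (use \<alpha> in simp)

lemma frac_int_Vop:
  assumes t: "0 < t"
  shows "((\<lambda>s. ((t - s) powr (\<alpha> - 1) / Gamma \<alpha>) *\<^sub>R blinfun_apply (solop 0 s) a) has_integral blinfun_apply (Vop t) a) {0..t}"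
  using has_integral_linear[OF solop_frac_int[OF t] blinfun.bounded_linear_left[of a]]
  by (simp add: o_def Vop_def blinfun.scaleR_left)

lemma frac_int_G_op:
  assumes t: "0 < t"
  shows "frac_int \<alpha> (\<lambda>s. G_op smc D A \<alpha> th s a) t = blinfun_apply (Vop t) a"
  unfolding frac_int_def
  by (rule integral_unique, rule has_integral_spike[OF negligible_sing[of 0] _ frac_int_Vop[OF t]])
    (auto simp: solop_eq_G_op)

lemma Vop_derivative: "0 < t \<Longrightarrow> (Vop has_vector_derivative Sinv o\<^sub>L solop 1 t) (at t)"
proof -
  assume t: "0 < t"
  have "((\<lambda>t. solop 0 t - id_blinfun) has_vector_derivative solop 1 t - 0) (at t)"
    by (intro has_vector_derivative_diff has_vector_derivative_const solop_derivative'(1) t)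
  from bounded_linear.has_vector_derivative[OF bounded_bilinear.bounded_linear_right[OF bounded_bilinear_blinfun_compose, of Sinv] this]
  show ?thesis unfolding Vop_def[abs_def] by simp
qed

lemma K_op_eq:
  assumes t: "0 < t"
  shows "K_op smc D A \<alpha> th t a = blinfun_apply Sinv (blinfun_apply (solop 1 t) a)"
proof -
  have "((\<lambda>\<tau>. blinfun_apply (Vop \<tau>) a) has_vector_derivative blinfun_apply (Sinv o\<^sub>L solop 1 t) a) (at t)"
    by (rule bounded_linear.has_vector_derivative[OF blinfun.bounded_linear_left Vop_derivative[OF t]])
  then have "((\<lambda>\<tau>. frac_int \<alpha> (\<lambda>s. G_op smc D A \<alpha> th s a) \<tau>) has_vector_derivative blinfun_apply (Sinv o\<^sub>L solop 1 t) a) (at t)"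
    by (rule has_vector_derivative_transform_within_open[where S = "{0<..}"]) (use t in \<open>auto simp: frac_int_G_op\<close>)
  then show ?thesis unfolding K_op_def by (simp add: vector_derivative_at)
qed

text \<open>The form S (G - I) shows only boundedness. The representation as a fractional integral
  of the bounded G gives the rate t^\<alpha> at 0, which makes V the primitive of K up to the
  singular endpoint.\<close>

lemma norm_Vop_apply_le:
  assumes t: "0 < t"
  shows "norm (blinfun_apply (Vop t) a) \<le> solop_const * norm a / (Gamma \<alpha> * \<alpha>) * t powr \<alpha>"
proof -
  have g: "((\<lambda>s. (solop_const * norm a / Gamma \<alpha>) * (t - s) powr (\<alpha> - 1)) has_integral (solop_const * norm a / Gamma \<alpha>) * (t powr (\<alpha> - 1 + 1) / (\<alpha> - 1 + 1))) {0..t}"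
    by (intro has_integral_mult_right has_integral_powr_reflect) (use \<alpha> t in auto)
  have "norm (integral {0..t} (\<lambda>s. ((t - s) powr (\<alpha> - 1) / Gamma \<alpha>) *\<^sub>R blinfun_apply (solop 0 s) a)) \<le> integral {0..t} (\<lambda>s. (solop_const * norm a / Gamma \<alpha>) * (t - s) powr (\<alpha> - 1))"
  proof (rule integral_norm_bound_interior[OF interval_with_interior_Icc has_integral_integrable[OF frac_int_Vop[OF t]] has_integral_integrable[OF g]])
    fix s assume s: "s \<in> {0<..<t}"
    have "norm (blinfun_apply (solop 0 s) a) \<le> solop_const * norm a"
      by (rule norm_apply_le[OF norm_solop0 order_refl]) (use s in simp)
    from mult_left_mono[OF this, of "(t - s) powr (\<alpha> - 1) / Gamma \<alpha>"] Gamma_pos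
    show "norm (((t - s) powr (\<alpha> - 1) / Gamma \<alpha>) *\<^sub>R blinfun_apply (solop 0 s) a) \<le> (solop_const * norm a / Gamma \<alpha>) * (t - s) powr (\<alpha> - 1)"
      by (simp add: mult_ac)
  qed
  then show ?thesis unfolding integral_unique[OF frac_int_Vop[OF t]] integral_unique[OF g] by (simp add: mult_ac)
qed

text \<open>The bound extends \<phi> continuously by 0 to s = t, so the fundamental theorem with
  interior derivatives applies although the integrand may be singular there.\<close>

lemma has_integral_vanishing_end:
  fixes \<phi> :: "real \<Rightarrow> 'b::banach"
  assumes t: "0 < t" and d: "\<And>s. s \<in> {0<..<t} \<Longrightarrow> (\<phi> has_vector_derivative f s) (at s)"
    and c: "continuous_on {0..<t} \<phi>"
    and b: "\<And>s. s \<in> {0..<t} \<Longrightarrow> norm (\<phi> s) \<le> C * (t - s) powr e" and e: "0 < e"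
  shows "(f has_integral - \<phi> 0) {0..t}"
proof -
  define \<psi> where "\<psi> s = (if s < t then \<phi> s else 0)" for s
  have "continuous_on {0..t} \<psi>"
    unfolding continuous_on_def
  proof
    fix x assume x: "x \<in> {0..t}"
    show "(\<psi> \<longlongrightarrow> \<psi> x) (at x within {0..t})"
    proof (cases "x = t")
      case True
      have "((\<lambda>s. C * (t - s) powr e) \<longlongrightarrow> C * (t - t) powr e) (at t within {0..t})"
        using e by (intro tendsto_intros tendsto_powr') (auto simp: eventually_at intro!: exI[of _ 1])
      then have l: "((\<lambda>s. C * (t - s) powr e) \<longlongrightarrow> 0) (at t within {0..t})" by simp
      have "(\<psi> \<longlongrightarrow> 0) (at t within {0..t})"
        by (rule Lim_null_comparison[OF _ l]) (use b in \<open>auto simp: eventually_at \<psi>_def intro!: exI[of _ 1]\<close>)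
      then show ?thesis using True by (simp add: \<psi>_def)
    next
      case False
      then have xt: "x < t" using x by simp
      have "(\<phi> \<longlongrightarrow> \<phi> x) (at x within {0..<t})" using c x xt unfolding continuous_on_def by auto
      moreover have "at x within {0..<t} = at x within {0..t}"
        by (rule at_within_nhd[where S = "{..<t}"]) (use xt in auto)
      ultimately have "(\<phi> \<longlongrightarrow> \<phi> x) (at x within {0..t})" by simp
      then have "(\<psi> \<longlongrightarrow> \<phi> x) (at x within {0..t})"
      proof (rule Lim_transform_eventually)
        show "\<forall>\<^sub>F y in at x within {0..t}. \<phi> y = \<psi> y"
          unfolding eventually_at by (intro exI[of _ "t - x"]) (use xt in \<open>auto simp: \<psi>_def dist_real_def\<close>)
      qed
      then show ?thesis using xt by (simp add: \<psi>_def)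
    qed
  qed
  then have "(f has_integral \<psi> t - \<psi> 0) {0..t}"
  proof (rule fundamental_theorem_of_calculus_interior[rotated])
    fix s assume s: "s \<in> {0<..<t}"
    show "(\<psi> has_vector_derivative f s) (at s)"
      by (rule has_vector_derivative_transform_within_open[OF d[OF s], where S = "{0<..<t}"]) (use s in \<open>auto simp: \<psi>_def\<close>)
  qed (use t in simp)
  then show ?thesis using t by (simp add: \<psi>_def)
qed

lemma reflected_derivative:
  assumes "(B has_vector_derivative B') (at (t - s))"
  shows "((\<lambda>s. B (t - s)) has_vector_derivative - B') (at s)"
proof -
  have "((\<lambda>s. t - s) has_vector_derivative - 1) (at s)"
    by (auto simp: has_vector_derivative_def intro!: derivative_eq_intros)
  from vector_diff_chain_at[OF this assms] show ?thesis by (simp add: o_def)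
qed

text \<open>Split F s into F s - F t and F t. The first part converges absolutely by the Hoelder
  increment; the second integrates exactly to V(t) F t = S (G(t) - I) F t, which combines with the
  first into S (w - F).\<close>

lemma K_convolution:
  assumes F: "holder_bound T \<sigma> H F" and \<sigma>: "0 < \<sigma>" and t: "0 < t" "t \<le> T"
  shows "((\<lambda>s. K_op smc D A \<alpha> th (t - s) (F s)) has_integral blinfun_apply Sinv (wop F t - F t)) {0..t}"
proof -
  define a where "a = F t"
  let ?S = "blinfun_apply Sinv"
  have 1: "((\<lambda>s. ?S (blinfun_apply (solop 1 (t - s)) (F s - F t))) has_integral
      ?S (integral {0..t} (\<lambda>s. blinfun_apply (solop 1 (t - s)) (F s - F t)))) {0..t}"
    using has_integral_linear[OF integrable_integral[OF solop1_increment_integrable(1)[OF F \<sigma>]] blinfun.bounded_linear_right[of Sinv]] t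
    by (simp add: o_def)
  let ?\<phi> = "\<lambda>s. - blinfun_apply (Vop (t - s)) a"
  have der: "(?\<phi> has_vector_derivative ?S (blinfun_apply (solop 1 (t - s)) a)) (at s)" if "s < t" for s
  proof -
    have "(Vop has_vector_derivative Sinv o\<^sub>L solop 1 (t - s)) (at (t - s))" by (rule Vop_derivative) (use that in simp)
    from has_vector_derivative_minus[OF bounded_linear.has_vector_derivative[OF blinfun.bounded_linear_left[of a] reflected_derivative[OF this]]]
    show ?thesis by (simp add: blinfun.minus_left)
  qed
  have 2: "((\<lambda>s. ?S (blinfun_apply (solop 1 (t - s)) a)) has_integral - ?\<phi> 0) {0..t}"
  proof (rule has_integral_vanishing_end[OF t(1) _ _ _ \<alpha>(1)])
    show "continuous_on {0..<t} ?\<phi>"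
      by (rule continuous_on_vector_derivative, rule has_vector_derivative_at_within, rule der) simp
    show "norm (?\<phi> s) \<le> solop_const * norm a / (Gamma \<alpha> * \<alpha>) * (t - s) powr \<alpha>" if "s \<in> {0..<t}" for s
      using norm_Vop_apply_le[of "t - s" a] that by simp
  qed (rule der, simp)
  have "((\<lambda>s. ?S (blinfun_apply (solop 1 (t - s)) (F s - F t)) + ?S (blinfun_apply (solop 1 (t - s)) a)) has_integral
      ?S (integral {0..t} (\<lambda>s. blinfun_apply (solop 1 (t - s)) (F s - F t))) + - ?\<phi> 0) {0..t}"
    by (rule has_integral_add[OF 1 2])
  then have "((\<lambda>s. K_op smc D A \<alpha> th (t - s) (F s)) has_integral
      ?S (integral {0..t} (\<lambda>s. blinfun_apply (solop 1 (t - s)) (F s - F t))) + - ?\<phi> 0) {0..t}"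
    \<comment> \<open>At s = t the kernel is taken at time 0, where \<open>K_op_eq\<close> says
      nothing.\<close>
    by (rule has_integral_spike[OF negligible_sing[of t], rotated])
      (auto simp: K_op_eq a_def blinfun.diff_right)
  then show ?thesis
    by (simp add: wop_def Vop_def a_def blinfun.diff_left blinfun.diff_right blinfun.add_right algebra_simps)
qed

text \<open>Integration by parts with G(t - s) (F s - F t), which vanishes at s = t because G is
  bounded. The boundary term at s = 0 is G(t) F t, since F 0 = 0.\<close>

lemma wop_smooth:
  assumes F: "holder_bound T \<sigma> H F" and \<sigma>: "0 < \<sigma>" and t: "0 < t" "t \<le> T" and F0: "F 0 = 0"
    and Fd: "\<And>s. (F has_vector_derivative f s) (at s)"
  shows "((\<lambda>s. blinfun_apply (solop 0 (t - s)) (f s)) has_integral wop F t) {0..t}"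
proof -
  let ?\<phi> = "\<lambda>s. blinfun_apply (solop 0 (t - s)) (F s - F t)"
  let ?k = "\<lambda>s. blinfun_apply (solop 1 (t - s)) (F s - F t)"
  have der: "(?\<phi> has_vector_derivative blinfun_apply (solop 0 (t - s)) (f s) - ?k s) (at s)" if "s < t" for s
  proof -
    have "(solop 0 has_vector_derivative solop 1 (t - s)) (at (t - s))" by (rule solop_derivative') (use that in simp)
    note d1 = reflected_derivative[OF this]
    have d2: "((\<lambda>s. F s - F t) has_vector_derivative f s) (at s)"
      using has_vector_derivative_diff[OF Fd[of s] has_vector_derivative_const[of "F t"]] by simp
    show ?thesis
      using bounded_bilinear.has_vector_derivative[OF bounded_bilinear_blinfun_apply d1 d2]
      by (simp add: blinfun.minus_left)
  qed
  have "((\<lambda>s. blinfun_apply (solop 0 (t - s)) (f s) - ?k s) has_integral - ?\<phi> 0) {0..t}"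
  proof (rule has_integral_vanishing_end[OF t(1) _ _ _ \<sigma>])
    show "continuous_on {0..<t} ?\<phi>"
      by (rule continuous_on_vector_derivative, rule has_vector_derivative_at_within, rule der) simp
    show "norm (?\<phi> s) \<le> solop_const * H * (t - s) powr \<sigma>" if "s \<in> {0..<t}" for s
      unfolding mult.assoc by (intro norm_apply_le norm_solop0 holder_boundD(2)[OF F]) (use that t in auto)
  qed (rule der, simp)
  from has_integral_add[OF this integrable_integral[OF solop1_increment_integrable(1)[OF F \<sigma>]]] t
  have "((\<lambda>s. blinfun_apply (solop 0 (t - s)) (f s)) has_integral - ?\<phi> 0 + integral {0..t} ?k) {0..t}"
    by simp
  then show ?thesis using F0 by (simp add: wop_def blinfun.minus_right add.commute)
qed

lemma wop_bound:
  assumes F: "holder_bound T \<sigma> H F" and F0: "F 0 = 0" and \<sigma>: "0 < \<sigma>" "\<sigma> < 1" and t: "0 \<le> t" "t \<le> T"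
  shows "norm (wop F t) \<le> holder_const \<sigma> * H * T powr \<sigma>"
proof -
  note W = wop_holder_bound[OF F F0 \<sigma>]
  have "norm (wop F t) \<le> holder_const \<sigma> * H * (t - 0) powr \<sigma>"
    using holder_boundD(1)[OF W, of 0 t] wop_zero[of F] F0 t by simp
  also have "\<dots> \<le> holder_const \<sigma> * H * T powr \<sigma>"
    using holder_boundD(3)[OF W, of 0 t] t \<sigma> by (intro mult_left_mono powr_mono2) auto
  finally show ?thesis .
qed

lemma wop_weighted_integrable:
  assumes F: "holder_bound T \<sigma> H F" and F0: "F 0 = 0" and \<sigma>: "0 < \<sigma>" "\<sigma> < 1" and t: "0 \<le> t" "t \<le> T"
  shows "continuous_on {0<..<t} (\<lambda>s. ((t - s) powr (\<alpha> - 1) / Gamma \<alpha>) *\<^sub>R wop F s)"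
    and "\<And>s. s \<in> {0<..<t} \<Longrightarrow> norm (((t - s) powr (\<alpha> - 1) / Gamma \<alpha>) *\<^sub>R wop F s)
      \<le> (holder_const \<sigma> * H * T powr \<sigma> / Gamma \<alpha>) * (t - s) powr (\<alpha> - 1)"
    and "(\<lambda>s. (holder_const \<sigma> * H * T powr \<sigma> / Gamma \<alpha>) * (t - s) powr (\<alpha> - 1)) integrable_on {0..t}"
    and "(\<lambda>s. ((t - s) powr (\<alpha> - 1) / Gamma \<alpha>) *\<^sub>R wop F s) integrable_on {0..t}"
proof -
  show c: "continuous_on {0<..<t} (\<lambda>s. ((t - s) powr (\<alpha> - 1) / Gamma \<alpha>) *\<^sub>R wop F s)"
    by (intro continuous_intros continuous_on_subset[OF holder_bound_continuous[OF wop_holder_bound[OF F F0 \<sigma>] \<sigma>(1)]])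
      (use t Gamma_pos in auto)
  show b: "norm (((t - s) powr (\<alpha> - 1) / Gamma \<alpha>) *\<^sub>R wop F s)
      \<le> (holder_const \<sigma> * H * T powr \<sigma> / Gamma \<alpha>) * (t - s) powr (\<alpha> - 1)" if "s \<in> {0<..<t}" for s
  proof -
    have "norm (wop F s) \<le> holder_const \<sigma> * H * T powr \<sigma>" by (rule wop_bound[OF F F0 \<sigma>]) (use that t in auto)
    from mult_left_mono[OF this, of "(t - s) powr (\<alpha> - 1) / Gamma \<alpha>"] show ?thesis
      using Gamma_pos by (simp add: mult_ac)
  qed
  show g: "(\<lambda>s. (holder_const \<sigma> * H * T powr \<sigma> / Gamma \<alpha>) * (t - s) powr (\<alpha> - 1)) integrable_on {0..t}"
    by (rule has_integral_integrable, rule has_integral_mult_right, rule has_integral_powr_reflect) (use \<alpha> t in auto)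
  show "(\<lambda>s. ((t - s) powr (\<alpha> - 1) / Gamma \<alpha>) *\<^sub>R wop F s) integrable_on {0..t}"
    by (rule integrable_dominated[OF interval_with_interior_Icc c g b])
qed

text \<open>J^\<alpha> of G * f is a double integral over the triangle 0 < r < s < t. Integrating in
  s first gives V(t - r) f(r), and V = S (G - I) together with the integral of f being F t yields S
  (w - F).\<close>

lemma frac_int_wop_smooth:
  assumes F: "holder_bound T \<sigma> H F" and \<sigma>: "0 < \<sigma>" "\<sigma> < 1" and t: "0 < t" "t \<le> T" and F0: "F 0 = 0"
    and Fd: "\<And>s. (F has_vector_derivative f s) (at s)" and fc: "continuous_on UNIV f"
  shows "frac_int \<alpha> (wop F) t = blinfun_apply Sinv (wop F t - F t)"
proof -
  let ?S = "blinfun_apply Sinv"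
  define k where "k s = (t - s) powr (\<alpha> - 1) / Gamma \<alpha>" for s
  define W where "W = {p :: real \<times> real. 0 < snd p \<and> snd p < fst p \<and> fst p < t}"
  define ff where "ff s r = k s *\<^sub>R blinfun_apply (solop 0 (s - r)) (f r)" for s r
  have "compact (f ` {0..t})" by (rule compact_continuous_image[OF continuous_on_subset[OF fc]]) auto
  then have "bounded (f ` {0..t})" by (rule compact_imp_bounded)
  then obtain Bf where Bf: "0 < Bf" "\<And>r. r \<in> {0..t} \<Longrightarrow> norm (f r) \<le> Bf" unfolding bounded_pos by auto
  have kc: "continuous_on {0<..<t} k" unfolding k_def by (intro continuous_intros) (use Gamma_pos in auto)
  have k0: "0 \<le> k s" for s using Gamma_pos by (simp add: k_def)
  have ki: "k integrable_on {0..t}"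
    unfolding k_def using has_integral_powr_reflect[of "\<alpha> - 1" t] \<alpha> t by (intro integrable_on_divide) auto
  have wopI: "((\<lambda>r. blinfun_apply (solop 0 (s - r)) (f r)) has_integral wop F s) {0..s}" if "0 < s" "s < t" for s
    by (rule wop_smooth[OF F \<sigma>(1) _ _ F0 Fd]) (use that t in auto)
  define F1 where "F1 s = (if s \<in> {0<..<t} then k s *\<^sub>R wop F s else 0)" for s
  define F2 where "F2 r = (if r \<in> {0<..<t} then blinfun_apply (Vop (t - r)) (f r) else 0)" for r
  have "integral {0..t} (\<lambda>s. k s *\<^sub>R wop F s) = ?S (wop F t - F t)"
  proof (rule fubini_banach[of W ff "\<lambda>s. if s \<in> {0<..<t} then k s else 0" "\<lambda>r. if r \<in> {0<..<t} then solop_const * Bf else 0" F1 F2])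
    show "open W" unfolding W_def by (intro open_Collect_conj open_Collect_less continuous_intros)
    show "continuous_on W (\<lambda>p. ff (fst p) (snd p))"
      unfolding ff_def
      by (intro continuous_on_scaleR continuous_on_compose2[OF kc] continuous_on_solop_apply continuous_on_compose2[OF fc] continuous_intros)
        (auto simp: W_def)
    show "norm (ff s r) \<le> (if s \<in> {0<..<t} then k s else 0) * (if r \<in> {0<..<t} then solop_const * Bf else 0)"
      if "(s, r) \<in> W" for s r
    proof -
      have sr: "0 < r" "r < s" "s < t" using that by (auto simp: W_def)
      have "norm (blinfun_apply (solop 0 (s - r)) (f r)) \<le> solop_const * Bf"
        by (intro norm_apply_le norm_solop0 Bf) (use sr in auto)
      from mult_left_mono[OF this k0[of s]] sr show ?thesis using k0[of s] by (simp add: ff_def)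
    qed
    show "integrable lborel (\<lambda>s. if s \<in> {0<..<t} then k s else 0)"
      by (rule integrable_lborel_interior[OF interval_with_interior_Icc kc k0 ki])
    show "integrable lborel (\<lambda>r. if r \<in> {0<..<t} then solop_const * Bf else 0)"
      by (rule integrable_lborel_interior[OF interval_with_interior_Icc]) (use solop_const_nonneg Bf in auto)
    show "((\<lambda>r. if (s, r) \<in> W then ff s r else 0) has_integral F1 s) UNIV" for s
    proof (cases "s \<in> {0<..<t}")
      case True
      have "((\<lambda>r. if r \<in> {0<..<s} then ff s r else 0) has_integral k s *\<^sub>R wop F s) UNIV"
        unfolding has_integral_interior_UNIV[OF interval_with_interior_Icc] ff_def
        by (rule has_integral_cmul[OF wopI]) (use True in auto)
      moreover have "(s, r) \<in> W \<longleftrightarrow> r \<in> {0<..<s}" for r using True by (auto simp: W_def)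
      ultimately show ?thesis using True by (simp add: F1_def)
    next
      case False
      then have "(s, r) \<notin> W" for r by (auto simp: W_def)
      moreover have "F1 s = 0" using False by (auto simp: F1_def)
      ultimately show ?thesis by simp
    qed
    show "((\<lambda>s. if (s, r) \<in> W then ff s r else 0) has_integral F2 r) UNIV" for r
    proof (cases "r \<in> {0<..<t}")
      case True
      \<comment> \<open>Shifting time by r turns the inner integral into J^\<alpha> G at t -
        r.\<close>
      have "((\<lambda>s. ff s r) \<circ> (+) r has_integral blinfun_apply (Vop (t - r)) (f r)) {0..t - r}"
        using frac_int_Vop[of "t - r" "f r"] True by (simp add: o_def ff_def k_def algebra_simps)
      then have "((\<lambda>s. ff s r) has_integral blinfun_apply (Vop (t - r)) (f r)) {r..t}"
        unfolding has_integral_shift_Icc_real by simp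
      then have "((\<lambda>s. if s \<in> {r<..<t} then ff s r else 0) has_integral blinfun_apply (Vop (t - r)) (f r)) UNIV"
        unfolding has_integral_interior_UNIV[OF interval_with_interior_Icc] .
      moreover have "(s, r) \<in> W \<longleftrightarrow> s \<in> {r<..<t}" for s using True by (auto simp: W_def)
      ultimately show ?thesis using True by (simp add: F2_def)
    next
      case False
      then have "(s, r) \<notin> W" for s by (auto simp: W_def)
      moreover have "F2 r = 0" using False by (auto simp: F2_def)
      ultimately show ?thesis by simp
    qed
    show "(F1 has_integral integral {0..t} (\<lambda>s. k s *\<^sub>R wop F s)) UNIV"
      unfolding F1_def has_integral_interior_UNIV[OF interval_with_interior_Icc]
      using wop_weighted_integrable(4)[OF F F0 \<sigma>, of t] t by (intro integrable_integral) (auto simp: k_def)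
    have a1: "((\<lambda>r. blinfun_apply (solop 0 (t - r)) (f r)) has_integral wop F t) {0..t}"
      by (rule wop_smooth[OF F \<sigma>(1) t F0 Fd])
    have a2: "(f has_integral F t - F 0) {0..t}"
      by (rule fundamental_theorem_of_calculus, use t in simp, rule has_vector_derivative_at_within, rule Fd)
    have "((\<lambda>r. ?S (blinfun_apply (solop 0 (t - r)) (f r) - f r)) has_integral ?S (wop F t - (F t - F 0))) {0..t}"
      using has_integral_linear[OF has_integral_diff[OF a1 a2] blinfun.bounded_linear_right[of Sinv]]
      by (simp add: o_def)
    then have "((\<lambda>r. blinfun_apply (Vop (t - r)) (f r)) has_integral ?S (wop F t - F t)) {0..t}"
      using F0 by (simp add: Vop_def blinfun.diff_left)
    then show "(F2 has_integral ?S (wop F t - F t)) UNIV"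
      unfolding F2_def has_integral_interior_UNIV[OF interval_with_interior_Icc] .
  qed
  then show ?thesis by (simp add: frac_int_def k_def)
qed

text \<open>The approximations share the constant H, so the majorant of the singular integrand does
  not depend on n, and pointwise convergence suffices.\<close>

lemma wop_tendsto:
  assumes Fn: "\<And>n. holder_bound T \<sigma> H (Fn n)" and F: "holder_bound T \<sigma> H F" and \<sigma>: "0 < \<sigma>"
    and lim: "\<And>t. t \<in> {0..T} \<Longrightarrow> (\<lambda>n. Fn n t) \<longlonglongrightarrow> F t" and t: "0 \<le> t" "t \<le> T"
  shows "(\<lambda>n. wop (Fn n) t) \<longlonglongrightarrow> wop F t"
  unfolding wop_def
proof (intro tendsto_add blinfun.tendsto tendsto_const lim)
  show "(\<lambda>n. integral {0..t} (\<lambda>s. blinfun_apply (solop 1 (t - s)) (Fn n s - Fn n t)))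
      \<longlonglongrightarrow> integral {0..t} (\<lambda>s. blinfun_apply (solop 1 (t - s)) (F s - F t))"
    by (rule dominated_convergence_interior[OF interval_with_interior_Icc
          solop1_increment_integrable(3)[OF Fn \<sigma> t] solop1_increment_integrable(3)[OF F \<sigma> t]
          solop1_increment_integrable(4)[OF F \<sigma> t] solop1_increment_integrable(2)[OF Fn \<sigma> t]])
      (use t lim in \<open>auto intro!: blinfun.tendsto tendsto_intros\<close>)
qed (use t in auto)

lemma frac_int_wop:
  assumes F: "holder_bound T \<sigma> H F" and \<sigma>: "0 < \<sigma>" "\<sigma> < 1" and t: "0 < t" "t \<le> T" and F0: "F 0 = 0"
  shows "frac_int \<alpha> (wop F) t = blinfun_apply Sinv (wop F t - F t)"
proof -
  obtain Fn fn where Fn: "\<And>n. holder_bound T \<sigma> H (Fn n)" "\<And>n. Fn n 0 = 0"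
    and fn: "\<And>n. continuous_on UNIV (fn n)" "\<And>n s. (Fn n has_vector_derivative fn n s) (at s)"
    and lim: "\<And>t. t \<in> {0..T} \<Longrightarrow> (\<lambda>n::nat. Fn n t) \<longlonglongrightarrow> F t"
    by (rule steklov_approximation[OF F F0 \<sigma>(1)]) (use t in auto)
  note t' = less_imp_le[OF t(1)] t(2)
  have "(\<lambda>n. frac_int \<alpha> (wop (Fn n)) t) \<longlonglongrightarrow> frac_int \<alpha> (wop F) t"
    unfolding frac_int_def
  proof (rule dominated_convergence_interior[OF interval_with_interior_Icc
        wop_weighted_integrable(1)[OF Fn \<sigma> t'] wop_weighted_integrable(1)[OF F F0 \<sigma> t']
        wop_weighted_integrable(3)[OF F F0 \<sigma> t'] wop_weighted_integrable(2)[OF Fn \<sigma> t']])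
    show "(\<lambda>n. ((t - s) powr (\<alpha> - 1) / Gamma \<alpha>) *\<^sub>R wop (Fn n) s) \<longlonglongrightarrow> ((t - s) powr (\<alpha> - 1) / Gamma \<alpha>) *\<^sub>R wop F s"
      if "s \<in> {0<..<t}" for s
      by (intro tendsto_intros wop_tendsto[OF Fn(1) F \<sigma>(1) lim]) (use that t in auto)
  qed
  moreover have "frac_int \<alpha> (wop (Fn n)) t = blinfun_apply Sinv (wop (Fn n) t - Fn n t)" for n
    by (rule frac_int_wop_smooth[OF Fn(1) \<sigma> t Fn(2) fn(2) fn(1)])
  moreover have "(\<lambda>n. blinfun_apply Sinv (wop (Fn n) t - Fn n t)) \<longlonglongrightarrow> blinfun_apply Sinv (wop F t - F t)"
    by (intro blinfun.tendsto tendsto_intros wop_tendsto[OF Fn(1) F \<sigma>(1) lim] lim) (use t in auto)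
  ultimately show ?thesis by (simp add: LIMSEQ_unique)
qed

end

section \<open>From Hoelder constants to the Hoelder norm, and the regularity theorem\<close>

lemma holder_norm_le:
  assumes v: "holder_bound T \<sigma> K v" and B: "\<And>t. t \<in> {0..T} \<Longrightarrow> norm (v t) \<le> B" and T: "0 < T"
  shows "holder_norm T \<sigma> v \<le> B + K"
  unfolding holder_norm_def
proof (rule add_mono)
  show "(SUP t\<in>{0..T}. norm (v t)) \<le> B" by (rule cSUP_least) (use T B in auto)
  show "(SUP p\<in>{(t, s). 0 \<le> t \<and> t < s \<and> s \<le> T}. norm (v (snd p) - v (fst p)) / (snd p - fst p) powr \<sigma>) \<le> K"
  proof (rule cSUP_least)
    have "(0, T) \<in> {(t, s). 0 \<le> t \<and> t < s \<and> s \<le> T}" using T by simp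
    then show "{(t, s). 0 \<le> t \<and> t < s \<and> s \<le> T} \<noteq> {}" by blast
  next
    fix p assume "p \<in> {(t, s). 0 \<le> t \<and> t < s \<and> s \<le> T}"
    then have p: "0 \<le> fst p" "fst p < snd p" "snd p \<le> T" by auto
    then show "norm (v (snd p) - v (fst p)) / (snd p - fst p) powr \<sigma> \<le> K"
      using holder_boundD(1)[OF v, of "fst p" "snd p"] by (simp add: divide_le_eq)
  qed
qed

text \<open>The suprema in \<open>holder_norm\<close> bound their members only once the sets are
  known to be bounded above; membership in \<open>holder_space\<close> supplies this, by compactness
  for the values and by its constant for the quotients.\<close>

lemma holder_bound_holder_norm:
  assumes F: "holder_space T \<sigma> F" and T: "0 < T"
  shows "holder_bound T \<sigma> (holder_norm T \<sigma> F) F"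
proof -
  let ?P = "{(t, s). 0 \<le> t \<and> t < s \<and> s \<le> T}"
  let ?q = "\<lambda>p. norm (F (snd p) - F (fst p)) / (snd p - fst p) powr \<sigma>"
  obtain M where M: "\<And>t s. 0 \<le> t \<Longrightarrow> t < s \<Longrightarrow> s \<le> T \<Longrightarrow> norm (F s - F t) \<le> M * (s - t) powr \<sigma>"
    using F unfolding holder_space_def by blast
  have bq: "bdd_above (?q ` ?P)"
  proof (rule bdd_aboveI2)
    fix p assume "p \<in> ?P"
    then show "?q p \<le> M" using M[of "fst p" "snd p"] by (auto simp: divide_le_eq)
  qed
  have "compact ((\<lambda>t. norm (F t)) ` {0..T})"
    using F by (intro compact_continuous_image continuous_intros) (auto simp: holder_space_def)
  then have bn: "bdd_above ((\<lambda>t. norm (F t)) ` {0..T})"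
    by (intro bounded_imp_bdd_above compact_imp_bounded)
  have s0: "0 \<le> (SUP t\<in>{0..T}. norm (F t))"
    by (rule order_trans[OF norm_ge_zero cSUP_upper[OF _ bn, of 0]]) (use T in simp)
  have q: "?q p \<le> holder_norm T \<sigma> F" if "p \<in> ?P" for p
    using cSUP_upper[OF that bq] s0 unfolding holder_norm_def by linarith
  show ?thesis
    unfolding holder_bound_def
  proof (intro conjI allI impI)
    have "0 \<le> ?q (0, T)" by simp
    also have "\<dots> \<le> holder_norm T \<sigma> F" by (rule q) (use T in simp)
    finally show "0 \<le> holder_norm T \<sigma> F" .
    fix s t assume h: "0 \<le> s \<and> s \<le> t \<and> t \<le> T"
    show "norm (F t - F s) \<le> holder_norm T \<sigma> F * (t - s) powr \<sigma>"
      using q[of "(s, t)"] h by (cases "s = t") (auto simp: divide_le_eq)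
  qed
qed

lemma holder_bound_imp_holder_space:
  assumes "holder_bound T \<sigma> H F" "0 < \<sigma>" shows "holder_space T \<sigma> F"
  unfolding holder_space_def
  using holder_bound_continuous[OF assms] holder_boundD(1)[OF assms(1)] by (meson less_imp_le)

lemma holder_bound_diff:
  assumes "holder_bound T \<sigma> H F" "holder_bound T \<sigma> K G"
  shows "holder_bound T \<sigma> (H + K) (\<lambda>t. F t - G t)"
  unfolding holder_bound_def
proof (intro conjI allI impI)
  show "0 \<le> H + K" using assms by (simp add: holder_bound_def)
  fix s t assume h: "0 \<le> s \<and> s \<le> t \<and> t \<le> T"
  have "norm ((F t - F s) - (G t - G s)) \<le> H * (t - s) powr \<sigma> + K * (t - s) powr \<sigma>"
    using h by (intro order_trans[OF norm_triangle_ineq4] add_mono holder_boundD(1)[OF assms(1)] holder_boundD(1)[OF assms(2)]) auto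
  then show "norm (F t - G t - (F s - G s)) \<le> (H + K) * (t - s) powr \<sigma>" by (simp add: algebra_simps)
qed

lemma holder_bound_cong:
  assumes "holder_bound T \<sigma> H F" "\<And>t. t \<in> {0..T} \<Longrightarrow> F t = G t"
  shows "holder_bound T \<sigma> H G"
  using assms unfolding holder_bound_def by (auto simp: order_trans)

text \<open>Vanishing at 0 lets the seminorm control the supremum norm, at the price of the factor
  T^\<sigma>.\<close>

lemma holder_norm_le_vanishing:
  assumes v: "holder_bound T \<sigma> K v" and v0: "v 0 = 0" and T: "0 < T" and \<sigma>: "0 < \<sigma>"
  shows "holder_norm T \<sigma> v \<le> K * T powr \<sigma> + K"
proof (rule holder_norm_le[OF v _ T])
  fix t assume t: "t \<in> {0..T}"
  have "norm (v t) \<le> K * (t - 0) powr \<sigma>" using holder_boundD(1)[OF v, of 0 t] v0 t by simp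
  also have "\<dots> \<le> K * T powr \<sigma>"
    using t \<sigma> v by (intro mult_left_mono powr_mono2) (auto simp: holder_bound_def)
  finally show "norm (v t) \<le> K * T powr \<sigma>" .
qed

theorem theorem6p2:
  fixes smc :: "complex \<Rightarrow> 'x::banach \<Rightarrow> 'x"
    and D :: "'x set" and A :: "'x \<Rightarrow> 'x"
    and \<alpha> th T \<sigma> :: real
  assumes "complex_structure smc"
    and "condition_A smc D A th"
    and "0 < \<alpha>" and "\<alpha> < 1" and "0 < T"
    and "0 < \<sigma>" and "\<sigma> < 1 - \<alpha>"
  shows "\<exists>C>0. \<forall>F :: real \<Rightarrow> 'x. holder_space T \<sigma> F \<and> F 0 = 0 \<longrightarrow>
           (let u = (\<lambda>t. integral {0..t} (\<lambda>s. K_op smc D A \<alpha> th (t - s) (F s))) in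
              (\<forall>t\<in>{0..T}. u t \<in> D) \<and>
              holder_space T \<sigma> (\<lambda>t. A (u t)) \<and>
              (\<exists>w. holder_space T \<sigma> w \<and>
                   (\<forall>t\<in>{0..T}. u t = frac_int \<alpha> w t) \<and>
                   (\<forall>t. 0 < t \<and> t < T \<longrightarrow> w t = A (u t) + F t) \<and>
                   holder_norm T \<sigma> (\<lambda>t. A (u t)) + holder_norm T \<sigma> w \<le> C * holder_norm T \<sigma> F))"
proof -
  interpret sectorial smc D A \<alpha> th by unfold_locales (fact assms)+
  note T = \<open>0 < T\<close>
  have \<sigma>: "0 < \<sigma>" "\<sigma> < 1" using assms by auto
  define K where "K = holder_const \<sigma>"
  have K0: "0 \<le> K" unfolding K_def by (rule holder_const_nonneg[OF \<sigma>])
  \<comment> \<open>w has Hoelder constant K H and A u = w - F has (K + 1) H. Both vanish at 0, so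
    each constant is multiplied by T^\<sigma> + 1 in the norm.\<close>
  define C where "C = (2 * K + 1) * (T powr \<sigma> + 1)"
  have C0: "0 < C" using K0 by (simp add: C_def add_nonneg_pos)
  show ?thesis
  proof (intro exI[of _ C] conjI C0 allI impI, elim conjE)
    fix F :: "real \<Rightarrow> 'x" assume Fs: "holder_space T \<sigma> F" and F0: "F 0 = 0"
    define H where "H = holder_norm T \<sigma> F"
    have F: "holder_bound T \<sigma> H F" unfolding H_def by (rule holder_bound_holder_norm[OF Fs T])
    define u where "u t = integral {0..t} (\<lambda>s. K_op smc D A \<alpha> th (t - s) (F s))" for t
    have ut: "u t = blinfun_apply Sinv (wop F t - F t)" if "t \<in> {0..T}" for t
    proof (cases "t = 0")
      case True
      then show ?thesis using F0 wop_zero[of F] by (simp add: u_def blinfun.zero_right)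
    next
      case False
      then show ?thesis unfolding u_def using that by (intro integral_unique K_convolution[OF F \<sigma>(1)]) auto
    qed
    have uf: "u t = frac_int \<alpha> (wop F) t" if "t \<in> {0..T}" for t
    proof (cases "t = 0")
      case True
      then show ?thesis by (simp add: u_def frac_int_def)
    next
      case False
      then show ?thesis using ut[OF that] frac_int_wop[OF F \<sigma> _ _ F0, of t] that by simp
    qed
    have uD: "u t \<in> D" and Au: "A (u t) = wop F t - F t" if "t \<in> {0..T}" for t
      using ut[OF that] Sinv_mem A_Sinv by simp_all
    have w: "holder_bound T \<sigma> (K * H) (wop F)" unfolding K_def by (rule wop_holder_bound[OF F F0 \<sigma>])
    have Auh: "holder_bound T \<sigma> (K * H + H) (\<lambda>t. A (u t))"
      by (rule holder_bound_cong[OF holder_bound_diff[OF w F]]) (simp add: Au)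
    have "holder_norm T \<sigma> (\<lambda>t. A (u t)) + holder_norm T \<sigma> (wop F)
        \<le> ((K * H + H) * T powr \<sigma> + (K * H + H)) + (K * H * T powr \<sigma> + K * H)"
      by (intro add_mono holder_norm_le_vanishing[OF Auh _ T \<sigma>(1)] holder_norm_le_vanishing[OF w _ T \<sigma>(1)])
        (use Au[of 0] F0 T wop_zero[of F] in auto)
    also have "\<dots> = C * H" by (simp add: C_def algebra_simps)
    finally have nb: "holder_norm T \<sigma> (\<lambda>t. A (u t)) + holder_norm T \<sigma> (wop F) \<le> C * holder_norm T \<sigma> F"
      by (simp add: H_def)
    \<comment> \<open>The derivative of order \<alpha> is the inverse of J^\<alpha>, so the role of
      \<partial>_t^\<alpha> u is played by a function w with u = J^\<alpha> w; the witness is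
      \<open>wop F\<close>.\<close>
    have "(\<forall>t\<in>{0..T}. u t \<in> D) \<and> holder_space T \<sigma> (\<lambda>t. A (u t)) \<and>
              (\<exists>w. holder_space T \<sigma> w \<and> (\<forall>t\<in>{0..T}. u t = frac_int \<alpha> w t) \<and>
                   (\<forall>t. 0 < t \<and> t < T \<longrightarrow> w t = A (u t) + F t) \<and>
                   holder_norm T \<sigma> (\<lambda>t. A (u t)) + holder_norm T \<sigma> w \<le> C * holder_norm T \<sigma> F)"
      using uD uf Au nb holder_bound_imp_holder_space[OF Auh \<sigma>(1)] holder_bound_imp_holder_space[OF w \<sigma>(1)]
      by (intro conjI exI[of _ "wop F"]) auto
    then show "let u = (\<lambda>t. integral {0..t} (\<lambda>s. K_op smc D A \<alpha> th (t - s) (F s))) in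
              (\<forall>t\<in>{0..T}. u t \<in> D) \<and> holder_space T \<sigma> (\<lambda>t. A (u t)) \<and>
              (\<exists>w. holder_space T \<sigma> w \<and> (\<forall>t\<in>{0..T}. u t = frac_int \<alpha> w t) \<and>
                   (\<forall>t. 0 < t \<and> t < T \<longrightarrow> w t = A (u t) + F t) \<and>
                   holder_norm T \<sigma> (\<lambda>t. A (u t)) + holder_norm T \<sigma> w \<le> C * holder_norm T \<sigma> F)"
      unfolding Let_def u_def[abs_def] .
  qed
qed

end
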